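(* Let $\mu_0>\sqrt{48}$ and let $\kappa>1$. For every $\delta>0$ there exists $\varepsilon>0$ such that the following holds. Let $\mathbf{u}^{*}=u_r^{*}(\theta)\mathbf{e}_r+u_\theta^{*}(\theta)\mathbf{e}_\theta\in C^{\infty}(\partial B;\mathbb{R}^2)$ satisfy the zero flux condition $\int_{\partial B}\mathbf{u}^{*}\cdot\mathbf{n}\,\mathrm{d}\sigma=0$ and be $\varepsilon$-close to $\mu_0\mathbf{e}_\theta$ in the sense that $$\Big|\frac1{2\pi}\int_{-\pi}^{\pi}u_\theta^{*}(\theta)\,\mathrm{d}\theta-\mu_0\Big|<\varepsilon,\qquad \sup_{n\in\mathbb{Z}\setminus\{0\}}(1+|n|)^{\kappa+3}\big(|u_n^{*}|+|v_n^{*}|\big)<\varepsilon,$$ where $u_n^{*}=\frac{1}{2\pi}\int_{-\pi}^{\pi}u_r^{*}(\theta)e^{-in\theta}\,\mathrm{d}\theta$ and $v_n^{*}=\frac{1}{2\pi}\int_{-\pi}^{\pi}u_\theta^{*}(\theta)e^{-in\theta}\,\mathrm{d}\theta$. Then there exists at least one solution $(\mathbf{u},p)\in C^{\infty}(\mathbb{R}^2\setminus\overline{B})^2\times C^{\infty}(\mathbb{R}^2\setminus\overline{B})$ of $$\Delta\mathbf{u}-\nabla p=\mathbf{u}\cdot\nabla\mathbf{u},\qquad \operatorname{div}\mathbf{u}=0\qquad\text{in }\mathbb{R}^2\setminus\overline{B},$$ with boundary conditions $$\mathbf{u}|_{\partial B}=\mathbf{u}^{*},\qquad \lim_{|\mathbf{x}|\to\infty}\mathbf{u}(\mathbf{x})=0.$$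 Moreover, there exists $\mu\in\mathbb{R}$ with $|\mu-\mu_0|<\delta$ such that $$\lim_{r\to\infty} r\,\Big\|\mathbf{u}(r,\cdot)-\frac{\mu\,\mathbf{e}_\theta}{r}\Big\|_{L^{\infty}(-\pi,\pi)}=0.$$
   Context: $B\subset\mathbb{R}^2$ is the open unit disk centered at the origin, $\mathbf{n}$ is the unit normal on $\partial B$, $(r,\theta)$ are polar coordinates centered at the origin with $\theta\in(-\pi,\pi)$, and $(\mathbf{e}_r,\mathbf{e}_\theta)$ is the associated local orthonormal basis. The boundary condition on $\partial B$ is attained continuously. *)

theory Defs
  imports "HOL-Analysis.Analysis" "HOL-Probability.Essential_Supremum"
begin

text \<open>Both definitions are meant for open \<open>S\<close>: the iterated derivatives are the full Frechet
  derivatives \<open>at x\<close>, not those relative to \<open>S\<close>.\<close>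

fun Ck_on :: "nat \<Rightarrow> ('a::real_normed_vector \<Rightarrow> 'b::real_normed_vector) \<Rightarrow> 'a set \<Rightarrow> bool" where
  "Ck_on 0 f S \<longleftrightarrow> continuous_on S f"
| "Ck_on (Suc k) f S \<longleftrightarrow>
     f differentiable_on S \<and> (\<forall>v. Ck_on k (\<lambda>x. frechet_derivative f (at x) v) S)"

definition smooth_on :: "('a::real_normed_vector \<Rightarrow> 'b::real_normed_vector) \<Rightarrow> 'a set \<Rightarrow> bool" where
  "smooth_on f S \<longleftrightarrow> (\<forall>k. Ck_on k f S)"

definition partial :: "'n \<Rightarrow> (real ^ 'n::finite \<Rightarrow> 'b::real_normed_vector) \<Rightarrow> real ^ 'n \<Rightarrow> 'b" where
  "partial i f x = frechet_derivative f (at x) (axis i 1)"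

definition gradient :: "(real ^ 'n::finite \<Rightarrow> real) \<Rightarrow> real ^ 'n \<Rightarrow> real ^ 'n" where
  "gradient p x = (\<chi> i. partial i p x)"

definition divergence :: "(real ^ 'n::finite \<Rightarrow> real ^ 'n) \<Rightarrow> real ^ 'n \<Rightarrow> real" where
  "divergence u x = (\<Sum>i\<in>UNIV. partial i u x $ i)"

definition laplacian :: "(real ^ 'n::finite \<Rightarrow> 'b::real_normed_vector) \<Rightarrow> real ^ 'n \<Rightarrow> 'b" where
  "laplacian u x = (\<Sum>i\<in>UNIV. partial i (partial i u) x)"

definition advection ::
  "(real ^ 'n::finite \<Rightarrow> real ^ 'n) \<Rightarrow> (real ^ 'n \<Rightarrow> 'b::real_normed_vector) \<Rightarrow> real ^ 'n \<Rightarrow> 'b" where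
  "advection u w x = (\<Sum>i\<in>UNIV. u x $ i *\<^sub>R partial i w x)"

definition e_r :: "real \<Rightarrow> real ^ 2" where
  "e_r \<theta> = vector [cos \<theta>, sin \<theta>]"

definition e_theta :: "real \<Rightarrow> real ^ 2" where
  "e_theta \<theta> = vector [- sin \<theta>, cos \<theta>]"

definition smooth_on_circle :: "(real ^ 2 \<Rightarrow> 'b::real_normed_vector) \<Rightarrow> bool" where
  "smooth_on_circle g \<longleftrightarrow> smooth_on (\<lambda>\<theta>. g (e_r \<theta>)) UNIV"

definition circle_integral :: "(real ^ 2 \<Rightarrow> real) \<Rightarrow> real" where
  "circle_integral f = integral {-pi..pi} (\<lambda>\<theta>. f (e_r \<theta>))"

text \<open>\<open>radial_part g\<close> and \<open>angular_part g\<close> are the polar components, as functions of the angle, of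
  the restriction of the vector field \<open>g\<close> to the unit circle, whose point at angle \<open>\<theta>\<close> is
  \<open>e_r \<theta>\<close>.\<close>

definition radial_part :: "(real ^ 2 \<Rightarrow> real ^ 2) \<Rightarrow> real \<Rightarrow> real" where
  "radial_part g \<theta> = g (e_r \<theta>) \<bullet> e_r \<theta>"

definition angular_part :: "(real ^ 2 \<Rightarrow> real ^ 2) \<Rightarrow> real \<Rightarrow> real" where
  "angular_part g \<theta> = g (e_r \<theta>) \<bullet> e_theta \<theta>"

lemma polar_components:
  "g (e_r \<theta>) = radial_part g \<theta> *\<^sub>R e_r \<theta> + angular_part g \<theta> *\<^sub>R e_theta \<theta>"
proof -
  have eq: "a = (a * c + b * s) * c - (b * c - a * s) * s"
    and eq': "b = (a * c + b * s) * s + (b * c - a * s) * c"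
    if "c\<^sup>2 + s\<^sup>2 = 1" for a b c s :: real
    using that by algebra+
  show ?thesis
    using eq[of "cos \<theta>" "sin \<theta>"] eq'[of "cos \<theta>" "sin \<theta>"]
    by (simp add: vec_eq_iff forall_2 radial_part_def angular_part_def e_r_def e_theta_def
        inner_vec_def sum_2)
qed

definition fourier_coeff :: "(real \<Rightarrow> real) \<Rightarrow> int \<Rightarrow> complex" where
  "fourier_coeff f n =
     1 / (2 * pi) * integral {-pi..pi} (\<lambda>\<theta>. of_real (f \<theta>) * exp (- (\<i> * of_int n * of_real \<theta>)))"

text \<open>Extended-real valued, so that smallness of the norm includes finiteness.\<close>

definition Linf_norm :: "(real \<Rightarrow> 'b::real_normed_vector) \<Rightarrow> ereal" where
  "Linf_norm f = esssup (lebesgue_on {-pi<..<pi}) (\<lambda>\<theta>. ereal (norm (f \<theta>)))"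

definition exterior :: "(real ^ 2) set" where
  "exterior = - closure (ball 0 1)"

text \<open>The boundary values are attained continuously: the velocity is continuous up to the
  unit circle, where it coincides with \<open>ustar\<close>.\<close>

definition steady_NS_solution ::
  "(real ^ 2 \<Rightarrow> real ^ 2) \<Rightarrow> (real ^ 2 \<Rightarrow> real ^ 2) \<Rightarrow> (real ^ 2 \<Rightarrow> real) \<Rightarrow> bool" where
  "steady_NS_solution ustar u p \<longleftrightarrow>
     smooth_on u exterior \<and> smooth_on p exterior \<and>
     (\<forall>x\<in>exterior. laplacian u x - gradient p x = advection u u x) \<and>
     (\<forall>x\<in>exterior. divergence u x = 0) \<and>
     continuous_on (closure exterior) u \<and>
     (\<forall>x\<in>frontier (ball 0 1). u x = ustar x) \<and>
     (u \<longlongrightarrow> 0) at_infinity"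

end

theory Submission
  imports Defs "HOL-Library.Nat_Bijection"
begin

text \<open>Write \<open>s = ln r\<close> and expand everything in Fourier series in the angle. The velocity is
  the rotated gradient of a stream function \<open>\<psi> = \<mu>\<^sub>0 s + \<phi>\<close>, and the modes of \<open>\<psi>\<close>, of the
  vorticity \<open>w\<close> and of the total head \<open>H = p + |u|^2 / 2\<close> satisfy the system
  \<open>\<psi>'' = n^2 \<psi> + e^(2s) w\<close>, \<open>w' = i n H - (\<psi>_\<theta> w)_n\<close>, \<open>H' = - i n w + (\<psi>_s w)_n\<close>, which is the
  steady Navier-Stokes system in disguise (\<open>steady_NS_of_mode_system\<close>). Keeping \<open>H\<close> as an
  unknown makes the pressure single-valued: in the mode \<open>n = 0\<close> the second equation contains
  no \<open>H\<close>.

  Linearised at the swirl \<open>\<mu>\<^sub>0 s\<close>, the mode \<open>w_n\<close> solves \<open>w'' = (n^2 + i \<mu>\<^sub>0 n) w\<close>, so its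
  decaying solution is \<open>r\<close> to the power \<open>- \<zeta>_n\<close> with \<open>\<zeta>_n = sqrt (n^2 + i \<mu>\<^sub>0 n)\<close>. The
  condition \<open>\<mu>\<^sub>0 > sqrt 48\<close> says exactly that \<open>Re \<zeta>_1 > 2\<close> for a positive swirl. Then the
  vorticity decays faster than \<open>r^-2\<close>, the source \<open>e^(2s) w\<close> of the stream function decays in
  \<open>s\<close>, and the velocity differs from a multiple of \<open>e_\<theta> / r\<close> by a term that is small compared
  with \<open>1 / r\<close>.

  The nonlinear problem becomes a fixed point problem for the vorticity modes. Given \<open>w\<close>, the
  stream function is found by integrating from infinity and from the circle; given the
  quadratic terms, the vorticity equation is solved by variation of constants, and the one
  free constant in each mode \<open>n \<noteq> 0\<close> is spent on the tangential boundary value. In a weighted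
  sup norm that carries the factors \<open>(1 + |n|)^-2\<close> and \<open>exp (- (a + c |n|) s)\<close>, with \<open>a > 2\<close>
  and \<open>c > 0\<close>, convolution is bounded, so the map contracts a small ball
  (\<open>fix_map_contraction\<close>) and has a fixed point (\<open>fix_map_fixpoint_exists\<close>); uniqueness makes
  it the mode family of a real field (\<open>real_fixpoint_exists\<close>). In the mode \<open>n = 0\<close> there is no
  constant to choose for \<open>w_0\<close>; the circulation at infinity adjusts itself instead, and this
  is the value \<open>\<mu>\<close>, close to \<open>\<mu>\<^sub>0\<close> (\<open>mode_solution_exists\<close>).

  Smoothness comes from the weights. For \<open>s > 0\<close> the factor \<open>exp (- c |n| s)\<close> beats every
  power of \<open>n\<close>, the system expresses each \<open>s\<close>-derivative through the unknowns themselves, and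
  induction on the order gives smooth mode families (\<open>smooth_fam_bootstrap\<close>), whose Fourier
  sums are smooth functions in the exterior (\<open>smooth_on_lin_synth\<close>). At the circle only
  absolute summability is left, which gives continuity; that the Fourier sum equals the
  prescribed data is Fourier inversion (\<open>fourier_inversion\<close>).\<close>

section \<open>Weighted sums over the integers\<close>

text \<open>The modes are measured against this weight: it is summable, and by \<open>wt_conv_le\<close> it
  survives convolution up to a constant.\<close>

definition wt :: "int \<Rightarrow> real" where
  "wt n = 1 / (1 + real_of_int \<bar>n\<bar>) ^ 2"

lemma wt_pos: "0 < wt n"
proof -
  have "0 < 1 + real_of_int \<bar>n\<bar>" by linarith
  then show ?thesis unfolding wt_def by simp
qed

lemma wt_minus [simp]: "wt (- n) = wt n"
  by (simp add: wt_def)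

lemma wt_summable: "wt summable_on UNIV"
proof -
  have 1: "summable (\<lambda>k::nat. wt (int k))"
    unfolding wt_def using inverse_squares_sums
    by (simp add: sums_iff inverse_eq_divide add.commute)
  then have a: "(\<lambda>k::nat. wt (int k)) summable_on UNIV"
    by (subst summable_on_UNIV_nonneg_real_iff) (auto simp: less_imp_le[OF wt_pos])
  have "wt summable_on range int"
    by (subst summable_on_reindex) (use a in \<open>auto simp: o_def\<close>)
  moreover have "wt summable_on range (\<lambda>k::nat. - int k)"
    by (subst summable_on_reindex) (use a in \<open>auto simp: o_def inj_on_def\<close>)
  ultimately have "wt summable_on (range int \<union> range (\<lambda>k::nat. - int k))"
    by (rule summable_on_union)
  moreover have "range int \<union> range (\<lambda>k::nat. - int k) = (UNIV :: int set)"
    by (auto simp: image_iff) (metis int_cases2)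
  ultimately show ?thesis by simp
qed

definition wt_total :: real where "wt_total = (\<Sum>\<^sub>\<infinity>n. wt n)"

lemma wt_total_nonneg: "0 \<le> wt_total"
  unfolding wt_total_def by (rule infsum_nonneg) (simp add: less_imp_le[OF wt_pos])

lemma norm_infsum_le_majorant:
  fixes f :: "'i \<Rightarrow> 'b::banach"
  assumes "b summable_on A" "\<And>n. n \<in> A \<Longrightarrow> norm (f n) \<le> b n"
  shows "f summable_on A" "norm (infsum f A) \<le> infsum b A"
proof -
  have "(\<lambda>x. norm (f x)) summable_on A"
    using assms by (rule Infinite_Sum.abs_summable_on_comparison_test')
  then show s: "f summable_on A" by (rule abs_summable_summable)
  show "norm (infsum f A) \<le> infsum b A"
    using has_sum_infsum[OF s] has_sum_infsum[OF assms(1)] assms(2) by (rule norm_infsum_le)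
qed

lemma continuous_on_infsum_majorant:
  fixes f :: "'i \<Rightarrow> 'a::topological_space \<Rightarrow> 'b::banach"
  assumes "b summable_on A" "\<And>n x. n \<in> A \<Longrightarrow> x \<in> S \<Longrightarrow> norm (f n x) \<le> b n"
    "\<And>n. n \<in> A \<Longrightarrow> continuous_on S (f n)"
  shows "continuous_on S (\<lambda>x. \<Sum>\<^sub>\<infinity>n\<in>A. f n x)"
proof (rule uniform_limit_theorem)
  show "uniform_limit S (\<lambda>X y. \<Sum>x\<in>X. f x y) (\<lambda>y. \<Sum>\<^sub>\<infinity>x\<in>A. f x y) (finite_subsets_at_top A)"
    by (rule Weierstrass_m_test_general) (use assms in auto)
  show "\<forall>\<^sub>F X in finite_subsets_at_top A. continuous_on S (\<lambda>y. \<Sum>x\<in>X. f x y)"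
    by (rule eventually_finite_subsets_at_top_weakI) (use assms(3) in \<open>auto intro!: continuous_on_sum\<close>)
qed simp

lemma sums_int_decode:
  fixes g :: "int \<Rightarrow> 'c::banach"
  assumes "g summable_on UNIV"
  shows "(\<lambda>k. g (int_decode k)) sums (\<Sum>\<^sub>\<infinity>n. g n)"
proof -
  have "((\<lambda>k. g (int_decode k)) has_sum (\<Sum>\<^sub>\<infinity>n. g n)) UNIV"
    using has_sum_infsum[OF assms] has_sum_reindex_bij_betw[OF bij_int_decode, of g] by blast
  then show ?thesis by (rule has_sum_imp_sums)
qed

text
  \<open>Termwise differentiation for sums over the integers. An enumeration of the integers turns the sum into a series over the natural numbers, to which termwise differentiation of series applies; absolute convergence makes the enumeration irrelevant, and the majorant makes the tails of the differentiated series uniformly small.\<close>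

lemma has_derivative_infsum_int:
  fixes f :: "int \<Rightarrow> 'a::real_normed_vector \<Rightarrow> 'b::banach"
  assumes S: "open S" "convex S"
    and d: "\<And>n x. x \<in> S \<Longrightarrow> (f n has_derivative f' n x) (at x)"
    and b': "\<And>n x h. x \<in> S \<Longrightarrow> norm (f' n x h) \<le> b n * norm h"
    and b: "\<And>n x. x \<in> S \<Longrightarrow> norm (f n x) \<le> b n"
    and sb: "b summable_on UNIV"
    and x: "x \<in> S"
  shows "((\<lambda>x. \<Sum>\<^sub>\<infinity>n. f n x) has_derivative (\<lambda>h. \<Sum>\<^sub>\<infinity>n. f' n x h)) (at x)"
proof -
  let ?d = int_decode
  have b0: "0 \<le> b n" for n using b[OF x, of n] norm_ge_zero order_trans by blast
  define g' where "g' x h = (\<Sum>\<^sub>\<infinity>n. f' n x h)" for x h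
  have B: "(\<lambda>k. b (?d k)) sums (\<Sum>\<^sub>\<infinity>n. b n)" using sb by (rule sums_int_decode)
  have tail: "\<forall>\<^sub>F n in sequentially. (\<Sum>\<^sub>\<infinity>n. b n) - (\<Sum>i<n. b (?d i)) < e" if "e > 0" for e
  proof -
    have "\<forall>\<^sub>F n in sequentially. dist (\<Sum>i<n. b (?d i)) (\<Sum>\<^sub>\<infinity>n. b n) < e"
      using B that unfolding sums_def tendsto_iff by blast
    then show ?thesis by eventually_elim (auto simp: dist_real_def)
  qed
  have "\<exists>g. \<forall>x\<in>S. (\<lambda>k. f (?d k) x) sums g x \<and> (g has_derivative g' x) (at x within S)"
  proof (rule has_derivative_series[where f'="\<lambda>k. f' (?d k)"])
    show "(f (?d n) has_derivative f' (?d n) x) (at x within S)" if "x \<in> S" for n x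
      by (rule has_derivative_at_withinI[OF d[OF that]])
    show "(\<lambda>k. f (?d k) x) sums (\<Sum>\<^sub>\<infinity>n. f n x)"
      by (rule sums_int_decode) (rule norm_infsum_le_majorant(1)[OF sb b[OF x]])
    fix e :: real assume "e > 0"
    from tail[OF this] show "\<forall>\<^sub>F n in sequentially. \<forall>x\<in>S. \<forall>h. norm ((\<Sum>i<n. f' (?d i) x h) - g' x h) \<le> e * norm h"
    proof eventually_elim
      case (elim n)
      show ?case
      proof (intro ballI allI)
        fix x h :: 'a assume xS: "x \<in> S"
        have sb': "(\<lambda>n. b n * norm h) summable_on UNIV" using sb by (rule summable_on_cmult_left)
        have F: "(\<lambda>k. f' (?d k) x h) sums g' x h"
          unfolding g'_def by (rule sums_int_decode) (rule norm_infsum_le_majorant(1)[OF sb' b'[OF xS]])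
        have sB: "summable (\<lambda>k. b (?d k))" "summable (\<lambda>k. b (?d (k + n)))"
          using B summable_ignore_initial_segment[of "\<lambda>k. b (?d k)" n] by (simp_all add: sums_iff)
        have "norm (\<Sum>k. f' (?d (k + n)) x h) \<le> (\<Sum>k. b (?d (k + n)) * norm h)"
        proof (rule norm_suminf_le)
          show "norm (f' (?d (k + n)) x h) \<le> b (?d (k + n)) * norm h" for k by (rule b'[OF xS])
          show "summable (\<lambda>k. b (?d (k + n)) * norm h)" by (rule summable_mult2[OF sB(2)])
        qed
        also have "\<dots> = (\<Sum>k. b (?d (k + n))) * norm h"
          by (rule suminf_mult2[OF sB(2), symmetric])
        also have "(\<Sum>k. b (?d (k + n))) = (\<Sum>\<^sub>\<infinity>n. b n) - (\<Sum>i<n. b (?d i))"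
          using suminf_minus_initial_segment[OF sB(1), of n] sums_unique[OF B] by simp
        also have "\<dots> * norm h \<le> e * norm h" using elim by (intro mult_right_mono) auto
        finally have "norm (\<Sum>k. f' (?d (k + n)) x h) \<le> e * norm h" .
        moreover have "(\<Sum>k. f' (?d (k + n)) x h) = g' x h - (\<Sum>i<n. f' (?d i) x h)"
          using suminf_minus_initial_segment[OF sums_summable[OF F], of n] sums_unique[OF F] by simp
        ultimately show "norm ((\<Sum>i<n. f' (?d i) x h) - g' x h) \<le> e * norm h"
          by (simp add: norm_minus_commute)
      qed
    qed
  qed (use S x in auto)
  then obtain g where gg: "\<forall>x\<in>S. (\<lambda>k. f (?d k) x) sums g x \<and> (g has_derivative g' x) (at x within S)"
    by (rule exE)
  have eq: "g x = (\<Sum>\<^sub>\<infinity>n. f n x)" if "x \<in> S" for x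
    using sums_unique2[OF conjunct1[OF bspec[OF gg that]] sums_int_decode[OF norm_infsum_le_majorant(1)[OF sb b[OF that]]]] by simp
  have gd: "(g has_derivative g' x) (at x within S)" using gg x by simp
  have "(g has_derivative g' x) (at x)" using gd by (simp only: at_within_open[OF x S(1)])
  then have "((\<lambda>x. \<Sum>\<^sub>\<infinity>n. f n x) has_derivative g' x) (at x)"
    using S(1) x by (rule has_derivative_transform_within_open) (use eq in auto)
  then show ?thesis unfolding g'_def .
qed

section \<open>Convolution of mode families\<close>

text \<open>In \<open>f n s\<close> the integer is the Fourier index in the angle and the real number is the
  logarithm of the radius.\<close>

type_synonym modes = "int \<Rightarrow> real \<Rightarrow> complex"

definition conv :: "modes \<Rightarrow> modes \<Rightarrow> modes" where
  "conv f g n s = (\<Sum>\<^sub>\<infinity>k. f k s * g (n - k) s)"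

lemma infsum_shift_int:
  fixes f :: "int \<Rightarrow> 'b::{comm_monoid_add,t2_space}"
  shows "(\<Sum>\<^sub>\<infinity>n. f (n - k)) = (\<Sum>\<^sub>\<infinity>n. f n)" "(\<Sum>\<^sub>\<infinity>n. f (n + k)) = (\<Sum>\<^sub>\<infinity>n. f n)"
    "(\<Sum>\<^sub>\<infinity>n. f (k - n)) = (\<Sum>\<^sub>\<infinity>n. f n)"  "(\<Sum>\<^sub>\<infinity>n. f (- n)) = (\<Sum>\<^sub>\<infinity>n. f n)"
proof -
  show "(\<Sum>\<^sub>\<infinity>n. f (n - k)) = (\<Sum>\<^sub>\<infinity>n. f n)"
    by (rule infsum_reindex_bij_witness[where i="\<lambda>n. n + k" and j="\<lambda>n. n - k"]) auto
  show "(\<Sum>\<^sub>\<infinity>n. f (n + k)) = (\<Sum>\<^sub>\<infinity>n. f n)"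
    by (rule infsum_reindex_bij_witness[where i="\<lambda>n. n - k" and j="\<lambda>n. n + k"]) auto
  show "(\<Sum>\<^sub>\<infinity>n. f (k - n)) = (\<Sum>\<^sub>\<infinity>n. f n)"
    by (rule infsum_reindex_bij_witness[where i="\<lambda>n. k - n" and j="\<lambda>n. k - n"]) auto
  show "(\<Sum>\<^sub>\<infinity>n. f (- n)) = (\<Sum>\<^sub>\<infinity>n. f n)"
    by (rule infsum_reindex_bij_witness[where i="\<lambda>n. - n" and j="\<lambda>n. - n"]) auto
qed

lemma summable_shift_int:
  fixes f :: "int \<Rightarrow> 'b::{comm_monoid_add,t2_space}"
  shows "(\<lambda>n. f (n - k)) summable_on UNIV \<longleftrightarrow> f summable_on UNIV"
    "(\<lambda>n. f (n + k)) summable_on UNIV \<longleftrightarrow> f summable_on UNIV"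
    "(\<lambda>n. f (k - n)) summable_on UNIV \<longleftrightarrow> f summable_on UNIV"
proof -
  show "(\<lambda>n. f (n - k)) summable_on UNIV \<longleftrightarrow> f summable_on UNIV"
    by (rule summable_on_reindex_bij_witness[where i="\<lambda>n. n + k" and j="\<lambda>n. n - k"]) auto
  show "(\<lambda>n. f (n + k)) summable_on UNIV \<longleftrightarrow> f summable_on UNIV"
    by (rule summable_on_reindex_bij_witness[where i="\<lambda>n. n - k" and j="\<lambda>n. n + k"]) auto
  show "(\<lambda>n. f (k - n)) summable_on UNIV \<longleftrightarrow> f summable_on UNIV"
    by (rule summable_on_reindex_bij_witness[where i="\<lambda>n. k - n" and j="\<lambda>n. k - n"]) auto
qed

text \<open>One of \<open>k\<close> and \<open>n - k\<close> has at least half the size of \<open>n\<close>, so one of the two weights is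
  comparable to \<open>wt n\<close>, and the other one remains summable. This makes the weighted sup norm
  an algebra norm.\<close>

lemma wt_conv_le: "wt k * wt (n - k) \<le> 2 * wt n * (wt k + wt (n - k))"
proof -
  define a b c where "a = 1 + real_of_int \<bar>k\<bar>" and "b = 1 + real_of_int \<bar>n - k\<bar>" and "c = 1 + real_of_int \<bar>n\<bar>"
  have p: "a > 0" "b > 0" "c > 0" unfolding a_def b_def c_def by linarith+
  have "c \<le> a + b" unfolding a_def b_def c_def by linarith
  then have "c\<^sup>2 \<le> (a + b)\<^sup>2" using p by (simp add: power_mono)
  also have "\<dots> \<le> 2 * (a\<^sup>2 + b\<^sup>2)" using sum_squares_bound[of a b] by (simp add: power2_sum)
  finally have "c\<^sup>2 \<le> 2 * (a\<^sup>2 + b\<^sup>2)" .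
  then have "1 / a\<^sup>2 * (1 / b\<^sup>2) \<le> 2 * (1 / c\<^sup>2) * (1 / a\<^sup>2 + 1 / b\<^sup>2)"
    using p by (simp add: field_simps)
  then show ?thesis by (simp add: wt_def a_def b_def c_def)
qed

lemma conv_majorant:
  shows "(\<lambda>k. wt k * wt (n - k)) summable_on UNIV"
    "(\<Sum>\<^sub>\<infinity>k. wt k * wt (n - k)) \<le> 4 * wt_total * wt n"
proof -
  have s: "(\<lambda>k. 2 * wt n * (wt k + wt (n - k))) summable_on UNIV"
    by (intro summable_on_cmult_right summable_on_add wt_summable) (simp add: summable_shift_int wt_summable)
  show "(\<lambda>k. wt k * wt (n - k)) summable_on UNIV"
    by (rule summable_on_comparison_test[OF s wt_conv_le]) (simp add: less_imp_le[OF wt_pos])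
  then have "(\<Sum>\<^sub>\<infinity>k. wt k * wt (n - k)) \<le> (\<Sum>\<^sub>\<infinity>k. 2 * wt n * (wt k + wt (n - k)))"
    using s wt_conv_le by (rule infsum_mono)
  also have "\<dots> = 2 * wt n * ((\<Sum>\<^sub>\<infinity>k. wt k) + (\<Sum>\<^sub>\<infinity>k. wt (n - k)))"
    by (subst infsum_cmult_right', subst infsum_add) (simp_all add: summable_shift_int wt_summable)
  also have "\<dots> = 4 * wt_total * wt n" by (simp add: infsum_shift_int wt_total_def)
  finally show "(\<Sum>\<^sub>\<infinity>k. wt k * wt (n - k)) \<le> 4 * wt_total * wt n" .
qed

section \<open>Rapidly decaying mode families\<close>

text \<open>The Japanese bracket.\<close>

definition jbracket :: "int \<Rightarrow> real" where "jbracket n = 1 + real_of_int \<bar>n\<bar>"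

lemma jbracket_ge1: "1 \<le> jbracket n" and jbracket_pos: "0 < jbracket n"
  unfolding jbracket_def by linarith+

lemma wt_jbracket: "wt n = 1 / jbracket n ^ 2"
  by (simp add: wt_def jbracket_def)

lemma wt_le1: "wt n \<le> 1"
  unfolding wt_jbracket using jbracket_ge1[of n] by (simp add: one_le_power)

lemma jbracket_submult: "jbracket (k + l) \<le> jbracket k * jbracket l"
proof -
  have "jbracket (k + l) \<le> 1 + real_of_int \<bar>k\<bar> + real_of_int \<bar>l\<bar>" unfolding jbracket_def by linarith
  also have "\<dots> \<le> (1 + real_of_int \<bar>k\<bar>) * (1 + real_of_int \<bar>l\<bar>)" by (simp add: algebra_simps)
  finally show ?thesis unfolding jbracket_def .
qed

lemma jbracket_submult_power: "jbracket (k + l) ^ m \<le> jbracket k ^ m * jbracket l ^ m"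
  using power_mono[OF jbracket_submult, of k l m] jbracket_pos[of "k + l"] by (simp add: power_mult_distrib)

text \<open>The modes of a function that is smooth in the angle: decay faster than every power of
  \<open>n\<close>, uniformly on compact intervals. The intervals stay away from \<open>s = 0\<close>, the circle, where
  only the decay of the boundary data is available.\<close>

definition rapid :: "modes \<Rightarrow> bool" where
  "rapid f \<longleftrightarrow> (\<forall>m s0 s1. 0 < s0 \<longrightarrow> (\<exists>C. \<forall>n. \<forall>s\<in>{s0..s1}. jbracket n ^ m * norm (f n s) \<le> C))"

lemma rapidE:
  assumes "rapid f" "0 < s0"
  shows "\<exists>C\<ge>0. \<forall>n s. s0 \<le> s \<longrightarrow> s \<le> s1 \<longrightarrow> jbracket n ^ m * norm (f n s) \<le> C"
proof -
  obtain C where "\<forall>n. \<forall>s\<in>{s0..s1}. jbracket n ^ m * norm (f n s) \<le> C"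
    using assms unfolding rapid_def by blast
  then have "jbracket n ^ m * norm (f n s) \<le> max C 0" if "s0 \<le> s" "s \<le> s1" for n s
    using that by (meson atLeastAtMost_iff max.coboundedI1)
  then show ?thesis by (intro exI[of _ "max C 0"]) simp
qed

lemma rapidE_wt:
  assumes "rapid f" "0 < s0"
  shows "\<exists>C\<ge>0. \<forall>n s. s0 \<le> s \<longrightarrow> s \<le> s1 \<longrightarrow> jbracket n ^ m * norm (f n s) \<le> C * wt n"
proof -
  obtain C where C1: "0 \<le> C" and C2: "\<forall>n s. s0 \<le> s \<longrightarrow> s \<le> s1 \<longrightarrow> jbracket n ^ (m + 2) * norm (f n s) \<le> C"
    using rapidE[OF assms, of s1 "m + 2"] by blast
  note C = C1 C2[rule_format]
  have "jbracket n ^ m * norm (f n s) \<le> C * wt n" if "s0 \<le> s" "s \<le> s1" for n s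
    using C(2)[OF that, of n] jbracket_pos[of n] by (simp add: wt_jbracket field_simps power_add power2_eq_square)
  with C(1) show ?thesis by blast
qed

lemma rapidI:
  assumes "\<And>m s0 s1. 0 < s0 \<Longrightarrow> \<exists>C. \<forall>n s. s0 \<le> s \<longrightarrow> s \<le> s1 \<longrightarrow> jbracket n ^ m * norm (f n s) \<le> C"
  shows "rapid f"
  using assms unfolding rapid_def by (metis atLeastAtMost_iff)

lemma rapid_cong:
  assumes "\<And>n s. 0 < s \<Longrightarrow> f n s = g n s" "rapid f"
  shows "rapid g"
proof (rule rapidI)
  fix m s0 s1 :: real and k :: nat assume "0 < s0"
  then show "\<exists>C. \<forall>n s. s0 \<le> s \<longrightarrow> s \<le> s1 \<longrightarrow> jbracket n ^ k * norm (g n s) \<le> C"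
    using rapidE[OF assms(2), of s0 s1 k] assms(1) by (metis less_le_trans)
qed

lemma rapid_add: "rapid f \<Longrightarrow> rapid g \<Longrightarrow> rapid (\<lambda>n s. f n s + g n s)"
proof (rule rapidI)
  fix s0 s1 :: real and m :: nat assume r: "rapid f" "rapid g" "0 < s0"
  obtain C where "0 \<le> C" and C_all: "\<forall>n s. s0 \<le> s \<longrightarrow> s \<le> s1 \<longrightarrow> jbracket n ^ m * norm (f n s) \<le> C"
    using rapidE[OF r(1,3), of s1 m] by blast
  note C = C_all[rule_format]
  obtain D where "0 \<le> D" and D_all: "\<forall>n s. s0 \<le> s \<longrightarrow> s \<le> s1 \<longrightarrow> jbracket n ^ m * norm (g n s) \<le> D"
    using rapidE[OF r(2,3), of s1 m] by blast
  note D = D_all[rule_format]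
  have "jbracket n ^ m * norm (f n s + g n s) \<le> C + D" if "s0 \<le> s" "s \<le> s1" for n s
  proof -
    have "jbracket n ^ m * norm (f n s + g n s) \<le> jbracket n ^ m * (norm (f n s) + norm (g n s))"
      by (intro mult_left_mono norm_triangle_ineq) (simp add: less_imp_le[OF jbracket_pos])
    then show ?thesis using C[OF that, of n] D[OF that, of n] by (simp add: distrib_left)
  qed
  then show "\<exists>C. \<forall>n s. s0 \<le> s \<longrightarrow> s \<le> s1 \<longrightarrow> jbracket n ^ m * norm (f n s + g n s) \<le> C" by blast
qed

lemma rapid_coeff:
  assumes "rapid f" "\<And>n. norm (c n) \<le> A * jbracket n ^ q"
  shows "rapid (\<lambda>n s. c n * f n s)"
proof (rule rapidI)
  fix s0 s1 :: real and m :: nat assume s0: "0 < s0"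
  obtain C where "0 \<le> C" and C_all: "\<forall>n s. s0 \<le> s \<longrightarrow> s \<le> s1 \<longrightarrow> jbracket n ^ (m + q) * norm (f n s) \<le> C"
    using rapidE[OF assms(1) s0, of s1 "m + q"] by blast
  note C = C_all[rule_format]
  have A: "0 \<le> A" using order_trans[OF norm_ge_zero assms(2)[of 0]] by (simp add: jbracket_def)
  have "jbracket n ^ m * norm (c n * f n s) \<le> A * C" if "s0 \<le> s" "s \<le> s1" for n s
  proof -
    have "jbracket n ^ m * norm (c n * f n s) \<le> jbracket n ^ m * (A * jbracket n ^ q * norm (f n s))"
      unfolding norm_mult by (intro mult_left_mono mult_right_mono assms(2)) (simp_all add: less_imp_le[OF jbracket_pos])
    also have "\<dots> = A * (jbracket n ^ (m + q) * norm (f n s))" by (simp add: power_add)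
    also have "\<dots> \<le> A * C" using C[OF that] A by (rule mult_left_mono)
    finally show ?thesis .
  qed
  then show "\<exists>C. \<forall>n s. s0 \<le> s \<longrightarrow> s \<le> s1 \<longrightarrow> jbracket n ^ m * norm (c n * f n s) \<le> C" by blast
qed

lemma rapid_shift: assumes "rapid f" shows "rapid (\<lambda>n s. f (n + k) s)"
proof (rule rapidI)
  fix s0 s1 :: real and m :: nat assume s0: "0 < s0"
  obtain C where "0 \<le> C" and C_all: "\<forall>n s. s0 \<le> s \<longrightarrow> s \<le> s1 \<longrightarrow> jbracket n ^ m * norm (f n s) \<le> C"
    using rapidE[OF assms(1) s0, of s1 m] by blast
  note C = C_all[rule_format]
  have "jbracket n ^ m * norm (f (n + k) s) \<le> jbracket (-k) ^ m * C" if "s0 \<le> s" "s \<le> s1" for n s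
  proof -
    have "jbracket n ^ m * norm (f (n + k) s) \<le> (jbracket (- k) ^ m * jbracket (n + k) ^ m) * norm (f (n + k) s)"
      using jbracket_submult_power[of "- k" "n + k" m] by (intro mult_right_mono) auto
    also have "\<dots> \<le> jbracket (-k) ^ m * C"
      using C[OF that, of "n + k"] jbracket_pos[of "-k"] by (simp add: mult.assoc)
    finally show ?thesis .
  qed
  then show "\<exists>C. \<forall>n s. s0 \<le> s \<longrightarrow> s \<le> s1 \<longrightarrow> jbracket n ^ m * norm (f (n + k) s) \<le> C" by blast
qed

lemma rapid_exp: assumes "rapid f" shows "rapid (\<lambda>n s. of_real (exp (\<alpha> * s)) * f n s)"
proof (rule rapidI)
  fix s0 s1 :: real and m :: nat assume s0: "0 < s0"
  obtain C where C0: "0 \<le> C" and C_all: "\<forall>n s. s0 \<le> s \<longrightarrow> s \<le> s1 \<longrightarrow> jbracket n ^ m * norm (f n s) \<le> C"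
    using rapidE[OF assms(1) s0, of s1 m] by blast
  note C = C_all[rule_format]
  have "jbracket n ^ m * norm (of_real (exp (\<alpha> * s)) * f n s) \<le> exp (\<bar>\<alpha>\<bar> * s1) * C" if "s0 \<le> s" "s \<le> s1" for n s
  proof -
    have "\<alpha> * s \<le> \<bar>\<alpha>\<bar> * s" using that s0 by (intro mult_right_mono) auto
    also have "\<dots> \<le> \<bar>\<alpha>\<bar> * s1" using that by (intro mult_left_mono) auto
    finally have "exp (\<alpha> * s) * (jbracket n ^ m * norm (f n s)) \<le> exp (\<bar>\<alpha>\<bar> * s1) * C"
      using C[OF that, of n] C0 jbracket_pos[of n] by (intro mult_mono) auto
    then show ?thesis by (simp add: norm_mult mult_ac)
  qed
  then show "\<exists>C. \<forall>n s. s0 \<le> s \<longrightarrow> s \<le> s1 \<longrightarrow> jbracket n ^ m * norm (of_real (exp (\<alpha> * s)) * f n s) \<le> C" by blast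
qed

text \<open>Submultiplicativity of the bracket distributes the power \<open>jbracket n ^ m\<close> over the two
  factors; two further powers of \<open>jbracket k\<close> are spent on summability.\<close>

lemma rapid_conv_bound:
  assumes "rapid f" "rapid g" "0 < s0"
  shows "\<exists>C\<ge>0. \<forall>n k s. s0 \<le> s \<longrightarrow> s \<le> s1 \<longrightarrow> jbracket n ^ m * norm (f k s * g (n - k) s) \<le> C * wt k"
proof -
  obtain C where C0: "0 \<le> C" and C_all: "\<forall>n s. s0 \<le> s \<longrightarrow> s \<le> s1 \<longrightarrow> jbracket n ^ m * norm (f n s) \<le> C * wt n"
    using rapidE_wt[OF assms(1,3), of s1 m] by blast
  note C = C_all[rule_format]
  obtain D where D0: "0 \<le> D" and D_all: "\<forall>n s. s0 \<le> s \<longrightarrow> s \<le> s1 \<longrightarrow> jbracket n ^ m * norm (g n s) \<le> D"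
    using rapidE[OF assms(2,3), of s1 m] by blast
  note D = D_all[rule_format]
  have "jbracket n ^ m * norm (f k s * g (n - k) s) \<le> C * D * wt k" if "s0 \<le> s" "s \<le> s1" for n k s
  proof -
    have "jbracket n ^ m * norm (f k s * g (n - k) s) \<le> jbracket k ^ m * jbracket (n - k) ^ m * norm (f k s * g (n - k) s)"
      using jbracket_submult_power[of k "n - k" m] by (intro mult_right_mono) auto
    also have "\<dots> = (jbracket k ^ m * norm (f k s)) * (jbracket (n - k) ^ m * norm (g (n - k) s))"
      by (simp add: norm_mult mult_ac)
    also have "\<dots> \<le> (C * wt k) * D"
      using C[OF that, of k] D[OF that, of "n - k"] C0 wt_pos[of k] jbracket_pos[of "n - k"] by (intro mult_mono[of "jbracket k ^ m * norm (f k s)"]) auto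
    finally show ?thesis by (simp add: mult_ac)
  qed
  moreover have "0 \<le> C * D" using C0 D0 by simp
  ultimately show ?thesis by (intro exI[of _ "C * D"]) simp
qed

lemma summable_conv:
  assumes "rapid f" "rapid g" "0 < s"
  shows "(\<lambda>k. f k s * g (n - k) s) summable_on UNIV"
proof -
  obtain C where "0 \<le> C" and C_all: "\<forall>n k t. s \<le> t \<longrightarrow> t \<le> s \<longrightarrow> jbracket n ^ 0 * norm (f k t * g (n - k) t) \<le> C * wt k"
    using rapid_conv_bound[OF assms, of s 0] by blast
  note C = C_all[rule_format]
  show ?thesis
    by (rule norm_infsum_le_majorant(1)[of "\<lambda>k. C * wt k"])
      (use C[of s] wt_summable in \<open>auto intro: summable_on_cmult_right\<close>)
qed

lemma rapid_conv: assumes "rapid f" "rapid g" shows "rapid (conv f g)"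
proof (rule rapidI)
  fix s0 s1 :: real and m :: nat assume s0: "0 < s0"
  obtain C where "0 \<le> C" and C_all: "\<forall>n k s. s0 \<le> s \<longrightarrow> s \<le> s1 \<longrightarrow> jbracket n ^ m * norm (f k s * g (n - k) s) \<le> C * wt k"
    using rapid_conv_bound[OF assms s0, of s1 m] by blast
  note C = C_all[rule_format]
  have "jbracket n ^ m * norm (conv f g n s) \<le> C * wt_total" if "s0 \<le> s" "s \<le> s1" for n s
  proof -
    have "norm (\<Sum>\<^sub>\<infinity>k. f k s * g (n - k) s) \<le> (\<Sum>\<^sub>\<infinity>k. C / jbracket n ^ m * wt k)"
    proof (rule norm_infsum_le_majorant(2))
      show "(\<lambda>k. C / jbracket n ^ m * wt k) summable_on UNIV" by (rule summable_on_cmult_right[OF wt_summable])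
      show "norm (f k s * g (n - k) s) \<le> C / jbracket n ^ m * wt k" for k
        using C[OF that, of n k] jbracket_pos[of n] by (simp add: pos_le_divide_eq mult.commute)
    qed
    also have "\<dots> = C / jbracket n ^ m * wt_total" by (simp only: infsum_cmult_right' wt_total_def)
    finally show ?thesis using jbracket_pos[of n] by (simp add: conv_def pos_le_divide_eq mult.commute)
  qed
  then show "\<exists>C. \<forall>n s. s0 \<le> s \<longrightarrow> s \<le> s1 \<longrightarrow> jbracket n ^ m * norm (conv f g n s) \<le> C" by blast
qed

lemma power_exp_bound:
  assumes d: "0 < d"
  shows "\<exists>C. \<forall>n. jbracket n ^ m * exp (- (d * \<bar>of_int n\<bar>)) \<le> C"
proof (cases "m = 0")
  case True
  then show ?thesis using d by (intro exI[of _ 1]) simp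
next
  case False
  define q where "q = d / m"
  have q: "0 < q" "real m * q = d" using d False by (simp_all add: q_def)
  have "jbracket n ^ m * exp (- (d * \<bar>of_int n\<bar>)) \<le> (1 + 1 / q) ^ m" for n
  proof -
    have "jbracket n \<le> (1 + 1 / q) * (1 + q * \<bar>of_int n\<bar>)" using q by (simp add: jbracket_def field_simps)
    also have "\<dots> \<le> (1 + 1 / q) * exp (q * \<bar>of_int n\<bar>)" using q exp_ge_add_one_self by (intro mult_left_mono) auto
    finally have "jbracket n ^ m \<le> ((1 + 1 / q) * exp (q * \<bar>of_int n\<bar>)) ^ m"
      using jbracket_pos[of n] by (intro power_mono) auto
    also have "\<dots> = (1 + 1 / q) ^ m * exp (d * \<bar>of_int n\<bar>)"
      using q(2) by (simp add: power_mult_distrib flip: exp_of_nat_mult mult.assoc)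
    finally show ?thesis by (simp add: exp_minus field_simps)
  qed
  then show ?thesis by blast
qed

text \<open>Analytic smoothing away from the circle: at \<open>s \<ge> s0 > 0\<close> the exponential factor
  dominates every power of \<open>n\<close>. The mode \<open>0\<close> carries no such factor and may even grow (the
  stream function of a swirl is \<open>\<mu> s\<close>), so it is only asked to be continuous.\<close>

lemma rapidI_exp:
  assumes c: "0 < c" and K: "\<And>n s. n \<noteq> 0 \<Longrightarrow> 0 \<le> s \<Longrightarrow> norm (f n s) \<le> K * exp (- (c * \<bar>of_int n\<bar> * s))"
    and f0: "continuous_on {0..} (f 0)"
  shows "rapid f"
proof (rule rapidI)
  fix m :: nat and s0 s1 :: real assume s0: "0 < s0"
  obtain C where C: "\<And>n. jbracket n ^ m * exp (- ((c * s0) * \<bar>of_int n\<bar>)) \<le> C"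
    using power_exp_bound[of "c * s0" m] c s0 by auto
  have "bounded (f 0 ` {s0..s1})"
    by (intro compact_imp_bounded compact_continuous_image continuous_on_subset[OF f0]) (use s0 in auto)
  then obtain B where "\<forall>x\<in>f 0 ` {s0..s1}. norm x \<le> B"
    unfolding bounded_iff by blast
  then have B: "norm (f 0 s) \<le> B" if "s0 \<le> s" "s \<le> s1" for s using that by simp
  have K0: "0 \<le> K" using order_trans[OF norm_ge_zero K[of 1 0]] by simp
  have "jbracket n ^ m * norm (f n s) \<le> max B (K * C)" if s: "s0 \<le> s" "s \<le> s1" for n s
  proof (cases "n = 0")
    case True
    then show ?thesis using B[OF s] by (simp add: jbracket_def)
  next
    case False
    have "norm (f n s) \<le> K * exp (- (c * \<bar>of_int n\<bar> * s))" using K[OF False, of s] s s0 by simp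
    also have "\<dots> \<le> K * exp (- ((c * s0) * \<bar>of_int n\<bar>))"
      using K0 c s mult_left_mono[OF s(1), of "c * \<bar>of_int n\<bar>"] by (intro mult_left_mono) (auto simp: mult_ac)
    finally have "jbracket n ^ m * norm (f n s) \<le> jbracket n ^ m * (K * exp (- ((c * s0) * \<bar>of_int n\<bar>)))"
      using jbracket_pos[of n] by (intro mult_left_mono) auto
    also have "\<dots> = K * (jbracket n ^ m * exp (- ((c * s0) * \<bar>of_int n\<bar>)))" by simp
    also have "\<dots> \<le> K * C" using C[of n] K0 by (rule mult_left_mono)
    finally show ?thesis by simp
  qed
  then show "\<exists>C. \<forall>n s. s0 \<le> s \<longrightarrow> s \<le> s1 \<longrightarrow> jbracket n ^ m * norm (f n s) \<le> C" by blast
qed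

section \<open>Smooth mode families\<close>

text \<open>The derivative is taken mode by mode; \<open>fam_deriv\<close> is the corresponding relation,
  restricted to the open half-line, which corresponds to the exterior of the circle.\<close>

definition dfam :: "modes \<Rightarrow> modes" where
  "dfam f n s = vector_derivative (f n) (at s)"

definition fam_deriv :: "modes \<Rightarrow> modes \<Rightarrow> bool" where
  "fam_deriv f f' \<longleftrightarrow> (\<forall>n s. 0 < s \<longrightarrow> (f n has_vector_derivative f' n s) (at s))"

lemma fam_deriv_dfam: "fam_deriv f f' \<Longrightarrow> 0 < s \<Longrightarrow> dfam f n s = f' n s"
  unfolding fam_deriv_def dfam_def by (simp add: vector_derivative_at)

lemma fam_deriv_conv:
  assumes r: "rapid f" "rapid f'" "rapid g" "rapid g'" and d: "fam_deriv f f'" "fam_deriv g g'"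
  shows "fam_deriv (conv f g) (\<lambda>n s. conv f' g n s + conv f g' n s)"
  unfolding fam_deriv_def
proof (intro allI impI)
  fix n :: int and s :: real assume s: "0 < s"
  define S where "S = {s / 2 <..< s + 1}"
  have S: "open S" "convex S" "s \<in> S" using s by (auto simp: S_def)
  have s2: "0 < s / 2" using s by simp
  obtain C0 where "0 \<le> C0" and C0_all: "\<forall>n k t. s/2 \<le> t \<longrightarrow> t \<le> s + 1 \<longrightarrow> jbracket n ^ 0 * norm (f k t * g (n - k) t) \<le> C0 * wt k"
    using rapid_conv_bound[OF r(1,3) s2, of "s + 1" 0] by blast
  note C0 = C0_all[rule_format]
  obtain C1 where "0 \<le> C1" and C1_all: "\<forall>n k t. s/2 \<le> t \<longrightarrow> t \<le> s + 1 \<longrightarrow> jbracket n ^ 0 * norm (f' k t * g (n - k) t) \<le> C1 * wt k"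
    using rapid_conv_bound[OF r(2,3) s2, of "s + 1" 0] by blast
  note C1 = C1_all[rule_format]
  obtain C2 where "0 \<le> C2" and C2_all: "\<forall>n k t. s/2 \<le> t \<longrightarrow> t \<le> s + 1 \<longrightarrow> jbracket n ^ 0 * norm (f k t * g' (n - k) t) \<le> C2 * wt k"
    using rapid_conv_bound[OF r(1,4) s2, of "s + 1" 0] by blast
  note C2 = C2_all[rule_format]
  let ?d = "\<lambda>k t. f' k t * g (n - k) t + f k t * g' (n - k) t"
  define b where "b k = max C0 (C1 + C2) * wt k" for k
  have "((\<lambda>t. \<Sum>\<^sub>\<infinity>k. f k t * g (n - k) t) has_derivative (\<lambda>h. \<Sum>\<^sub>\<infinity>k. h *\<^sub>R ?d k s)) (at s)"
  proof (rule has_derivative_infsum_int[OF S(1,2)])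
    fix k t assume "t \<in> S"
    then have t: "s/2 \<le> t" "t \<le> s + 1" "0 < t" using s by (auto simp: S_def)
    have f: "(f k has_vector_derivative f' k t) (at t)" and g: "(g (n - k) has_vector_derivative g' (n - k) t) (at t)"
      using d t unfolding fam_deriv_def by auto
    show "((\<lambda>t. f k t * g (n - k) t) has_derivative (\<lambda>h. h *\<^sub>R ?d k t)) (at t)"
      using has_vector_derivative_mult[OF f g] by (simp add: has_vector_derivative_def add.commute)
    have w: "0 < wt k" by (rule wt_pos)
    show "norm (f k t * g (n - k) t) \<le> b k"
    proof -
      have "norm (f k t * g (n - k) t) \<le> C0 * wt k" using C0[OF t(1,2), of n k] by simp
      also have "\<dots> \<le> b k" unfolding b_def using w by (intro mult_right_mono) auto
      finally show ?thesis .
    qed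
    show "norm (h *\<^sub>R ?d k t) \<le> b k * norm h" for h
    proof -
      have "norm (?d k t) \<le> C1 * wt k + C2 * wt k"
        using C1[OF t(1,2), of n k] C2[OF t(1,2), of n k] by (intro norm_triangle_le) simp
      also have "\<dots> = (C1 + C2) * wt k" by (simp add: distrib_right)
      also have "\<dots> \<le> b k" unfolding b_def using w by (intro mult_right_mono) auto
      finally have "norm (?d k t) \<le> b k" .
      from mult_left_mono[OF this, of "\<bar>h\<bar>"] show ?thesis by (simp add: mult.commute[of "b k"])
    qed
  next
    show "b summable_on UNIV" unfolding b_def by (intro summable_on_cmult_right wt_summable)
  qed (rule S(3))
  moreover have "(\<Sum>\<^sub>\<infinity>k. h *\<^sub>R ?d k s) = h *\<^sub>R (conv f' g n s + conv f g' n s)" for h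
  proof -
    have "(\<Sum>\<^sub>\<infinity>k. h *\<^sub>R ?d k s) = of_real h * (\<Sum>\<^sub>\<infinity>k. ?d k s)"
      by (simp add: scaleR_conv_of_real infsum_cmult_right')
    also have "(\<Sum>\<^sub>\<infinity>k. ?d k s) = conv f' g n s + conv f g' n s"
      unfolding conv_def by (intro infsum_add summable_conv r s)
    finally show ?thesis by (simp add: scaleR_conv_of_real)
  qed
  ultimately show "(conv f g n has_vector_derivative conv f' g n s + conv f g' n s) (at s)"
    unfolding has_vector_derivative_def conv_def[abs_def] by simp
qed

text \<open>The first \<open>k\<close> derivatives in \<open>s\<close> exist and all of them decay rapidly in \<open>n\<close>.\<close>

fun Ck_fam :: "nat \<Rightarrow> modes \<Rightarrow> bool" where
  "Ck_fam 0 f = rapid f"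
| "Ck_fam (Suc k) f = (rapid f \<and> fam_deriv f (dfam f) \<and> Ck_fam k (dfam f))"

lemma Ck_fam_rapid: "Ck_fam k f \<Longrightarrow> rapid f"
  by (cases k) auto

lemma dfam_cong:
  assumes "\<And>n s. 0 < s \<Longrightarrow> f n s = g n s" "0 < s"
  shows "dfam f n s = dfam g n s"
proof -
  have "\<forall>\<^sub>F t in nhds s. f n t = g n t"
    using assms(1) eventually_nhds_in_open[of "{0<..}" s] assms(2)
    by (auto elim: eventually_mono)
  then show ?thesis unfolding dfam_def
    by (intro vector_derivative_cong_eq) (auto simp: assms)
qed

lemma fam_deriv_cong:
  assumes "\<And>n s. 0 < s \<Longrightarrow> f n s = g n s" "\<And>n s. 0 < s \<Longrightarrow> f' n s = g' n s" "fam_deriv f f'"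
  shows "fam_deriv g g'"
  unfolding fam_deriv_def
proof (intro allI impI)
  fix n and s :: real assume s: "0 < s"
  have "(f n has_vector_derivative g' n s) (at s)"
    using assms(2)[OF s, of n] assms(3) s unfolding fam_deriv_def by metis
  then show "(g n has_vector_derivative g' n s) (at s)"
    by (rule has_vector_derivative_transform_within_open[where S="{0<..}"]) (use s assms(1) in auto)
qed

lemma Ck_fam_cong:
  assumes "\<And>n s. 0 < s \<Longrightarrow> f n s = g n s" "Ck_fam k f"
  shows "Ck_fam k g"
  using assms
proof (induction k arbitrary: f g)
  case 0
  then show ?case using rapid_cong[of f g] by simp
next
  case (Suc k)
  have e: "dfam f n s = dfam g n s" if "0 < s" for n s using dfam_cong[of f g] Suc.prems(1) that by blast
  show ?case using Suc.prems rapid_cong[of f g] fam_deriv_cong[of f g "dfam f" "dfam g"] e Suc.IH[of "dfam f" "dfam g"]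
    by simp
qed

lemma Ck_fam_SucI:
  assumes "rapid f" "fam_deriv f g" "Ck_fam k g"
  shows "Ck_fam (Suc k) f"
proof -
  have e: "0 < s \<Longrightarrow> dfam f n s = g n s" for n s using fam_deriv_dfam[OF assms(2)] .
  show ?thesis using assms fam_deriv_cong[of f f g "dfam f"] Ck_fam_cong[of g "dfam f" k] e by simp
qed

lemma Ck_fam_mono: "Ck_fam (Suc k) f \<Longrightarrow> Ck_fam k f"
  by (induction k arbitrary: f) auto

lemma fam_deriv_add: "fam_deriv f f' \<Longrightarrow> fam_deriv g g' \<Longrightarrow> fam_deriv (\<lambda>n s. f n s + g n s) (\<lambda>n s. f' n s + g' n s)"
  unfolding fam_deriv_def by (auto intro!: has_vector_derivative_add)

lemma fam_deriv_coeff: "fam_deriv f f' \<Longrightarrow> fam_deriv (\<lambda>n s. c n * f n s) (\<lambda>n s. c n * f' n s)"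
  unfolding fam_deriv_def by (auto intro!: has_vector_derivative_mult_right)

lemma fam_deriv_shift: "fam_deriv f f' \<Longrightarrow> fam_deriv (\<lambda>n s. f (n + k) s) (\<lambda>n s. f' (n + k) s)"
  unfolding fam_deriv_def by auto

lemma fam_deriv_exp: "fam_deriv f f' \<Longrightarrow> fam_deriv (\<lambda>n s. of_real (exp (\<alpha> * s)) * f n s)
    (\<lambda>n s. of_real (exp (\<alpha> * s)) * (of_real \<alpha> * f n s + f' n s))"
  unfolding fam_deriv_def
proof (intro allI impI)
  fix n and s :: real assume "\<forall>n s. 0 < s \<longrightarrow> (f n has_vector_derivative f' n s) (at s)" "0 < s"
  then have f: "(f n has_vector_derivative f' n s) (at s)" by blast
  have e: "((\<lambda>s. of_real (exp (\<alpha> * s)) :: complex) has_vector_derivative of_real (\<alpha> * exp (\<alpha> * s))) (at s)"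
    by (rule has_vector_derivative_of_real) (auto intro!: derivative_eq_intros simp flip: has_real_derivative_iff_has_vector_derivative)
  show "((\<lambda>s. of_real (exp (\<alpha> * s)) * f n s) has_vector_derivative
      of_real (exp (\<alpha> * s)) * (of_real \<alpha> * f n s + f' n s)) (at s)"
    using has_vector_derivative_mult[OF e f] by (simp add: algebra_simps)
qed

lemma Ck_fam_add: "Ck_fam k f \<Longrightarrow> Ck_fam k g \<Longrightarrow> Ck_fam k (\<lambda>n s. f n s + g n s)"
proof (induction k arbitrary: f g)
  case (Suc k)
  then show ?case
    by (intro Ck_fam_SucI[where g="\<lambda>n s. dfam f n s + dfam g n s"]) (auto intro: rapid_add fam_deriv_add)
qed (simp add: rapid_add)

lemma Ck_fam_coeff:
  assumes "Ck_fam k f" "\<And>n. norm (c n) \<le> A * jbracket n ^ q"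
  shows "Ck_fam k (\<lambda>n s. c n * f n s)"
  using assms(1)
proof (induction k arbitrary: f)
  case (Suc k)
  then show ?case
    by (intro Ck_fam_SucI[where g="\<lambda>n s. c n * dfam f n s"]) (auto intro: rapid_coeff[OF _ assms(2)] fam_deriv_coeff)
qed (simp add: rapid_coeff[OF _ assms(2)])

lemma Ck_fam_const: "Ck_fam k f \<Longrightarrow> Ck_fam k (\<lambda>n s. c * f n s)"
  by (rule Ck_fam_coeff[where A="norm c" and q=0]) auto

lemma Ck_fam_shift: "Ck_fam k f \<Longrightarrow> Ck_fam k (\<lambda>n s. f (n + j) s)"
proof (induction k arbitrary: f)
  case (Suc k)
  then show ?case
    by (intro Ck_fam_SucI[where g="\<lambda>n s. dfam f (n + j) s"]) (auto intro: rapid_shift fam_deriv_shift)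
qed (simp add: rapid_shift)

lemma Ck_fam_exp: "Ck_fam k f \<Longrightarrow> Ck_fam k (\<lambda>n s. of_real (exp (\<alpha> * s)) * f n s)"
proof (induction k arbitrary: f)
  case (Suc k)
  have "Ck_fam k (\<lambda>n s. of_real \<alpha> * f n s + dfam f n s)"
    using Suc.prems Ck_fam_mono[OF Suc.prems] by (intro Ck_fam_add Ck_fam_const) auto
  then show ?case using Suc
    by (intro Ck_fam_SucI[where g="\<lambda>n s. of_real (exp (\<alpha> * s)) * (of_real \<alpha> * f n s + dfam f n s)"])
      (auto intro: rapid_exp fam_deriv_exp)
qed (simp add: rapid_exp)

lemma Ck_fam_conv: "Ck_fam k f \<Longrightarrow> Ck_fam k g \<Longrightarrow> Ck_fam k (conv f g)"
proof (induction k arbitrary: f g)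
  case (Suc k)
  have "Ck_fam k (\<lambda>n s. conv (dfam f) g n s + conv f (dfam g) n s)"
    using Suc Ck_fam_mono[OF Suc.prems(1)] Ck_fam_mono[OF Suc.prems(2)] by (intro Ck_fam_add Suc.IH) auto
  then show ?case using Suc.prems Ck_fam_rapid
    by (intro Ck_fam_SucI[OF rapid_conv fam_deriv_conv]) auto
qed (simp add: rapid_conv)

definition smooth_fam :: "modes \<Rightarrow> bool" where
  "smooth_fam f \<longleftrightarrow> (\<forall>k. Ck_fam k f)"

lemma smooth_fam_rapid: "smooth_fam f \<Longrightarrow> rapid f"
  unfolding smooth_fam_def using Ck_fam_rapid by blast

lemma smooth_fam_deriv: "smooth_fam f \<Longrightarrow> fam_deriv f (dfam f)"
  unfolding smooth_fam_def using Ck_fam.simps(2) by blast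

lemma smooth_fam_dfam: "smooth_fam f \<Longrightarrow> smooth_fam (dfam f)"
  unfolding smooth_fam_def using Ck_fam.simps(2) by blast

lemma smooth_fam_add: "smooth_fam f \<Longrightarrow> smooth_fam g \<Longrightarrow> smooth_fam (\<lambda>n s. f n s + g n s)"
  unfolding smooth_fam_def by (intro allI Ck_fam_add) auto

lemma smooth_fam_const: "smooth_fam f \<Longrightarrow> smooth_fam (\<lambda>n s. c * f n s)"
  unfolding smooth_fam_def by (intro allI Ck_fam_const) auto

lemma smooth_fam_shift: "smooth_fam f \<Longrightarrow> smooth_fam (\<lambda>n s. f (n + j) s)"
  unfolding smooth_fam_def by (intro allI Ck_fam_shift) auto

lemma smooth_fam_exp: "smooth_fam f \<Longrightarrow> smooth_fam (\<lambda>n s. of_real (exp (\<alpha> * s)) * f n s)"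
  unfolding smooth_fam_def by (intro allI Ck_fam_exp) auto

lemma smooth_fam_conv: "smooth_fam f \<Longrightarrow> smooth_fam g \<Longrightarrow> smooth_fam (conv f g)"
  unfolding smooth_fam_def by (intro allI Ck_fam_conv) auto

lemma smooth_fam_index: "smooth_fam f \<Longrightarrow> smooth_fam (\<lambda>n s. of_int n * f n s)"
  unfolding smooth_fam_def
  using Ck_fam_coeff[where c="\<lambda>n. of_int n" and A=1 and q=1] by (simp add: jbracket_def)

text \<open>The first-order system writes the derivative of each unknown as a polynomial expression
  in the unknowns (index multiplication, exponential factors and convolutions), and all these
  operations preserve \<open>Ck_fam k\<close>. So \<open>k\<close> derivatives of the unknowns give \<open>k + 1\<close>, and the
  induction starts from rapid decay alone.\<close>

lemma smooth_fam_bootstrap: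
  assumes r: "rapid \<psi>" "rapid \<psi>1" "rapid \<omega>" "rapid H"
    and d: "fam_deriv \<psi> \<psi>1"
      "fam_deriv \<psi>1 (\<lambda>n s. of_int n * (of_int n * \<psi> n s) + of_real (exp (2 * s)) * \<omega> n s)"
      "fam_deriv \<omega> (\<lambda>n s. \<i> * (of_int n * H n s) + (- \<i>) * conv (\<lambda>n s. of_int n * \<psi> n s) \<omega> n s)"
      "fam_deriv H (\<lambda>n s. (- \<i>) * (of_int n * \<omega> n s) + conv \<psi>1 \<omega> n s)"
  shows "smooth_fam \<psi>" "smooth_fam \<psi>1" "smooth_fam \<omega>" "smooth_fam H"
proof -
  have idx: "Ck_fam k f \<Longrightarrow> Ck_fam k (\<lambda>n s. of_int n * f n s)" for k f
    using Ck_fam_coeff[where c="\<lambda>n. of_int n" and A=1 and q=1] by (simp add: jbracket_def)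
  have "Ck_fam k \<psi> \<and> Ck_fam k \<psi>1 \<and> Ck_fam k \<omega> \<and> Ck_fam k H" for k
  proof (induction k)
    case 0
    then show ?case using r by simp
  next
    case (Suc k)
    then have E: "Ck_fam k \<psi>" "Ck_fam k \<psi>1" "Ck_fam k \<omega>" "Ck_fam k H" by auto
    show ?case
      by (intro conjI Ck_fam_SucI[OF r(1) d(1)] Ck_fam_SucI[OF r(2) d(2)] Ck_fam_SucI[OF r(3) d(3)] Ck_fam_SucI[OF r(4) d(4)]
          Ck_fam_add Ck_fam_const Ck_fam_conv Ck_fam_exp idx E)
  qed
  then show "smooth_fam \<psi>" "smooth_fam \<psi>1" "smooth_fam \<omega>" "smooth_fam H"
    unfolding smooth_fam_def by auto
qed

section \<open>Plane fields as Fourier sums in polar coordinates\<close>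

definition cpx :: "real ^ 2 \<Rightarrow> complex" where "cpx x = Complex (x $ 1) (x $ 2)"
definition vec2 :: "complex \<Rightarrow> real ^ 2" where "vec2 z = vector [Re z, Im z]"

lemma vec2_nth [simp]: "vec2 z $ 1 = Re z" "vec2 z $ 2 = Im z"
  by (simp_all add: vec2_def)

lemma cpx_sel [simp]: "Re (cpx x) = x $ 1" "Im (cpx x) = x $ 2"
  by (simp_all add: cpx_def)

lemma cpx_vec2 [simp]: "cpx (vec2 z) = z" by (simp add: complex_eq_iff)
lemma vec2_cpx [simp]: "vec2 (cpx x) = x" by (simp add: vec_eq_iff forall_2)

lemma norm_cpx [simp]: "norm (cpx x) = norm x"
  by (simp add: cmod_def norm_vec_def L2_set_def sum_2)

lemma norm_vec2 [simp]: "norm (vec2 z) = norm z"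
  using norm_cpx[of "vec2 z"] by simp

lemma bounded_linear_cpx: "bounded_linear cpx"
  by (rule bounded_linear_intro[where K=1]) (auto simp: complex_eq_iff)

lemma bounded_linear_vec2: "bounded_linear vec2"
  by (rule bounded_linear_intro[where K=1]) (auto simp: vec_eq_iff forall_2)

lemma inner_cpx: "x \<bullet> y = Re (cnj (cpx x) * cpx y)"
  by (simp add: inner_vec_def sum_2)

lemma exterior_iff: "x \<in> exterior \<longleftrightarrow> 1 < norm x"
  by (simp add: exterior_def not_le)

lemma open_exterior: "open exterior"
  unfolding exterior_def by (rule open_Compl) (rule closed_closure)

text \<open>The field with modes \<open>f\<close>. In polar coordinates \<open>sgn (cpx x)\<close> is \<open>e^(i \<theta>)\<close>, so the sum is
  the Fourier series in the angle at \<open>s = ln r\<close>; this form needs no choice of the angle.\<close>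

definition synth :: "modes \<Rightarrow> real ^ 2 \<Rightarrow> complex" where
  "synth f x = (\<Sum>\<^sub>\<infinity>n. f n (ln (norm x)) * sgn (cpx x) powi n)"

text \<open>On the level of modes, \<open>Dbar\<close> and \<open>Dz\<close> are the Wirtinger derivatives
  \<open>e^(i \<theta>) (\<partial>_s + i \<partial>_\<theta>) / (2 r)\<close> and \<open>e^(- i \<theta>) (\<partial>_s - i \<partial>_\<theta>) / (2 r)\<close>: the exponential
  factors in the angle shift the index. The sums are written with \<open>-1 * s\<close> and \<open>n + -1\<close> so
  that they match the closure rules for smooth families literally.\<close>

definition Dbar :: "modes \<Rightarrow> modes" where
  "Dbar f n s = of_real (exp (-1 * s)) * (1/2 * (dfam f (n + -1) s + (-1) * (of_int (n + -1) * f (n + -1) s)))"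

definition Dz :: "modes \<Rightarrow> modes" where
  "Dz f n s = of_real (exp (-1 * s)) * (1/2 * (dfam f (n + 1) s + of_int (n + 1) * f (n + 1) s))"

text \<open>The derivative of the synthesised field in the direction \<open>v\<close>, see
  \<open>has_derivative_synth\<close>.\<close>

definition Dv :: "complex \<Rightarrow> modes \<Rightarrow> modes" where
  "Dv v f n s = cnj v * Dbar f n s + v * Dz f n s"

lemma smooth_fam_Dbar: assumes "smooth_fam f" shows "smooth_fam (Dbar f)"
proof -
  have g: "smooth_fam (\<lambda>n s. dfam f n s + (-1) * (of_int n * f n s))"
    by (intro smooth_fam_add smooth_fam_const smooth_fam_dfam smooth_fam_index assms)
  show ?thesis unfolding Dbar_def[abs_def]
    by (intro smooth_fam_exp smooth_fam_const smooth_fam_shift[OF g, of "-1"])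
qed

lemma smooth_fam_Dz: assumes "smooth_fam f" shows "smooth_fam (Dz f)"
proof -
  have g: "smooth_fam (\<lambda>n s. dfam f n s + of_int n * f n s)"
    by (intro smooth_fam_add smooth_fam_const smooth_fam_dfam smooth_fam_index assms)
  show ?thesis unfolding Dz_def[abs_def]
    by (intro smooth_fam_exp smooth_fam_const smooth_fam_shift[OF g, of 1])
qed

lemma smooth_fam_Dv: "smooth_fam f \<Longrightarrow> smooth_fam (Dv v f)"
  unfolding Dv_def[abs_def] by (intro smooth_fam_add smooth_fam_const smooth_fam_Dbar smooth_fam_Dz)

lemma norm_sgn_cpx: "1 < norm x \<Longrightarrow> norm (sgn (cpx x) powi n) = 1"
proof -
  assume "1 < norm x"
  then have "cpx x \<noteq> 0" using norm_cpx[of x] by (metis norm_zero not_one_less_zero)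
  then show ?thesis by (simp add: norm_power_int norm_sgn)
qed

lemma summable_synth:
  assumes "rapid f" "1 < norm x"
  shows "(\<lambda>n. f n (ln (norm x)) * sgn (cpx x) powi n) summable_on UNIV"
proof -
  let ?s = "ln (norm x)"
  have s: "0 < ?s" using assms(2) by (rule ln_gt_zero)
  obtain C where "0 \<le> C" and C: "\<forall>n s. ?s \<le> s \<longrightarrow> s \<le> ?s \<longrightarrow> jbracket n ^ 0 * norm (f n s) \<le> C * wt n"
    using rapidE_wt[OF assms(1) s, of ?s 0] by blast
  show ?thesis
    by (rule norm_infsum_le_majorant(1)[OF summable_on_cmult_right[OF wt_summable, of C]])
      (use C assms(2) in \<open>auto simp: norm_mult norm_sgn_cpx\<close>)
qed

lemma synth_add:
  assumes "rapid f" "rapid g" "1 < norm x"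
  shows "synth (\<lambda>n s. f n s + g n s) x = synth f x + synth g x"
  unfolding synth_def distrib_right by (intro infsum_add summable_synth assms)

lemma synth_const: "synth (\<lambda>n s. c * f n s) x = c * synth f x"
  unfolding synth_def by (simp only: infsum_cmult_right' mult.assoc)

lemma synth_cong: "1 < norm x \<Longrightarrow> (\<And>n s. 0 < s \<Longrightarrow> f n s = g n s) \<Longrightarrow> synth f x = synth g x"
  unfolding synth_def by (intro infsum_cong arg_cong2[where f="(*)"]) (auto simp: ln_gt_zero)

text \<open>Absolute convergence allows the double sum to be rearranged along
  \<open>(n, k) \<mapsto> (k, n - k)\<close>.\<close>

lemma synth_conv:
  assumes r: "rapid f" "rapid g" and x: "1 < norm x"
  shows "synth (conv f g) x = synth f x * synth g x"
proof -
  let ?s = "ln (norm x)" let ?e = "sgn (cpx x)"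
  have s: "0 < ?s" using x by (rule ln_gt_zero)
  have e0: "?e \<noteq> 0" using x by (auto simp: sgn_zero_iff) (metis norm_cpx norm_zero not_one_less_zero)
  obtain C where C0: "0 \<le> C" and C: "\<forall>n s. ?s \<le> s \<longrightarrow> s \<le> ?s \<longrightarrow> jbracket n ^ 0 * norm (f n s) \<le> C * wt n"
    using rapidE_wt[OF r(1) s, of ?s 0] by blast
  obtain D where D0: "0 \<le> D" and D: "\<forall>n s. ?s \<le> s \<longrightarrow> s \<le> ?s \<longrightarrow> jbracket n ^ 0 * norm (g n s) \<le> D * wt n"
    using rapidE_wt[OF r(2) s, of ?s 0] by blast
  define F where "F k = f k ?s * ?e powi k" for k
  define G where "G k = g k ?s * ?e powi k" for k
  have Fb: "norm (F k) \<le> C * wt k" for k using C x by (simp add: F_def norm_mult norm_sgn_cpx)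
  have Gb: "norm (G k) \<le> D * wt k" for k using D x by (simp add: G_def norm_mult norm_sgn_cpx)
  have aF: "(\<lambda>k. norm (F k)) summable_on UNIV" and aG: "(\<lambda>k. norm (G k)) summable_on UNIV"
    using Infinite_Sum.abs_summable_on_comparison_test'[OF summable_on_cmult_right[OF wt_summable] Fb]
      Infinite_Sum.abs_summable_on_comparison_test'[OF summable_on_cmult_right[OF wt_summable] Gb] by auto
  have "(\<lambda>p. norm ((\<lambda>(n, k). F k * G (n - k)) p)) summable_on (UNIV \<times> UNIV)"
  proof -
    have "(\<lambda>p. norm ((\<lambda>(k, j). F k * G j) p)) summable_on (UNIV \<times> UNIV)"
    proof (subst Infinite_Sum.abs_summable_on_Sigma_iff, intro conjI ballI)
      show "(\<lambda>y. norm (case (k, y) of (k, j) \<Rightarrow> F k * G j)) summable_on UNIV" for k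
        using aG by (simp add: norm_mult summable_on_cmult_right)
      show "(\<lambda>k. norm (\<Sum>\<^sub>\<infinity>y. norm (case (k, y) of (k, j) \<Rightarrow> F k * G j))) summable_on UNIV"
        using aF by (simp add: norm_mult infsum_cmult_right' summable_on_cmult_left abs_mult)
    qed
    moreover have "bij_betw (\<lambda>(n, k). (k, n - k)) (UNIV \<times> UNIV) (UNIV \<times> (UNIV :: int set))"
      by (rule bij_betw_byWitness[where f'="\<lambda>(k, j). (k + j, k)"]) auto
    ultimately have "(\<lambda>p. norm ((\<lambda>(k, j). F k * G j) ((\<lambda>(n, k). (k, n - k)) p))) summable_on (UNIV \<times> UNIV)"
      by (subst summable_on_reindex_bij_betw)
    then show ?thesis by (simp add: case_prod_unfold)
  qed
  then have sw: "(\<lambda>(n, k). F k * G (n - k)) summable_on (UNIV \<times> UNIV)"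
    by (rule abs_summable_summable)
  have "synth (conv f g) x = (\<Sum>\<^sub>\<infinity>n. \<Sum>\<^sub>\<infinity>k. F k * G (n - k))"
  proof -
    have "conv f g n ?s * ?e powi n = (\<Sum>\<^sub>\<infinity>k. F k * G (n - k))" for n
    proof -
      have "F k * G (n - k) = f k ?s * g (n - k) ?s * ?e powi n" for k
      proof -
        have "?e powi k * ?e powi (n - k) = ?e powi n"
          using e0 by (simp flip: power_int_add)
        then show ?thesis by (simp add: F_def G_def mult_ac)
      qed
      then show ?thesis by (simp add: conv_def infsum_cmult_left')
    qed
    then show ?thesis by (simp add: synth_def)
  qed
  also have "\<dots> = (\<Sum>\<^sub>\<infinity>k. \<Sum>\<^sub>\<infinity>n. F k * G (n - k))"
    using sw by (rule infsum_swap_banach)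
  also have "\<dots> = (\<Sum>\<^sub>\<infinity>k. F k * (\<Sum>\<^sub>\<infinity>j. G j))"
    by (simp add: infsum_cmult_right' infsum_shift_int)
  also have "\<dots> = synth f x * synth g x"
    by (simp add: infsum_cmult_left' synth_def F_def G_def)
  finally show ?thesis .
qed

lemma has_derivative_synth_term:
  assumes f: "(f has_vector_derivative f') (at (ln (norm x)))" and x: "x \<noteq> 0"
  shows "((\<lambda>y. f (ln (norm y)) * sgn (cpx y) powi n) has_derivative
     (\<lambda>h. of_real (exp (- ln (norm x))) * (1/2 * (
        cnj (cpx h) * sgn (cpx x) powi (n + 1) * (f' - of_int n * f (ln (norm x))) +
        cpx h * sgn (cpx x) powi (n - 1) * (f' + of_int n * f (ln (norm x))))))) (at x)"
proof -
  let ?r = "norm x" let ?e = "sgn (cpx x)"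
  have r: "0 < ?r" using x by simp
  have cx: "cpx x \<noteq> 0" using norm_cpx[of x] x by (metis norm_eq_zero)
  then have e0: "?e \<noteq> 0" by (simp add: sgn_zero_iff)
  have ec: "?e * cnj ?e = 1" using cx by (simp add: complex_norm_square[symmetric] norm_sgn)
  have xe: "cpx x = of_real ?r * ?e" using norm_cpx[of x] r by (simp add: sgn_div_norm scaleR_conv_of_real field_simps)
  define q where "q h = Re (cnj ?e * cpx h)" for h
  have dn: "(norm has_derivative q) (at x)"
  proof -
    have "(norm has_derivative (\<lambda>h. inner h (sgn x))) (at x)"
      using x by (rule has_derivative_norm)
    moreover have "inner h (sgn x) = q h" for h
      using r by (simp add: q_def sgn_div_norm inner_cpx[of h] inner_commute[of h] inner_cpx[of x] field_simps)
    ultimately show ?thesis by simp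
  qed
  have dl: "((\<lambda>y. ln (norm y)) has_derivative (\<lambda>h. q h / ?r)) (at x)"
    using has_derivative_ln[OF r dn] by (simp add: divide_inverse)
  have df: "((\<lambda>y. f (ln (norm y))) has_derivative (\<lambda>h. (q h / ?r) *\<^sub>R f')) (at x)"
    using has_derivative_compose[OF dl f[unfolded has_vector_derivative_def]] .
  have dc: "(cpx has_derivative cpx) (at x)"
    by (rule bounded_linear_imp_has_derivative[OF bounded_linear_cpx])
  have di: "((\<lambda>y. complex_of_real (inverse (norm y))) has_derivative (\<lambda>h. of_real (- (q h / ?r^2)))) (at x)"
    by (rule has_derivative_of_real)
      (use Deriv.has_derivative_inverse[OF _ dn] r in \<open>simp add: power2_eq_square divide_inverse mult_ac\<close>)
  have ds: "((\<lambda>y. sgn (cpx y)) has_derivative (\<lambda>h. (cpx h - of_real (q h) * ?e) / of_real ?r)) (at x)"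
  proof -
    have "((\<lambda>y. cpx y * complex_of_real (inverse (norm y))) has_derivative
        (\<lambda>h. cpx x * of_real (- (q h / ?r^2)) + cpx h * of_real (inverse (norm x)))) (at x)"
      by (rule has_derivative_mult[OF dc di])
    moreover have "cpx x * of_real (- (q h / ?r^2)) + cpx h * of_real (inverse (norm x)) =
        (cpx h - of_real (q h) * ?e) / of_real ?r" for h
      using r by (subst xe) (simp add: field_simps power2_eq_square)
    moreover have "sgn (cpx y) = cpx y * complex_of_real (inverse (norm y))" for y
      by (simp add: sgn_div_norm scaleR_conv_of_real mult.commute)
    ultimately show ?thesis by simp
  qed
  have dp: "((\<lambda>y. sgn (cpx y) powi n) has_derivative
      (\<lambda>h. (cpx h - of_real (q h) * ?e) / of_real ?r * (of_int n * ?e powi (n - 1)))) (at x)"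
    by (rule has_derivative_power_int[OF _ ds]) (use e0 in simp)
  have er: "exp (- ln ?r) = inverse ?r" using r by (simp add: exp_minus)
  have eq: "f (ln ?r) * ((cpx h - of_real (q h) * ?e) / of_real ?r * (of_int n * ?e powi (n - 1)))
      + (q h / ?r) *\<^sub>R f' * ?e powi n =
     of_real (exp (- ln (norm x))) * (1/2 * (
        cnj (cpx h) * ?e powi (n + 1) * (f' - of_int n * f (ln (norm x))) +
        cpx h * ?e powi (n - 1) * (f' + of_int n * f (ln (norm x)))))" for h
  proof -
    have q: "of_real (q h) = (cnj ?e * cpx h + ?e * cnj (cpx h)) / 2"
      unfolding q_def by (simp add: complex_eq_iff algebra_simps)
    define P where "P = ?e powi (n - 1)"
    have p: "?e powi n = P * ?e" "?e powi (n + 1) = P * ?e * ?e"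
      using power_int_add_1[of ?e "n - 1"] power_int_add_1[of ?e n] e0 by (simp_all add: P_def)
    have w: "of_real (q h) * ?e = (cpx h + ?e * ?e * cnj (cpx h)) / 2"
      using ec unfolding q by algebra
    show ?thesis unfolding er p P_def[symmetric] scaleR_conv_of_real
    proof -
      have eq1: "f (ln ?r) * ((cpx h - of_real (q h) * ?e) / of_real ?r * (of_int n * P)) + of_real (q h / ?r) * f' * (P * ?e)
        = (f (ln ?r) * ((cpx h - of_real (q h) * ?e) * (of_int n * P)) + (of_real (q h) * ?e) * f' * P) / of_real ?r"
        using r by (simp add: field_simps)
      show "f (ln ?r) * ((cpx h - of_real (q h) * ?e) / of_real ?r * (of_int n * P)) + of_real (q h / ?r) * f' * (P * ?e) =
          of_real (inverse ?r) * (1/2 * (cnj (cpx h) * (P * ?e * ?e) * (f' - of_int n * f (ln ?r)) + cpx h * P * (f' + of_int n * f (ln ?r))))"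
        unfolding eq1 unfolding w using r by (simp add: field_simps)
    qed
  qed
  show ?thesis using has_derivative_mult[OF df dp] unfolding eq .
qed

text
  \<open>Directional derivatives of a field with smooth modes are again fields with smooth modes. This is what makes the class of synthesised fields closed under differentiation.\<close>

lemma has_derivative_synth:
  assumes f: "smooth_fam f" and x: "1 < norm x"
  shows "(synth f has_derivative (\<lambda>h. synth (Dv (cpx h) f) x)) (at x)"
proof -
  \<comment> \<open>A ball that stays away from the circle, so that \<open>ln (norm y)\<close> ranges in a compact part of
    the open half-line.\<close>
  define r where "r = (norm x - 1) / 2"
  have r: "0 < r" using x by (simp add: r_def)
  define S where "S = ball x r"
  have S: "open S" "convex S" "x \<in> S" using r by (auto simp: S_def)
  define s0 where "s0 = ln (norm x - r)"
  define s1 where "s1 = ln (norm x + r)"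
  have gt: "1 < norm x - r" using x by (simp add: r_def field_simps)
  then have s0: "0 < s0" by (simp add: s0_def)
  have inS: "1 < norm y" "s0 \<le> ln (norm y)" "ln (norm y) \<le> s1" if "y \<in> S" for y
  proof -
    have "norm (x - y) < r" using that by (simp add: S_def dist_norm)
    then have "norm x - r < norm y" "norm y < norm x + r"
      using norm_triangle_ineq2[of x y] norm_triangle_ineq2[of y x] by (simp_all add: norm_minus_commute)
    then show "1 < norm y" "s0 \<le> ln (norm y)" "ln (norm y) \<le> s1"
      using gt by (auto simp: s0_def s1_def intro!: ln_mono)
  qed
  have d: "(f n has_vector_derivative dfam f n s) (at s)" if "0 < s" for n s
    using smooth_fam_deriv[OF f] that unfolding fam_deriv_def by blast
  obtain C where C0: "0 \<le> C" and C: "\<forall>n s. s0 \<le> s \<longrightarrow> s \<le> s1 \<longrightarrow> jbracket n ^ 1 * norm (f n s) \<le> C * wt n"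
    using rapidE_wt[OF smooth_fam_rapid[OF f] s0, of s1 1] by blast
  obtain D where D0: "0 \<le> D" and D: "\<forall>n s. s0 \<le> s \<longrightarrow> s \<le> s1 \<longrightarrow> jbracket n ^ 1 * norm (dfam f n s) \<le> D * wt n"
    using rapidE_wt[OF smooth_fam_rapid[OF smooth_fam_dfam[OF f]] s0, of s1 1] by blast
  define b where "b n = (C + D) * wt n" for n
  define T where "T n y h = of_real (exp (- ln (norm y))) * (1/2 * (
        cnj (cpx h) * sgn (cpx y) powi (n + 1) * (dfam f n (ln (norm y)) - of_int n * f n (ln (norm y))) +
        cpx h * sgn (cpx y) powi (n - 1) * (dfam f n (ln (norm y)) + of_int n * f n (ln (norm y)))))" for n y h
  have fb: "norm (f n s) \<le> C * wt n" "norm (of_int n * f n s) \<le> C * wt n" "norm (dfam f n s) \<le> D * wt n"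
    if "s0 \<le> s" "s \<le> s1" for n s
  proof -
    have "jbracket n * norm (f n s) \<le> C * wt n" "jbracket n * norm (dfam f n s) \<le> D * wt n"
      using C D that by auto
    moreover have "1 * norm (f n s) \<le> jbracket n * norm (f n s)" "1 * norm (dfam f n s) \<le> jbracket n * norm (dfam f n s)"
      by (intro mult_right_mono jbracket_ge1 norm_ge_zero)+
    moreover have "\<bar>real_of_int n\<bar> * norm (f n s) \<le> jbracket n * norm (f n s)"
      by (intro mult_right_mono) (auto simp: jbracket_def)
    ultimately show "norm (f n s) \<le> C * wt n" "norm (of_int n * f n s) \<le> C * wt n" "norm (dfam f n s) \<le> D * wt n"
      by (auto simp: norm_mult)
  qed
  have "((\<lambda>y. \<Sum>\<^sub>\<infinity>n. f n (ln (norm y)) * sgn (cpx y) powi n) has_derivative (\<lambda>h. \<Sum>\<^sub>\<infinity>n. T n x h)) (at x)"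
  proof (rule has_derivative_infsum_int[OF S(1,2), where b=b])
    fix n y assume y: "y \<in> S"
    show "((\<lambda>y. f n (ln (norm y)) * sgn (cpx y) powi n) has_derivative T n y) (at y)"
      unfolding T_def by (rule has_derivative_synth_term[OF d]) (use inS[OF y] s0 in auto)
    have w: "0 \<le> C * wt n" "0 \<le> D * wt n" using C0 D0 wt_pos[of n] by auto
    show "norm (f n (ln (norm y)) * sgn (cpx y) powi n) \<le> b n"
      using fb(1)[OF inS(2,3)[OF y], of n] w by (simp add: norm_mult norm_sgn_cpx inS[OF y] b_def distrib_right)
    show "norm (T n y h) \<le> b n * norm h" for h
    proof -
      have e1: "exp (- ln (norm y)) \<le> 1" using inS[OF y] s0 by auto
      let ?A = "dfam f n (ln (norm y)) - of_int n * f n (ln (norm y))"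
      let ?B = "dfam f n (ln (norm y)) + of_int n * f n (ln (norm y))"
      have A: "norm ?A \<le> b n" "norm ?B \<le> b n"
        using fb(2,3)[OF inS(2,3)[OF y], of n] norm_triangle_ineq4[of "dfam f n (ln (norm y))" "of_int n * f n (ln (norm y))"]
          norm_triangle_ineq[of "dfam f n (ln (norm y))" "of_int n * f n (ln (norm y))"]
        by (simp_all add: b_def distrib_right)
      have "norm (T n y h) = exp (- ln (norm y)) * (1/2 * norm (
        cnj (cpx h) * sgn (cpx y) powi (n + 1) * ?A + cpx h * sgn (cpx y) powi (n - 1) * ?B))"
        unfolding T_def norm_mult norm_of_real by simp
      also have "\<dots> \<le> 1 * (1/2 * (norm h * b n + norm h * b n))"
      proof (intro mult_mono e1 order.refl)
        have "norm (cnj (cpx h) * sgn (cpx y) powi (n + 1) * ?A) = norm h * norm ?A"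
          "norm (cpx h * sgn (cpx y) powi (n - 1) * ?B) = norm h * norm ?B"
          by (simp_all only: norm_mult norm_sgn_cpx[OF inS(1)[OF y]] complex_mod_cnj norm_cpx mult_1_right)
        note eqs = this
        show "norm (cnj (cpx h) * sgn (cpx y) powi (n + 1) * ?A + cpx h * sgn (cpx y) powi (n - 1) * ?B)
          \<le> norm h * b n + norm h * b n"
          by (rule norm_triangle_le, unfold eqs) (intro add_mono mult_left_mono A norm_ge_zero)
      qed auto
      finally show ?thesis by (simp add: mult.commute)
    qed
  next
    show "b summable_on UNIV" unfolding b_def by (intro summable_on_cmult_right wt_summable)
  qed (rule S(3))
  moreover have "(\<Sum>\<^sub>\<infinity>n. T n x h) = synth (Dv (cpx h) f) x" for h
  proof -
    let ?s = "ln (norm x)" let ?e = "sgn (cpx x)"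
    have sm: "rapid (Dbar f)" "rapid (Dz f)"
      using f smooth_fam_Dbar smooth_fam_Dz smooth_fam_rapid by auto
    define a where "a n = Dbar f n ?s * ?e powi n" for n
    define c where "c n = Dz f n ?s * ?e powi n" for n
    have sa: "a summable_on UNIV" "c summable_on UNIV"
      unfolding a_def c_def by (rule summable_synth[OF sm(1) x], rule summable_synth[OF sm(2) x])
    have "T n x h = cnj (cpx h) * a (n + 1) + cpx h * c (n - 1)" for n
      by (simp add: T_def a_def c_def Dbar_def Dz_def algebra_simps)
    then have "(\<Sum>\<^sub>\<infinity>n. T n x h) = (\<Sum>\<^sub>\<infinity>n. cnj (cpx h) * a (n + 1) + cpx h * c (n - 1))" by simp
    also have "\<dots> = (\<Sum>\<^sub>\<infinity>n. cnj (cpx h) * a (n + 1)) + (\<Sum>\<^sub>\<infinity>n. cpx h * c (n - 1))"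
      using sa by (intro infsum_add summable_on_cmult_right) (simp_all add: summable_shift_int)
    also have "\<dots> = cnj (cpx h) * synth (Dbar f) x + cpx h * synth (Dz f) x"
      by (simp add: infsum_cmult_right' infsum_shift_int[of a] infsum_shift_int[of c])
        (simp add: a_def c_def synth_def)
    also have "\<dots> = synth (Dv (cpx h) f) x"
    proof -
      have "synth (Dv (cpx h) f) x = synth (\<lambda>n s. cnj (cpx h) * Dbar f n s) x + synth (\<lambda>n s. cpx h * Dz f n s) x"
        unfolding Dv_def[abs_def] using x smooth_fam_Dbar[OF f] smooth_fam_Dz[OF f]
        by (intro synth_add smooth_fam_rapid smooth_fam_const)
      then show ?thesis by (simp add: synth_const)
    qed
    finally show ?thesis .
  qed
  ultimately show ?thesis unfolding synth_def[abs_def] by simp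
qed

lemma has_derivative_lin_synth:
  assumes A: "bounded_linear A" and f: "smooth_fam f"
    and F: "\<And>y. y \<in> exterior \<Longrightarrow> F y = A (synth f y)" and x: "x \<in> exterior"
  shows "(F has_derivative (\<lambda>h. A (synth (Dv (cpx h) f) x))) (at x)"
proof -
  have "((\<lambda>y. A (synth f y)) has_derivative (\<lambda>h. A (synth (Dv (cpx h) f) x))) (at x)"
    by (rule bounded_linear.has_derivative[OF A has_derivative_synth[OF f]]) (use x in \<open>simp add: exterior_iff\<close>)
  then show ?thesis
    by (rule has_derivative_transform_within_open[OF _ open_exterior x]) (simp add: F)
qed

lemma frechet_lin_synth:
  assumes "bounded_linear A" "smooth_fam f" "\<And>y. y \<in> exterior \<Longrightarrow> F y = A (synth f y)" "x \<in> exterior"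
  shows "frechet_derivative F (at x) h = A (synth (Dv (cpx h) f) x)"
  using frechet_derivative_at[OF has_derivative_lin_synth[OF assms]] by metis

text \<open>Induction on the order of differentiability, with the mode family generalised: a
  derivative of a synthesised field is the synthesised field of \<open>Dv v f\<close>. The linear map \<open>A\<close>
  covers vector-valued fields and real parts in one statement.\<close>

lemma smooth_on_lin_synth:
  assumes A: "bounded_linear A" and f: "smooth_fam f"
    and F: "\<And>y. y \<in> exterior \<Longrightarrow> F y = A (synth f y)"
  shows "smooth_on F exterior"
proof -
  have diff: "F differentiable_on exterior"
    if "smooth_fam f" "\<And>y. y \<in> exterior \<Longrightarrow> F y = A (synth f y)" for f F
    unfolding differentiable_on_def
    using has_derivative_lin_synth[OF A that] has_derivative_at_withinI differentiableI by blast
  have "Ck_on k F exterior"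
    if "smooth_fam f" "\<And>y. y \<in> exterior \<Longrightarrow> F y = A (synth f y)" for k f F
    using that
  proof (induction k arbitrary: f F)
    case 0
    have "continuous_on exterior F" using diff[OF 0] by (rule differentiable_imp_continuous_on)
    then show ?case by simp
  next
    case (Suc k)
    have "Ck_on k (\<lambda>x. frechet_derivative F (at x) v) exterior" for v
      by (rule Suc.IH[OF smooth_fam_Dv[OF Suc.prems(1)], of _ "cpx v"])
        (rule frechet_lin_synth[OF A Suc.prems])
    then show ?case using diff[of f F] Suc.prems by simp
  qed
  then show ?thesis using f F unfolding smooth_on_def by blast
qed

section \<open>Algebra of the Wirtinger operators\<close>

lemma dfam_Dbar:
  assumes "smooth_fam f" "0 < s"
  shows "dfam (Dbar f) n s = of_real (exp (- s)) / 2 * (dfam (dfam f) (n - 1) s - of_int n * dfam f (n - 1) s + of_int (n - 1) * f (n - 1) s)"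
proof -
  have d: "fam_deriv f (dfam f)" "fam_deriv (dfam f) (dfam (dfam f))"
    using assms smooth_fam_deriv smooth_fam_dfam by auto
  have "fam_deriv (Dbar f) (\<lambda>n s. of_real (exp (-1 * s)) * (of_real (-1) * (1/2 * (dfam f (n + -1) s + (-1) * (of_int (n + -1) * f (n + -1) s)))
     + 1/2 * (dfam (dfam f) (n + -1) s + (-1) * (of_int (n + -1) * dfam f (n + -1) s))))"
    unfolding Dbar_def[abs_def]
    by (intro fam_deriv_exp fam_deriv_coeff fam_deriv_add fam_deriv_shift d)
  from fam_deriv_dfam[OF this assms(2), of n] show ?thesis
    by (simp add: algebra_simps add_divide_distrib diff_divide_distrib)
qed

lemma dfam_Dz:
  assumes "smooth_fam f" "0 < s"
  shows "dfam (Dz f) n s = of_real (exp (- s)) / 2 * (dfam (dfam f) (n + 1) s + of_int n * dfam f (n + 1) s - of_int (n + 1) * f (n + 1) s)"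
proof -
  have d: "fam_deriv f (dfam f)" "fam_deriv (dfam f) (dfam (dfam f))"
    using assms smooth_fam_deriv smooth_fam_dfam by auto
  have "fam_deriv (Dz f) (\<lambda>n s. of_real (exp (-1 * s)) * (of_real (-1) * (1/2 * (dfam f (n + 1) s + (of_int (n + 1) * f (n + 1) s)))
     + 1/2 * (dfam (dfam f) (n + 1) s + (of_int (n + 1) * dfam f (n + 1) s))))"
    unfolding Dz_def[abs_def]
    by (intro fam_deriv_exp fam_deriv_coeff fam_deriv_add fam_deriv_shift d)
  from fam_deriv_dfam[OF this assms(2), of n] show ?thesis
    by (simp add: algebra_simps add_divide_distrib diff_divide_distrib)
qed

text \<open>Both compositions are a quarter of the Laplacian in log-polar coordinates,
  \<open>r^-2 (\<partial>_s^2 + \<partial>_\<theta>^2) / 4\<close>.\<close>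

lemma Dz_Dbar:
  assumes "smooth_fam f" "0 < s"
  shows "Dz (Dbar f) n s = of_real (exp (- 2 * s)) / 4 * (dfam (dfam f) n s - of_int n * (of_int n * f n s))"
    "Dbar (Dz f) n s = of_real (exp (- 2 * s)) / 4 * (dfam (dfam f) n s - of_int n * (of_int n * f n s))"
proof -
  have e: "exp (- 2 * s) = exp (- s) * exp (- s)" by (simp flip: exp_add)
  show "Dz (Dbar f) n s = of_real (exp (- 2 * s)) / 4 * (dfam (dfam f) n s - of_int n * (of_int n * f n s))"
    unfolding Dz_def[of "Dbar f"] dfam_Dbar[OF assms] e
    by (simp add: Dbar_def algebra_simps add_divide_distrib diff_divide_distrib)
  show "Dbar (Dz f) n s = of_real (exp (- 2 * s)) / 4 * (dfam (dfam f) n s - of_int n * (of_int n * f n s))"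
    unfolding Dbar_def[of "Dz f"] dfam_Dz[OF assms] e
    by (simp add: Dz_def algebra_simps add_divide_distrib diff_divide_distrib)
qed

lemma Dbar_const: "smooth_fam f \<Longrightarrow> 0 < s \<Longrightarrow> Dbar (\<lambda>n s. c * f n s) n s = c * Dbar f n s"
  and Dz_const: "smooth_fam f \<Longrightarrow> 0 < s \<Longrightarrow> Dz (\<lambda>n s. c * f n s) n s = c * Dz f n s"
proof -
  assume a: "smooth_fam f" "0 < s"
  have "dfam (\<lambda>n s. c * f n s) n s = c * dfam f n s" for n
    by (rule fam_deriv_dfam[OF fam_deriv_coeff[OF smooth_fam_deriv[OF a(1)]] a(2)])
  then show "Dbar (\<lambda>n s. c * f n s) n s = c * Dbar f n s" "Dz (\<lambda>n s. c * f n s) n s = c * Dz f n s"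
    by (simp_all add: Dbar_def Dz_def algebra_simps)
qed

lemma Dbar_cong: "(\<And>n s. 0 < s \<Longrightarrow> f n s = g n s) \<Longrightarrow> 0 < s \<Longrightarrow> Dbar f n s = Dbar g n s"
  and Dz_cong: "(\<And>n s. 0 < s \<Longrightarrow> f n s = g n s) \<Longrightarrow> 0 < s \<Longrightarrow> Dz f n s = Dz g n s"
  using dfam_cong[of f g s] by (simp_all add: Dbar_def Dz_def)

text \<open>The modes of a real-valued function.\<close>

definition real_fam :: "modes \<Rightarrow> bool" where
  "real_fam f \<longleftrightarrow> (\<forall>n s. 0 < s \<longrightarrow> f (- n) s = cnj (f n s))"

lemma cnj_synth:
  assumes "\<And>n s. 0 < s \<Longrightarrow> g (- n) s = cnj (f n s)" "1 < norm x"
  shows "cnj (synth f x) = synth g x"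
proof -
  let ?e = "sgn (cpx x)"
  have cx: "cpx x \<noteq> 0" using assms(2) by (metis norm_cpx norm_zero not_one_less_zero)
  have "?e * cnj ?e = 1" using cx by (simp add: complex_norm_square[symmetric] norm_sgn)
  then have "cnj ?e = inverse ?e" by (metis inverse_unique)
  then have e: "cnj (?e powi n) = ?e powi (- n)" for n
    by (simp add: power_int_minus power_int_inverse)
  have "cnj (synth f x) = (\<Sum>\<^sub>\<infinity>n. g (- n) (ln (norm x)) * ?e powi (- n))"
    unfolding synth_def infsum_cnj[symmetric] using assms by (simp only: complex_cnj_mult e ln_gt_zero)
  also have "\<dots> = synth g x" unfolding synth_def by (rule infsum_shift_int(4))
  finally show ?thesis .
qed

lemma dfam_real_fam:
  assumes "smooth_fam f" "real_fam f" "0 < s"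
  shows "dfam f (- n) s = cnj (dfam f n s)"
proof -
  have "(f n has_vector_derivative dfam f n s) (at s)"
    using smooth_fam_deriv[OF assms(1)] assms(3) unfolding fam_deriv_def by blast
  then have "((\<lambda>s. cnj (f n s)) has_vector_derivative cnj (dfam f n s)) (at s)"
    by (rule has_vector_derivative_cnj)
  then have "(f (- n) has_vector_derivative cnj (dfam f n s)) (at s)"
    by (rule has_vector_derivative_transform_within_open[where S="{0<..}"])
      (use assms in \<open>auto simp: real_fam_def\<close>)
  then show ?thesis unfolding dfam_def by (rule vector_derivative_at)
qed

lemma cnj_synth_Dbar:
  assumes "smooth_fam f" "real_fam f" "1 < norm x"
  shows "cnj (synth (Dbar f) x) = synth (Dz f) x"
proof (rule cnj_synth[OF _ assms(3)])
  fix n and s :: real assume s: "0 < s"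
  have "f (- n + 1) s = cnj (f (n - 1) s)" "dfam f (- n + 1) s = cnj (dfam f (n - 1) s)"
    using dfam_real_fam[OF assms(1,2) s, of "n - 1"] assms(2) s unfolding real_fam_def
    by (metis minus_diff_eq uminus_add_conv_diff add.commute)+
  then show "Dz f (- n) s = cnj (Dbar f n s)"
    by (simp add: Dz_def Dbar_def algebra_simps)
qed

section \<open>The Navier-Stokes equations from the mode system\<close>

lemma conv_commute: "conv f g n s = conv g f n s"
proof -
  have "(\<Sum>\<^sub>\<infinity>k. (\<lambda>j. g j s * f (n - j) s) (n - k)) = (\<Sum>\<^sub>\<infinity>j. g j s * f (n - j) s)"
    by (rule infsum_shift_int(3))
  then show ?thesis by (simp add: conv_def mult.commute)
qed

text \<open>Multiplication of fields commutes with the index shift in \<open>Dbar\<close>. On the right stand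
  exactly the two quadratic terms of the mode system.\<close>

lemma conv_Dbar:
  assumes "rapid w" "smooth_fam f" "0 < s"
  shows "conv w (Dbar f) n s = of_real (exp (- s)) * (1/2) * (conv (dfam f) w (n - 1) s - conv (\<lambda>n s. of_int n * f n s) w (n - 1) s)"
proof -
  let ?g = "\<lambda>n s. of_int n * f n s"
  have r: "rapid (dfam f)" "rapid ?g"
    using assms smooth_fam_rapid smooth_fam_dfam smooth_fam_index by auto
  have "conv (dfam f) w (n - 1) s - conv ?g w (n - 1) s =
    (\<Sum>\<^sub>\<infinity>k. w k s * dfam f (n - 1 - k) s) - (\<Sum>\<^sub>\<infinity>k. w k s * ?g (n - 1 - k) s)"
    unfolding conv_commute[of "dfam f"] conv_commute[of ?g] by (simp add: conv_def)
  also have "\<dots> = (\<Sum>\<^sub>\<infinity>k. w k s * dfam f (n - 1 - k) s) + (-1) * (\<Sum>\<^sub>\<infinity>k. w k s * ?g (n - 1 - k) s)"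
    by simp
  also have "\<dots> = (\<Sum>\<^sub>\<infinity>k. w k s * dfam f (n - 1 - k) s + (-1) * (w k s * ?g (n - 1 - k) s))"
    unfolding infsum_cmult_right'[symmetric]
    by (rule infsum_add[symmetric])
      (intro summable_on_cmult_right summable_conv assms r)+
  also have "\<dots> = (\<Sum>\<^sub>\<infinity>k. w k s * dfam f (n - 1 - k) s - w k s * ?g (n - 1 - k) s)" by simp
  finally have "of_real (exp (- s)) * (1/2) * (conv (dfam f) w (n - 1) s - conv ?g w (n - 1) s)
     = (\<Sum>\<^sub>\<infinity>k. of_real (exp (- s)) * (1/2) * (w k s * dfam f (n - 1 - k) s - w k s * ?g (n - 1 - k) s))"
    by (simp only: infsum_cmult_right')
  also have "\<dots> = conv w (Dbar f) n s"
    unfolding conv_def Dbar_def by (intro infsum_cong) (simp add: algebra_simps diff_divide_distrib)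
  finally show ?thesis by simp
qed

lemma partial_lin_synth:
  assumes "bounded_linear A" "smooth_fam f" "\<And>y. y \<in> exterior \<Longrightarrow> F y = A (synth f y)" "x \<in> exterior"
  shows "partial i F x = A (synth (Dv (cpx (axis i 1)) f) x)"
  unfolding partial_def by (rule frechet_lin_synth[OF assms])

lemma cpx_axis: "cpx (axis 1 1) = 1" "cpx (axis 2 1) = \<i>"
  by (simp_all add: complex_eq_iff axis_def)

text \<open>Everything is computed with complex fields. The velocity is \<open>U = 2 i Dbar \<psi>\<close>, so that
  \<open>Dz U = i w / 2\<close> by the stream function equation; its real part vanishes, which is
  incompressibility, and its imaginary part is half the vorticity. The Laplacian is
  \<open>4 Dbar Dz\<close>, hence \<open>\<Delta>U = 2 i Dbar w\<close>. The two equations for \<open>w'\<close> and \<open>H'\<close> together are the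
  single complex equation \<open>Dbar H = i Dbar w + w Dbar \<psi>\<close>, that is \<open>\<nabla>H = \<Delta>u + w \<nabla>\<psi>\<close>. Since
  \<open>u \<cdot> \<nabla>u = \<nabla>|u|^2 / 2 - w \<nabla>\<psi>\<close>, this is the momentum equation for \<open>p = H - |u|^2 / 2\<close>.\<close>

lemma steady_NS_of_mode_system:
  fixes \<psi> \<omega> H :: "modes"
  assumes sm: "smooth_fam \<psi>" "smooth_fam \<omega>" "smooth_fam H"
    and re: "real_fam \<psi>" "real_fam \<omega>" "real_fam H"
    and lap: "\<And>n s. 0 < s \<Longrightarrow> dfam (dfam \<psi>) n s - of_int n * (of_int n * \<psi> n s) = of_real (exp (2 * s)) * \<omega> n s"
    and dw: "\<And>n s. 0 < s \<Longrightarrow> dfam \<omega> n s = \<i> * (of_int n * H n s) - \<i> * conv (\<lambda>n s. of_int n * \<psi> n s) \<omega> n s"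
    and dH: "\<And>n s. 0 < s \<Longrightarrow> dfam H n s = conv (dfam \<psi>) \<omega> n s - \<i> * (of_int n * \<omega> n s)"
    and u: "\<And>x. x \<in> exterior \<Longrightarrow> u x = vec2 (synth (\<lambda>n s. 2 * \<i> * Dbar \<psi> n s) x)"
    and p: "\<And>x. x \<in> exterior \<Longrightarrow> p x = Re (synth H x) - (norm (u x))\<^sup>2 / 2"
  shows "smooth_on u exterior" "smooth_on p exterior"
    "x \<in> exterior \<Longrightarrow> divergence u x = 0"
    "x \<in> exterior \<Longrightarrow> laplacian u x - gradient p x = advection u u x"
proof -
  define \<upsilon> where "\<upsilon> = (\<lambda>n s. 2 * \<i> * Dbar \<psi> n s)"
  have s\<upsilon>: "smooth_fam \<upsilon>" unfolding \<upsilon>_def by (intro smooth_fam_const smooth_fam_Dbar sm)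
  have u': "u x = vec2 (synth \<upsilon> x)" if "x \<in> exterior" for x using u[OF that] unfolding \<upsilon>_def .
  show "smooth_on u exterior"
    by (rule smooth_on_lin_synth[OF bounded_linear_vec2 s\<upsilon> u'])
  \<comment> \<open>The modes of the conjugate velocity; they make \<open>|u|^2\<close> a synthesised field.\<close>
  define \<upsilon>c where "\<upsilon>c = (\<lambda>n s. - 2 * \<i> * Dz \<psi> n s)"
  have s\<upsilon>c: "smooth_fam \<upsilon>c" unfolding \<upsilon>c_def by (intro smooth_fam_const smooth_fam_Dz sm)
  have U: "synth \<upsilon> x = 2 * \<i> * synth (Dbar \<psi>) x" for x unfolding \<upsilon>_def by (rule synth_const)
  have Uc: "synth \<upsilon>c x = cnj (synth \<upsilon> x)" if "x \<in> exterior" for x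
    unfolding U unfolding \<upsilon>c_def synth_const
    using cnj_synth_Dbar[OF sm(1) re(1)] that by (simp add: exterior_iff)
  define \<pi> where "\<pi> = (\<lambda>n s. H n s + (-1/2) * conv \<upsilon> \<upsilon>c n s)"
  have s\<pi>: "smooth_fam \<pi>" unfolding \<pi>_def by (intro smooth_fam_add smooth_fam_const smooth_fam_conv sm s\<upsilon> s\<upsilon>c)
  have r: "rapid \<upsilon>" "rapid \<upsilon>c" "rapid H" "rapid \<omega>" "rapid (Dbar \<psi>)" "rapid (conv \<upsilon> \<upsilon>c)" "rapid (Dbar \<omega>)"
    by (intro smooth_fam_rapid sm s\<upsilon> s\<upsilon>c smooth_fam_Dbar smooth_fam_conv)+
  have p': "p x = Re (synth \<pi> x)" if "x \<in> exterior" for x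
  proof -
    have x: "1 < norm x" using that by (simp add: exterior_iff)
    have "synth \<pi> x = synth H x + (-1/2) * (synth \<upsilon> x * synth \<upsilon>c x)"
      unfolding \<pi>_def
      unfolding synth_add[OF r(3) smooth_fam_rapid[OF smooth_fam_const[OF smooth_fam_conv[OF s\<upsilon> s\<upsilon>c]]] x]
        synth_const synth_conv[OF r(1,2) x] ..
    also have "synth \<upsilon> x * synth \<upsilon>c x = of_real ((norm (synth \<upsilon> x))\<^sup>2)"
      unfolding Uc[OF that] by (rule complex_norm_square[symmetric])
    finally show ?thesis by (simp add: p[OF that] u'[OF that])
  qed
  show "smooth_on p exterior"
    by (rule smooth_on_lin_synth[OF bounded_linear_Re s\<pi> p'])
  show "divergence u x = 0" "laplacian u x - gradient p x = advection u u x" if xe: "x \<in> exterior"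
  proof -
    have x: "1 < norm x" using xe by (simp add: exterior_iff)
    define A where "A = synth (Dbar \<upsilon>) x"
    define W where "W = Re (synth \<omega> x)"
    have W: "synth \<omega> x = of_real W"
      using cnj_synth[of \<omega> \<omega> x] re(2) x unfolding real_fam_def W_def by (simp add: complex_eq_iff)
    have Dz\<upsilon>: "Dz \<upsilon> n s = \<i> / 2 * \<omega> n s" if s: "0 < s" for n s
    proof -
      have "Dz \<upsilon> n s = 2 * \<i> * Dz (Dbar \<psi>) n s"
        unfolding \<upsilon>_def by (rule Dz_const[OF smooth_fam_Dbar[OF sm(1)] s])
      also have "\<dots> = \<i> / 2 * (of_real (exp (- 2 * s)) * (of_real (exp (2 * s)) * \<omega> n s))"
        unfolding Dz_Dbar[OF sm(1) s] lap[OF s] by simp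
      also have "of_real (exp (- 2 * s)) * (of_real (exp (2 * s)) * \<omega> n s) = \<omega> n s"
        by (simp add: mult.assoc[symmetric] of_real_mult[symmetric] exp_add[symmetric] del: of_real_mult)
      finally show ?thesis .
    qed
    have B: "synth (Dz \<upsilon>) x = \<i> / 2 * of_real W"
      using synth_cong[OF x Dz\<upsilon>] by (simp only: synth_const W)
    have Dvs: "synth (Dv v f) x = cnj v * synth (Dbar f) x + v * synth (Dz f) x" if "smooth_fam f" for v f
    proof -
      have "synth (Dv v f) x = synth (\<lambda>n s. cnj v * Dbar f n s) x + synth (\<lambda>n s. v * Dz f n s) x"
        unfolding Dv_def[abs_def]
        by (intro synth_add smooth_fam_rapid smooth_fam_const smooth_fam_Dbar smooth_fam_Dz that x)
      then show ?thesis by (simp add: synth_const)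
    qed
    note pu = partial_lin_synth[OF bounded_linear_vec2 s\<upsilon> u' xe, unfolded Dvs[OF s\<upsilon>] B A_def[symmetric]]
    have p1: "partial 1 u x = vec2 (A + \<i> / 2 * of_real W)"
      using pu[of 1] by (simp add: cpx_axis)
    have p2: "partial 2 u x = vec2 (- \<i> * A - of_real W / 2)"
      using pu[of 2] by (simp add: cpx_axis)
    show "divergence u x = 0"
      by (simp add: divergence_def sum_2 p1 p2)
    define V where "V = synth \<upsilon> x"
    have adv: "advection u u x = Re V *\<^sub>R vec2 (A + \<i> / 2 * of_real W) + Im V *\<^sub>R vec2 (- \<i> * A - of_real W / 2)"
      by (simp add: advection_def sum_2 p1 p2 u'[OF xe] V_def)
    have pp: "partial i (partial i u) x = vec2 (synth (Dv (cpx (axis i 1)) (Dv (cpx (axis i 1)) \<upsilon>)) x)" for i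
      by (rule partial_lin_synth[OF bounded_linear_vec2 smooth_fam_Dv[OF s\<upsilon>] partial_lin_synth[OF bounded_linear_vec2 s\<upsilon> u'] xe])
    define E where "E = synth (Dbar \<omega>) x"
    have lapU: "laplacian u x = vec2 (2 * \<i> * E)"
    proof -
      have DD: "synth (Dv v (Dv v \<upsilon>)) x = (cnj v)\<^sup>2 * synth (Dbar (Dbar \<upsilon>)) x + 2 * (v * cnj v) * (\<i> / 2 * E)
          + v\<^sup>2 * synth (Dz (Dz \<upsilon>)) x" for v
      proof -
        have s1: "smooth_fam (Dbar \<upsilon>)" "smooth_fam (Dz \<upsilon>)" using s\<upsilon> smooth_fam_Dbar smooth_fam_Dz by auto
        have s2: "smooth_fam (\<lambda>n s. c * Dbar \<upsilon> n s)" "smooth_fam (\<lambda>n s. c * Dz \<upsilon> n s)" for c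
          using s1 by (auto intro: smooth_fam_const)
        have lin: "Dbar (\<lambda>n s. f n s + g n s) n s = Dbar f n s + Dbar g n s"
            "Dz (\<lambda>n s. f n s + g n s) n s = Dz f n s + Dz g n s"
          if "smooth_fam f" "smooth_fam g" "0 < s" for f g n s
        proof -
          have "dfam (\<lambda>n s. f n s + g n s) n s = dfam f n s + dfam g n s" for n
            by (rule fam_deriv_dfam[OF fam_deriv_add]) (use that smooth_fam_deriv in auto)
          then show "Dbar (\<lambda>n s. f n s + g n s) n s = Dbar f n s + Dbar g n s"
            "Dz (\<lambda>n s. f n s + g n s) n s = Dz f n s + Dz g n s"
            by (simp_all add: Dbar_def Dz_def algebra_simps add_divide_distrib)
        qed
        have bar: "Dbar (Dv v \<upsilon>) n s = cnj v * Dbar (Dbar \<upsilon>) n s + v * Dbar (Dz \<upsilon>) n s"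
          and z: "Dz (Dv v \<upsilon>) n s = cnj v * Dz (Dbar \<upsilon>) n s + v * Dz (Dz \<upsilon>) n s" if "0 < s" for n s
          unfolding Dv_def[abs_def] lin[OF s2 that] using s1 that by (simp_all add: Dbar_const Dz_const)
        have mixed: "Dz (Dbar \<upsilon>) n s = \<i> / 2 * Dbar \<omega> n s" "Dbar (Dz \<upsilon>) n s = \<i> / 2 * Dbar \<omega> n s" if "0 < s" for n s
        proof -
          show 1: "Dbar (Dz \<upsilon>) n s = \<i> / 2 * Dbar \<omega> n s"
            using Dbar_cong[of "Dz \<upsilon>" "\<lambda>n s. \<i> / 2 * \<omega> n s" s n] Dz\<upsilon> Dbar_const[OF sm(2) that, of "\<i> / 2" n] that by simp
          show "Dz (Dbar \<upsilon>) n s = \<i> / 2 * Dbar \<omega> n s"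
            using 1 Dz_Dbar[OF s\<upsilon> that, of n] by simp
        qed
        have eq: "Dv v (Dv v \<upsilon>) n s = (cnj v)\<^sup>2 * Dbar (Dbar \<upsilon>) n s + ((2 * (v * cnj v) * (\<i> / 2)) * Dbar \<omega> n s
            + v\<^sup>2 * Dz (Dz \<upsilon>) n s)" if "0 < s" for n s
          unfolding Dv_def[of v "Dv v \<upsilon>"] bar[OF that] z[OF that] mixed[OF that]
          by (simp add: algebra_simps power2_eq_square)
        have "synth (Dv v (Dv v \<upsilon>)) x = (cnj v)\<^sup>2 * synth (Dbar (Dbar \<upsilon>)) x + ((2 * (v * cnj v) * (\<i> / 2)) * synth (Dbar \<omega>) x
            + v\<^sup>2 * synth (Dz (Dz \<upsilon>)) x)"
        proof -
          have sf: "smooth_fam (\<lambda>n s. (cnj v)\<^sup>2 * Dbar (Dbar \<upsilon>) n s)" "smooth_fam (\<lambda>n s. (2 * (v * cnj v) * (\<i> / 2)) * Dbar \<omega> n s)"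
            "smooth_fam (\<lambda>n s. v\<^sup>2 * Dz (Dz \<upsilon>) n s)"
            by (intro smooth_fam_const smooth_fam_Dbar smooth_fam_Dz s\<upsilon> sm)+
          have "synth (Dv v (Dv v \<upsilon>)) x = synth (\<lambda>n s. (cnj v)\<^sup>2 * Dbar (Dbar \<upsilon>) n s
              + ((2 * (v * cnj v) * (\<i> / 2)) * Dbar \<omega> n s + v\<^sup>2 * Dz (Dz \<upsilon>) n s)) x"
            by (rule synth_cong[OF x eq])
          then show ?thesis
            unfolding synth_add[OF smooth_fam_rapid[OF sf(1)] smooth_fam_rapid[OF smooth_fam_add[OF sf(2,3)]] x]
              synth_add[OF smooth_fam_rapid[OF sf(2)] smooth_fam_rapid[OF sf(3)] x] synth_const .
        qed
        then show ?thesis by (simp add: E_def)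
      qed
      have "laplacian u x = vec2 (synth (Dv 1 (Dv 1 \<upsilon>)) x) + vec2 (synth (Dv \<i> (Dv \<i> \<upsilon>)) x)"
        by (simp add: laplacian_def sum_2 pp cpx_axis)
      also have "\<dots> = vec2 (2 * \<i> * E)"
        unfolding DD by (simp add: vec_eq_iff forall_2)
      finally show ?thesis .
    qed
    have DH: "synth (Dbar H) x = \<i> * E + of_real W * synth (Dbar \<psi>) x"
    proof -
      have "Dbar H n s = \<i> * Dbar \<omega> n s + conv \<omega> (Dbar \<psi>) n s" if "0 < s" for n s
        unfolding conv_Dbar[OF r(4) sm(1) that] Dbar_def dw[OF that] dH[OF that]
        by (simp add: algebra_simps add_divide_distrib diff_divide_distrib)
      then have "synth (Dbar H) x = synth (\<lambda>n s. \<i> * Dbar \<omega> n s + conv \<omega> (Dbar \<psi>) n s) x"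
        by (intro synth_cong[OF x])
      also have "\<dots> = synth (\<lambda>n s. \<i> * Dbar \<omega> n s) x + synth (conv \<omega> (Dbar \<psi>)) x"
        by (intro synth_add smooth_fam_rapid smooth_fam_const smooth_fam_Dbar smooth_fam_conv sm x)
      finally have "synth (Dbar H) x = synth (\<lambda>n s. \<i> * Dbar \<omega> n s) x + synth (conv \<omega> (Dbar \<psi>)) x" .
      then show ?thesis by (simp add: synth_const synth_conv[OF r(4,5) x] W E_def)
    qed
    have dv: "(synth f has_derivative (\<lambda>h. cnj (cpx h) * synth (Dbar f) x + cpx h * synth (Dz f) x)) (at x)" if "smooth_fam f" for f
      using has_derivative_synth[OF that x] unfolding Dvs[OF that] .
    have dp: "(p has_derivative (\<lambda>h. Re (cnj (cpx h) * synth (Dbar H) x + cpx h * synth (Dz H) x)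
        - Re (cnj V * (cnj (cpx h) * A + cpx h * (\<i> / 2 * of_real W))))) (at x)"
    proof -
      have a: "((\<lambda>y. Re (synth H y)) has_derivative (\<lambda>h. Re (cnj (cpx h) * synth (Dbar H) x + cpx h * synth (Dz H) x))) (at x)"
        by (rule bounded_linear.has_derivative[OF bounded_linear_Re dv[OF sm(3)]])
      have b1: "((\<lambda>y. Re (synth \<upsilon> y)) has_derivative (\<lambda>h. Re (cnj (cpx h) * synth (Dbar \<upsilon>) x + cpx h * synth (Dz \<upsilon>) x))) (at x)"
        by (rule bounded_linear.has_derivative[OF bounded_linear_Re dv[OF s\<upsilon>]])
      have b2: "((\<lambda>y. Im (synth \<upsilon> y)) has_derivative (\<lambda>h. Im (cnj (cpx h) * synth (Dbar \<upsilon>) x + cpx h * synth (Dz \<upsilon>) x))) (at x)"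
        by (rule bounded_linear.has_derivative[OF bounded_linear_Im dv[OF s\<upsilon>]])
      have "((\<lambda>y. Re (synth H y) - (Re (synth \<upsilon> y) * Re (synth \<upsilon> y) + Im (synth \<upsilon> y) * Im (synth \<upsilon> y)) * (1/2)) has_derivative
         (\<lambda>h. Re (cnj (cpx h) * synth (Dbar H) x + cpx h * synth (Dz H) x)
        - Re (cnj V * (cnj (cpx h) * A + cpx h * (\<i> / 2 * of_real W))))) (at x)"
        by (rule has_derivative_eq_rhs[OF has_derivative_diff[OF a
            has_derivative_mult_left[OF has_derivative_add[OF has_derivative_mult[OF b1 b1] has_derivative_mult[OF b2 b2]]]]])
          (simp add: fun_eq_iff A_def V_def B algebra_simps add_divide_distrib diff_divide_distrib)
      then show ?thesis
        by (rule has_derivative_transform_within_open[OF _ open_exterior xe])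
          (simp only: p u' norm_vec2 cmod_power2, simp add: power2_eq_square)
    qed
    have DzH: "synth (Dz H) x = cnj (synth (Dbar H) x)"
      using cnj_synth_Dbar[OF sm(3) re(3) x] by simp
    have pp: "partial i p x = Re (cnj (cpx (axis i 1)) * synth (Dbar H) x + cpx (axis i 1) * synth (Dz H) x)
        - Re (cnj V * (cnj (cpx (axis i 1)) * A + cpx (axis i 1) * (\<i> / 2 * of_real W)))" for i
      unfolding partial_def frechet_derivative_at[OF dp, symmetric] by (rule refl)
    have VV: "synth (Dbar \<psi>) x = - \<i> / 2 * V" unfolding V_def U by simp
    have g1: "gradient p x $ 1 = 2 * Re (synth (Dbar H) x) - Re (cnj V * (A + \<i> / 2 * of_real W))"
      and g2: "gradient p x $ 2 = 2 * Im (synth (Dbar H) x) - Re (cnj V * (- \<i> * A - of_real W / 2))"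
      by (simp_all add: gradient_def pp cpx_axis DzH axis_def)
    show "laplacian u x - gradient p x = advection u u x"
      unfolding vec_eq_iff forall_2 lapU adv vector_minus_component g1 g2 DH VV
      by (simp add: algebra_simps)
  qed
qed

section \<open>First-order linear equations on the half-line\<close>

definition exp_decay :: "real \<Rightarrow> real \<Rightarrow> (real \<Rightarrow> complex) \<Rightarrow> bool" where
  "exp_decay \<alpha> C f \<longleftrightarrow> continuous_on {0..} f \<and> (\<forall>t\<ge>0. norm (f t) \<le> C * exp (- (\<alpha> * t)))"

lemma exp_decayD: "exp_decay \<alpha> C f \<Longrightarrow> 0 \<le> t \<Longrightarrow> norm (f t) \<le> C * exp (- (\<alpha> * t))"
  and exp_decay_cont: "exp_decay \<alpha> C f \<Longrightarrow> continuous_on {0..} f"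
  by (simp_all add: exp_decay_def)

lemma exp_decay_nonneg: "exp_decay \<alpha> C f \<Longrightarrow> 0 \<le> C"
  using order_trans[OF norm_ge_zero exp_decayD[of \<alpha> C f 0]] by simp

lemma exp_decay_mono:
  assumes "exp_decay \<alpha> C f" "\<beta> \<le> \<alpha>" "C \<le> D"
  shows "exp_decay \<beta> D f"
  unfolding exp_decay_def
proof (intro conjI allI impI)
  fix t :: real assume t: "0 \<le> t"
  have "norm (f t) \<le> C * exp (- (\<alpha> * t))" using assms(1) t by (rule exp_decayD)
  also have "\<dots> \<le> D * exp (- (\<beta> * t))"
    using exp_decay_nonneg[OF assms(1)] assms t by (intro mult_mono) (auto simp: mult_right_mono)
  finally show "norm (f t) \<le> D * exp (- (\<beta> * t))" .
qed (rule exp_decay_cont[OF assms(1)])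

lemma exp_decay_add:
  assumes "exp_decay \<alpha> C f" "exp_decay \<alpha> D g"
  shows "exp_decay \<alpha> (C + D) (\<lambda>t. f t + g t)"
  unfolding exp_decay_def
proof (intro conjI allI impI)
  fix t :: real assume t: "0 \<le> t"
  show "norm (f t + g t) \<le> (C + D) * exp (- (\<alpha> * t))"
    unfolding distrib_right using exp_decayD[OF assms(1) t] exp_decayD[OF assms(2) t] norm_triangle_mono by blast
qed (intro continuous_on_add exp_decay_cont[OF assms(1)] exp_decay_cont[OF assms(2)])

lemma exp_decay_cmult:
  assumes "exp_decay \<alpha> C f"
  shows "exp_decay \<alpha> (norm k * C) (\<lambda>t. k * f t)"
  unfolding exp_decay_def
proof (intro conjI allI impI)
  fix t :: real assume t: "0 \<le> t"
  show "norm (k * f t) \<le> (norm k * C) * exp (- (\<alpha> * t))"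
    unfolding norm_mult mult.assoc by (intro mult_left_mono exp_decayD[OF assms t]) auto
qed (intro continuous_intros exp_decay_cont[OF assms(1)])

lemma exp_decay_diff:
  assumes "exp_decay \<alpha> C f" "exp_decay \<alpha> D g"
  shows "exp_decay \<alpha> (C + D) (\<lambda>t. f t - g t)"
  using exp_decay_add[OF assms(1) exp_decay_cmult[OF assms(2), of "-1"]] by simp

lemma exp_decay_exp:
  assumes "exp_decay \<alpha> C f"
  shows "exp_decay (\<alpha> + Re z) C (\<lambda>t. exp (- (z * of_real t)) * f t)"
  unfolding exp_decay_def
proof (intro conjI allI impI)
  fix t :: real assume t: "0 \<le> t"
  have "norm (exp (- (z * of_real t)) * f t) = exp (- (Re z * t)) * norm (f t)"
    by (simp add: norm_mult)
  also have "\<dots> \<le> exp (- (Re z * t)) * (C * exp (- (\<alpha> * t)))"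
    by (intro mult_left_mono exp_decayD[OF assms t]) auto
  also have "\<dots> = C * exp (- ((\<alpha> + Re z) * t))"
    by (simp add: distrib_right exp_add[symmetric] mult.left_commute[of _ C])
  finally show "norm (exp (- (z * of_real t)) * f t) \<le> C * exp (- ((\<alpha> + Re z) * t))" .
qed (intro continuous_intros exp_decay_cont[OF assms(1)])

lemma exp_decay_exponential: "Re z \<ge> \<alpha> \<Longrightarrow> exp_decay \<alpha> (norm k) (\<lambda>t. k * exp (- (z * of_real t)))"
  unfolding exp_decay_def
  by (auto intro!: continuous_intros mult_left_mono mult_right_mono simp: norm_mult)

lemma tail_integral:
  assumes f: "exp_decay \<alpha> C f" and a: "0 < \<alpha>" and s: "0 \<le> s"
  shows "f integrable_on {s..}" "norm (integral {s..} f) \<le> C * exp (- (\<alpha> * s)) / \<alpha>"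
proof -
  have g: "((\<lambda>t. C * exp (- \<alpha> * t)) has_integral C * (exp (- \<alpha> * s) / \<alpha>)) {s..}"
    by (rule has_integral_mult_right[OF has_integral_exp_minus_to_infinity[OF a]])
  have b: "norm (f t) \<le> C * exp (- \<alpha> * t)" if "t \<in> {s..}" for t
    using exp_decayD[OF f, of t] that s by simp
  have m: "f \<in> borel_measurable (lebesgue_on {s..})"
    by (rule continuous_imp_measurable_on_sets_lebesgue)
      (use exp_decay_cont[OF f] s in \<open>auto intro: continuous_on_subset\<close>)
  show i: "f integrable_on {s..}"
    by (rule measurable_bounded_by_integrable_imp_integrable[OF m has_integral_integrable[OF g]]) (use b in auto)
  have "norm (integral {s..} f) \<le> integral {s..} (\<lambda>t. C * exp (- \<alpha> * t))"
    by (rule Henstock_Kurzweil_Integration.integral_norm_bound_integral[OF i has_integral_integrable[OF g] b])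
  also have "\<dots> = C * exp (- (\<alpha> * s)) / \<alpha>" using integral_unique[OF g] by simp
  finally show "norm (integral {s..} f) \<le> C * exp (- (\<alpha> * s)) / \<alpha>" .
qed

lemma tail_split:
  assumes f: "exp_decay \<alpha> C f" and a: "0 < \<alpha>" and s: "0 \<le> s"
  shows "integral {s..} f = integral {0..} f - integral {0..s} f"
proof -
  have i: "f integrable_on {0..s}"
    by (rule integrable_continuous_interval) (use exp_decay_cont[OF f] in \<open>auto intro: continuous_on_subset\<close>)
  have "(f has_integral (integral {0..s} f + integral {s..} f)) ({0..s} \<union> {s..})"
  proof (rule has_integral_Un)
    show "negligible ({0..s} \<inter> {s..})"
      by (rule negligible_subset[of "{s}"]) auto
  qed (use i tail_integral(1)[OF f a s] in \<open>auto simp: integrable_integral\<close>)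
  moreover have "{0..s} \<union> {s..} = {0..}" using s by auto
  ultimately show ?thesis by (simp add: integral_unique)
qed

text \<open>One-sided at \<open>0\<close>, since the circle is part of the domain of the integral equations.\<close>

lemma integral_0_has_vector_derivative:
  fixes f :: "real \<Rightarrow> complex"
  assumes f: "continuous_on {0..} f" and s: "0 \<le> s"
  shows "((\<lambda>s. integral {0..s} f) has_vector_derivative f s) (at s within {0..})"
proof -
  have "((\<lambda>s. integral {0..s} f) has_vector_derivative f s) (at s within {0..s + 1})"
    by (rule integral_has_vector_derivative) (use f s in \<open>auto intro: continuous_on_subset\<close>)
  moreover have "at s within {0..s + 1} = at s within {0..}"
    by (rule at_within_nhd[of _ "{..<s+1}"]) auto
  ultimately show ?thesis by simp
qed

text \<open>The solution of \<open>F' = z F - f\<close> that is obtained by integrating from infinity, hence the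
  one that does not grow like \<open>e^(z s)\<close>.\<close>

definition backward :: "complex \<Rightarrow> (real \<Rightarrow> complex) \<Rightarrow> real \<Rightarrow> complex" where
  "backward z f s = exp (z * of_real s) * integral {s..} (\<lambda>t. exp (- (z * of_real t)) * f t)"

text \<open>The solution of \<open>F' = f - z F\<close> with \<open>F 0 = 0\<close>.\<close>

definition forward :: "complex \<Rightarrow> (real \<Rightarrow> complex) \<Rightarrow> real \<Rightarrow> complex" where
  "forward z f s = exp (- (z * of_real s)) * integral {0..s} (\<lambda>t. exp (z * of_real t) * f t)"

lemma exp_has_vector_derivative_within:
  fixes z :: complex
  shows "((\<lambda>s. exp (z * of_real s)) has_vector_derivative z * exp (z * of_real s)) (at s within S)"
  by (rule has_vector_derivative_real_field[where f="\<lambda>w. exp (z * w)"]) (auto intro!: derivative_eq_intros)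

lemma has_vector_derivative_backward:
  assumes f: "exp_decay \<alpha> C f" and a: "0 < \<alpha> + Re z" and s: "0 \<le> s"
  shows "(backward z f has_vector_derivative z * backward z f s - f s) (at s within {0..})"
proof -
  let ?h = "\<lambda>t. exp (- (z * of_real t)) * f t"
  have h: "exp_decay (\<alpha> + Re z) C ?h" by (rule exp_decay_exp[OF f])
  have "((\<lambda>s. integral {0..} ?h - integral {0..s} ?h) has_vector_derivative - ?h s) (at s within {0..})"
    using has_vector_derivative_diff[OF has_vector_derivative_const integral_0_has_vector_derivative[OF exp_decay_cont[OF h] s]]
    by simp
  then have i: "((\<lambda>s. integral {s..} ?h) has_vector_derivative - ?h s) (at s within {0..})"
    by (rule has_vector_derivative_transform[rotated 2])
      (use s in \<open>auto simp only: atLeast_iff intro: tail_split[OF h a]\<close>)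
  have e: "exp (z * of_real s) * exp (- (z * of_real s)) = 1" by (simp flip: exp_add)
  have "(backward z f has_vector_derivative (exp (z * of_real s) * (- ?h s) + z * exp (z * of_real s) * integral {s..} ?h)) (at s within {0..})"
    unfolding backward_def[abs_def] by (rule has_vector_derivative_mult[OF exp_has_vector_derivative_within i])
  also have "exp (z * of_real s) * (- ?h s) + z * exp (z * of_real s) * integral {s..} ?h = z * backward z f s - f s"
    using e by (simp add: backward_def mult.assoc[symmetric])
  finally show ?thesis .
qed

lemma has_vector_derivative_forward:
  assumes f: "continuous_on {0..} f" and s: "0 \<le> s"
  shows "(forward z f has_vector_derivative f s - z * forward z f s) (at s within {0..})"
proof -
  let ?h = "\<lambda>t. exp (z * of_real t) * f t"
  have h: "continuous_on {0..} ?h" by (intro continuous_intros f)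
  have e: "exp (- (z * of_real s)) * exp (z * of_real s) = 1" by (simp flip: exp_add)
  have ed: "((\<lambda>s. exp (- (z * of_real s))) has_vector_derivative (- z) * exp (- (z * of_real s))) (at s within {0..})"
    using exp_has_vector_derivative_within[of "- z"] by simp
  have "(forward z f has_vector_derivative (exp (- (z * of_real s)) * ?h s + (- z) * exp (- (z * of_real s)) * integral {0..s} ?h)) (at s within {0..})"
    unfolding forward_def[abs_def]
    by (rule has_vector_derivative_mult[OF ed integral_0_has_vector_derivative[OF h s]])
  also have "exp (- (z * of_real s)) * ?h s + (- z) * exp (- (z * of_real s)) * integral {0..s} ?h = f s - z * forward z f s"
    using e by (simp add: forward_def mult.assoc[symmetric])
  finally show ?thesis .
qed

text \<open>Integration from infinity keeps the decay rate of the source. The same holds for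
  \<open>forward\<close> as long as the rate stays below \<open>Re z\<close>, the rate of the homogeneous solution; the
  constant then degenerates with the gap between the two rates.\<close>

lemma exp_decay_backward:
  assumes f: "exp_decay \<alpha> C f" and a: "0 < \<alpha> + Re z"
  shows "exp_decay \<alpha> (C / (\<alpha> + Re z)) (backward z f)"
  unfolding exp_decay_def
proof (intro conjI allI impI)
  show "continuous_on {0..} (backward z f)"
    by (rule continuous_on_vector_derivative) (use has_vector_derivative_backward[OF f a] in auto)
  fix s :: real assume s: "0 \<le> s"
  let ?h = "\<lambda>t. exp (- (z * of_real t)) * f t"
  have "norm (backward z f s) = exp (Re z * s) * norm (integral {s..} ?h)"
    by (simp add: backward_def norm_mult)
  also have "\<dots> \<le> exp (Re z * s) * (C * exp (- ((\<alpha> + Re z) * s)) / (\<alpha> + Re z))"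
    by (intro mult_left_mono tail_integral(2)[OF exp_decay_exp[OF f] a s]) auto
  also have "\<dots> = C / (\<alpha> + Re z) * (exp (Re z * s) * exp (- ((\<alpha> + Re z) * s)))" by simp
  also have "exp (Re z * s) * exp (- ((\<alpha> + Re z) * s)) = exp (- (\<alpha> * s))"
    by (simp add: exp_add[symmetric] algebra_simps)
  finally show "norm (backward z f s) \<le> C / (\<alpha> + Re z) * exp (- (\<alpha> * s))" .
qed

lemma exp_decay_forward:
  assumes f: "exp_decay \<alpha> C f" and a: "\<alpha> < Re z"
  shows "exp_decay \<alpha> (C / (Re z - \<alpha>)) (forward z f)"
  unfolding exp_decay_def
proof (intro conjI allI impI)
  show "continuous_on {0..} (forward z f)"
    by (rule continuous_on_vector_derivative) (use has_vector_derivative_forward[OF exp_decay_cont[OF f]] in auto)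
  fix s :: real assume s: "0 \<le> s"
  let ?h = "\<lambda>t. exp (z * of_real t) * f t"
  let ?b = "Re z - \<alpha>"
  have C: "0 \<le> C" using exp_decay_nonneg[OF f] .
  have g: "((\<lambda>t. C * exp (?b * t)) has_integral (C / ?b * exp (?b * s) - C / ?b * exp (?b * 0))) {0..s}"
  proof (rule fundamental_theorem_of_calculus[OF s])
    fix t assume "t \<in> {0..s}"
    show "((\<lambda>t. C / ?b * exp (?b * t)) has_vector_derivative C * exp (?b * t)) (at t within {0..s})"
      unfolding has_real_derivative_iff_has_vector_derivative[symmetric]
      using a by (auto intro!: derivative_eq_intros)
  qed
  have c: "continuous_on {0..} ?h" by (intro continuous_intros exp_decay_cont[OF f])
  have b: "norm (?h t) \<le> C * exp (?b * t)" if "t \<in> {0..s}" for t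
  proof -
    have "norm (?h t) = exp (Re z * t) * norm (f t)" by (simp add: norm_mult)
    also have "\<dots> \<le> exp (Re z * t) * (C * exp (- (\<alpha> * t)))"
      using that by (intro mult_left_mono exp_decayD[OF f]) auto
    also have "\<dots> = C * exp (?b * t)" by (simp add: exp_diff exp_minus field_simps left_diff_distrib)
    finally show ?thesis .
  qed
  have "norm (integral {0..s} ?h) \<le> integral {0..s} (\<lambda>t. C * exp (?b * t))"
    by (rule Henstock_Kurzweil_Integration.integral_norm_bound_integral[OF _ has_integral_integrable[OF g] b])
      (auto intro!: integrable_continuous_interval continuous_on_subset[OF c])
  also have "\<dots> = C / ?b * exp (?b * s) - C / ?b" using integral_unique[OF g] by simp
  also have "\<dots> \<le> C / ?b * exp (?b * s)" using C a by simp
  finally have i: "norm (integral {0..s} ?h) \<le> C / ?b * exp (?b * s)" .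
  have "norm (forward z f s) = exp (- (Re z * s)) * norm (integral {0..s} ?h)"
    by (simp add: forward_def norm_mult)
  also have "\<dots> \<le> exp (- (Re z * s)) * (C / ?b * exp (?b * s))"
    by (intro mult_left_mono i) auto
  also have "\<dots> = C / ?b * (exp (- (Re z * s)) * exp (?b * s))" by simp
  also have "exp (- (Re z * s)) * exp (?b * s) = exp (- (\<alpha> * s))"
    by (simp add: exp_add[symmetric] algebra_simps)
  finally show "norm (forward z f s) \<le> C / ?b * exp (- (\<alpha> * s))" .
qed

lemma backward_diff:
  assumes f: "exp_decay \<alpha> C f" and g: "exp_decay \<alpha> D g" and a: "0 < \<alpha> + Re z" and s: "0 \<le> s"
  shows "backward z (\<lambda>t. f t - g t) s = backward z f s - backward z g s"
proof -
  have "integral {s..} (\<lambda>t. exp (- (z * of_real t)) * f t - exp (- (z * of_real t)) * g t)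
      = integral {s..} (\<lambda>t. exp (- (z * of_real t)) * f t) - integral {s..} (\<lambda>t. exp (- (z * of_real t)) * g t)"
    by (rule Henstock_Kurzweil_Integration.integral_diff
        [OF tail_integral(1)[OF exp_decay_exp[OF f] a s] tail_integral(1)[OF exp_decay_exp[OF g] a s]])
  then show ?thesis by (simp add: backward_def right_diff_distrib)
qed

lemma forward_diff:
  assumes f: "continuous_on {0..} f" and g: "continuous_on {0..} g"
  shows "forward z (\<lambda>t. f t - g t) s = forward z f s - forward z g s"
proof -
  have "(\<lambda>t. exp (z * of_real t) * h t) integrable_on {0..s}" if "continuous_on {0..} h" for h
    by (rule integrable_continuous_interval)
      (auto intro!: continuous_intros continuous_on_subset[OF that])
  from Henstock_Kurzweil_Integration.integral_diff[OF this[OF f] this[OF g]]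
  show ?thesis by (simp add: forward_def right_diff_distrib)
qed

lemma backward_cong: "(\<And>t. 0 \<le> t \<Longrightarrow> f t = g t) \<Longrightarrow> 0 \<le> s \<Longrightarrow> backward z f s = backward z g s"
  unfolding backward_def by (intro arg_cong2[where f="(*)"] refl integral_cong) auto

lemma forward_cong: "(\<And>t. 0 \<le> t \<Longrightarrow> f t = g t) \<Longrightarrow> forward z f s = forward z g s"
  unfolding forward_def by (intro arg_cong2[where f="(*)"] refl integral_cong) auto

lemma hk_integral_cnj: "integral S (\<lambda>t. cnj (f t)) = cnj (integral S f)"
proof (cases "f integrable_on S")
  case True
  then show ?thesis using integral_linear[OF True bounded_linear_cnj] by (simp add: o_def)
next
  case False
  then have "\<not> (\<lambda>t. cnj (f t)) integrable_on S"
    using integrable_linear[OF _ bounded_linear_cnj, of "\<lambda>t. cnj (f t)" S] by (auto simp: o_def)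
  with False show ?thesis by (simp add: not_integrable_integral)
qed

lemma backward_cnj: "backward (cnj z) (\<lambda>t. cnj (f t)) s = cnj (backward z f s)"
  unfolding backward_def by (simp add: exp_cnj flip: hk_integral_cnj)

lemma forward_cnj: "forward (cnj z) (\<lambda>t. cnj (f t)) s = cnj (forward z f s)"
  unfolding forward_def by (simp add: exp_cnj flip: hk_integral_cnj)

lemma at_of_within_0:
  assumes "(f has_vector_derivative d) (at s within {0..})" "0 < (s::real)"
  shows "(f has_vector_derivative d) (at s)"
proof -
  have "at s within {0..} = at s" by (rule at_within_interior) (use assms in simp)
  then show ?thesis using assms(1) by (simp only:)
qed

lemma integral_cexp:
  assumes p: "0 < Re p"
  shows "integral {0..} (\<lambda>t. exp (- (p * of_real t))) = 1 / p"
proof -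
  let ?h = "\<lambda>t. exp (- (p * of_real t))"
  have h: "exp_decay (Re p) 1 ?h" using exp_decay_exponential[of "Re p" p 1] by simp
  have p0: "p \<noteq> 0" using p by auto
  have fin: "integral {0..s} ?h = 1 / p - exp (- (p * of_real s)) / p" if "0 \<le> s" for s
  proof -
    have "(?h has_integral (- exp (- (p * of_real s)) / p) - (- exp (- (p * of_real 0)) / p)) {0..s}"
    proof (rule fundamental_theorem_of_calculus[OF that])
      fix t assume "t \<in> {0..s}"
      show "((\<lambda>t. - exp (- (p * of_real t)) / p) has_vector_derivative ?h t) (at t within {0..s})"
        using has_vector_derivative_mult_right[OF exp_has_vector_derivative_within[of "- p" t "{0..s}"], of "- 1 / p"] p0
        by simp
    qed
    then show ?thesis by (simp add: integral_unique)
  qed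
  have "norm (integral {0..} ?h - 1 / p) \<le> exp (- (Re p * s)) / Re p + exp (- (Re p * s)) / norm p" if s: "0 \<le> s" for s
  proof -
    have "integral {0..} ?h - 1 / p = integral {s..} ?h + - (exp (- (p * of_real s)) / p)"
      using tail_split[OF h p s] fin[OF s] by simp
    then show ?thesis using tail_integral(2)[OF h p s]
      by (simp only: , intro norm_triangle_le add_mono) (simp_all add: norm_divide)
  qed
  note le = this
  have "((\<lambda>s. exp (- (Re p * s)) / Re p + exp (- (Re p * s)) / norm p) \<longlongrightarrow> 0 / Re p + 0 / norm p) at_top"
  proof (intro tendsto_intros)
    show "((\<lambda>s. exp (- (Re p * s))) \<longlongrightarrow> 0) at_top" using p
      by (auto intro!: filterlim_compose[OF exp_at_bot] filterlim_tendsto_pos_mult_at_top[OF tendsto_const _ filterlim_ident] simp: filterlim_uminus_at_bot)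
    then show "((\<lambda>s. exp (- (Re p * s))) \<longlongrightarrow> 0) at_top" .
  qed (use p p0 in auto)
  then have "norm (integral {0..} ?h - 1 / p) \<le> 0 / Re p + 0 / norm p"
    by (rule tendsto_lowerbound) (use le in \<open>auto intro!: eventually_at_top_linorderI[of 0]\<close>)
  then show ?thesis by simp
qed

section \<open>Characteristic exponents of the linearised vorticity equation\<close>

text \<open>The linearised vorticity equation in the mode \<open>n\<close> has the solutions \<open>e^(\<zeta> s)\<close> and
  \<open>e^(- \<zeta> s)\<close> for this \<open>\<zeta>\<close>, the square root with nonnegative real part.\<close>

definition zeta :: "real \<Rightarrow> int \<Rightarrow> complex" where
  "zeta mu n = csqrt (Complex ((of_int n)\<^sup>2) (mu * of_int n))"

lemma zeta_sq: "zeta mu n * zeta mu n = of_int n * of_int n + \<i> * of_real mu * of_int n"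
  using power2_csqrt[of "Complex ((of_int n)\<^sup>2) (mu * of_int n)"]
  by (simp add: zeta_def power2_eq_square complex_eq_iff)

lemma norm_zeta_ge: "\<bar>of_int n\<bar> \<le> norm (zeta mu n)"
proof -
  have "(of_int n)\<^sup>2 \<le> norm (Complex ((of_int n)\<^sup>2) (mu * of_int n))"
    using complex_Re_le_cmod[of "Complex ((of_int n)\<^sup>2) (mu * of_int n)"] by simp
  then show ?thesis
    unfolding zeta_def norm_csqrt by (metis real_sqrt_abs real_sqrt_le_iff)
qed

lemma norm_zeta_le: "norm (zeta mu n) \<le> (1 + \<bar>mu\<bar>) * \<bar>of_int n\<bar>"
proof -
  have n2: "\<bar>real_of_int n\<bar> \<le> (real_of_int n)\<^sup>2"
  proof (cases "n = 0")
    case False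
    then have "1 \<le> \<bar>real_of_int n\<bar>" by linarith
    from mult_left_mono[OF this, of "\<bar>real_of_int n\<bar>"] show ?thesis by (simp add: power2_eq_square)
  qed simp
  have "norm (Complex ((of_int n)\<^sup>2) (mu * of_int n)) \<le> (of_int n)\<^sup>2 + \<bar>mu\<bar> * \<bar>of_int n\<bar>"
    using cmod_le[of "Complex ((of_int n)\<^sup>2) (mu * of_int n)"] by (simp add: abs_mult)
  also have "\<dots> \<le> (of_int n)\<^sup>2 + \<bar>mu\<bar> * (of_int n)\<^sup>2"
    by (intro add_left_mono mult_left_mono n2) auto
  also have "\<dots> = (1 + \<bar>mu\<bar>) * (of_int n)\<^sup>2" by (simp add: distrib_right)
  also have "\<dots> \<le> ((1 + \<bar>mu\<bar>) * (1 + \<bar>mu\<bar>)) * (of_int n)\<^sup>2"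
    by (intro mult_right_mono) (simp_all add: algebra_simps)
  also have "\<dots> = ((1 + \<bar>mu\<bar>) * \<bar>of_int n\<bar>)\<^sup>2" by (simp add: power2_eq_square)
  finally have "sqrt (norm (Complex ((of_int n)\<^sup>2) (mu * of_int n))) \<le> sqrt (((1 + \<bar>mu\<bar>) * \<bar>of_int n\<bar>)\<^sup>2)"
    by (rule real_sqrt_le_mono)
  then show ?thesis unfolding zeta_def norm_csqrt by (simp add: abs_mult)
qed

lemma zeta_minus: assumes "n \<noteq> 0" "mu \<noteq> 0" shows "zeta mu (- n) = cnj (zeta mu n)"
  unfolding zeta_def[of mu "- n"]
proof (rule csqrt_unique)
  show "(cnj (zeta mu n))\<^sup>2 = Complex ((of_int (- n))\<^sup>2) (mu * of_int (- n))"
    using arg_cong[OF zeta_sq[of mu n], of cnj] by (simp add: power2_eq_square complex_eq_iff)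
  have "0 < (real_of_int n)\<^sup>2" using assms by simp
  then have "0 < Re (zeta mu n)"
    unfolding zeta_def csqrt.simps by (simp add: add_nonneg_pos)
  then show "0 < Re (cnj (zeta mu n)) \<or> Re (cnj (zeta mu n)) = 0 \<and> 0 \<le> Im (cnj (zeta mu n))" by simp
qed

text \<open>The real part of the principal root of \<open>w\<close> is \<open>sqrt ((|w| + Re w) / 2)\<close>. For \<open>n \<noteq> 0\<close>
  this is smallest at \<open>|n| = 1\<close>, which gives the second bound, and the trivial estimate
  \<open>|w| \<ge> Re w\<close> gives the first.\<close>

lemma Re_zeta_lower:
  assumes n: "n \<noteq> 0"
  shows "\<bar>of_int n\<bar> \<le> Re (zeta mu n)" "sqrt ((sqrt (1 + mu\<^sup>2) + 1) / 2) \<le> Re (zeta mu n)"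
proof -
  let ?w = "Complex ((of_int n)\<^sup>2) (mu * of_int n)"
  have n1: "1 \<le> (real_of_int n)\<^sup>2"
  proof -
    have "1 \<le> \<bar>real_of_int n\<bar>" using n by linarith
    then show ?thesis by (simp add: abs_le_square_iff[symmetric, of 1, simplified])
  qed
  have "(of_int n)\<^sup>2 \<le> norm ?w" using complex_Re_le_cmod[of ?w] by simp
  then have "sqrt ((of_int n)\<^sup>2) \<le> Re (zeta mu n)"
    unfolding zeta_def csqrt.simps by (intro real_sqrt_le_mono) simp
  then show "\<bar>of_int n\<bar> \<le> Re (zeta mu n)" by simp
  have "1 + mu\<^sup>2 \<le> ((of_int n)\<^sup>2)\<^sup>2 + (mu * of_int n)\<^sup>2"
  proof (rule add_mono)
    show "1 \<le> ((real_of_int n)\<^sup>2)\<^sup>2" using one_le_power[OF n1, of 2] .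
    show "mu\<^sup>2 \<le> (mu * of_int n)\<^sup>2" using mult_left_mono[OF n1, of "mu\<^sup>2"] by (simp add: power_mult_distrib)
  qed
  then have "sqrt (1 + mu\<^sup>2) \<le> norm ?w" by (simp add: cmod_def)
  then show "sqrt ((sqrt (1 + mu\<^sup>2) + 1) / 2) \<le> Re (zeta mu n)"
    unfolding zeta_def csqrt.simps using n1 by (intro real_sqrt_le_mono) simp
qed

text \<open>This is what the lower bound on the swirl is for. By \<open>Re_zeta_lower\<close> the real parts
  exceed some \<open>r > 2\<close>, and they also exceed \<open>|n|\<close>; a convex combination of the two bounds
  leaves a rate \<open>a > 2\<close> and a positive multiple of \<open>|n|\<close>. The factor \<open>2\<close> in front of \<open>c\<close>
  leaves the gap \<open>c |n|\<close> between the norm and the homogeneous solutions, and \<open>a - 2 + c \<le> 1/2\<close>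
  keeps the rates of the stream function below its own exponents \<open>|n|\<close>.\<close>

lemma decay_rates_exist:
  assumes "sqrt 48 < mu"
  shows "\<exists>a c. 2 < a \<and> 0 < c \<and> a - 2 + c \<le> 1/2 \<and> (\<forall>n. n \<noteq> 0 \<longrightarrow> a + 2 * c * \<bar>of_int n\<bar> \<le> Re (zeta mu n))"
proof -
  have "(sqrt 48)\<^sup>2 < mu\<^sup>2" using assms by (intro power_strict_mono) auto
  then have "sqrt (7\<^sup>2) < sqrt (1 + mu\<^sup>2)" by (intro real_sqrt_less_mono) simp
  then have "sqrt (2\<^sup>2) < sqrt ((sqrt (1 + mu\<^sup>2) + 1) / 2)" by (intro real_sqrt_less_mono) simp
  then have rho: "2 < sqrt ((sqrt (1 + mu\<^sup>2) + 1) / 2)" by simp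
  \<comment> \<open>The cap 9/4 serves \<open>a - 2 + c \<le> 1/2\<close>; \<open>a = (r + 2) / 2\<close> lies halfway between 2 and \<open>r\<close>, and
    \<open>t\<close> is the weight for which \<open>(1 - t) r = a\<close>.\<close>
  define r where "r = min (sqrt ((sqrt (1 + mu\<^sup>2) + 1) / 2)) (9/4)"
  have r: "2 < r" "r \<le> 9/4" using rho by (auto simp: r_def)
  define t where "t = (r - 2) / (2 * r)"
  have t: "0 < t" "t \<le> 1/4" "(1 - t) * r = (r + 2) / 2" using r by (auto simp: t_def field_simps)
  show ?thesis
  proof (rule exI[of _ "(r + 2) / 2"], rule exI[of _ "t / 2"], intro conjI allI impI)
    fix n :: int assume n: "n \<noteq> 0"
    have "(1 - t) * r + t * \<bar>of_int n\<bar> \<le> (1 - t) * Re (zeta mu n) + t * Re (zeta mu n)"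
      using t Re_zeta_lower[OF n, of mu] by (intro add_mono mult_left_mono) (auto simp: r_def)
    then show "(r + 2) / 2 + 2 * (t / 2) * \<bar>of_int n\<bar> \<le> Re (zeta mu n)"
      unfolding t(3) by (simp add: algebra_simps)
  next
    show "(r + 2) / 2 - 2 + t / 2 \<le> 1/2" using r(2) t(2) by (simp add: field_simps)
  qed (use r t in auto)
qed

lemma exp_decay_exp2: "exp_decay \<alpha> C f \<Longrightarrow> exp_decay (\<alpha> - 2) C (\<lambda>t. of_real (exp (2 * t)) * f t)"
  using exp_decay_exp[of \<alpha> C f "-2"] by (simp add: exp_of_real[symmetric])

lemma jbracket_abs: "\<bar>of_int n\<bar> \<le> jbracket n" by (simp add: jbracket_def)

section \<open>Stream function and vorticity as integral operators\<close>

text \<open>The stream function equation \<open>\<phi>'' - n^2 \<phi> = e^(2s) w\<close> is factorised: \<open>phi_plus\<close> is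
  \<open>\<phi>' + |n| \<phi>\<close>, determined by \<open>w\<close> alone through its decay at infinity, and \<open>phi\<close> is then
  recovered by integrating from the circle, where its value \<open>b n\<close> is prescribed.\<close>

definition phi_plus :: "modes \<Rightarrow> modes" where
  "phi_plus w n s = - backward (of_int \<bar>n\<bar>) (\<lambda>t. of_real (exp (2 * t)) * w n t) s"

definition phi :: "(int \<Rightarrow> complex) \<Rightarrow> modes \<Rightarrow> modes" where
  "phi b w n s = (if n = 0 then 0 else forward (of_int \<bar>n\<bar>) (phi_plus w n) s + b n * exp (- (of_int \<bar>n\<bar> * of_real s)))"

text \<open>The derivative of \<open>phi\<close> in \<open>s\<close>. In the mode \<open>0\<close> it is normalised by its value \<open>m\<close> at the
  circle, the deviation of the mean swirl; what remains of it at infinity is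
  \<open>m - phi_plus w 0 0\<close>.\<close>

definition phi_s :: "(int \<Rightarrow> complex) \<Rightarrow> complex \<Rightarrow> modes \<Rightarrow> modes" where
  "phi_s b m w n s = phi_plus w n s - of_int \<bar>n\<bar> * phi b w n s + (if n = 0 then m - phi_plus w 0 0 else 0)"

definition phi_theta :: "(int \<Rightarrow> complex) \<Rightarrow> modes \<Rightarrow> modes" where
  "phi_theta b w n s = \<i> * (of_int n * phi b w n s)"

text \<open>Variation of constants for \<open>w'' - \<zeta>^2 w = i n P - Q'\<close>, with the derivative of \<open>Q\<close>
  removed by partial integration. The growing exponential is integrated from infinity and the
  decaying one from the circle.\<close>

definition lin_particular :: "real \<Rightarrow> modes \<Rightarrow> modes \<Rightarrow> modes" where
  "lin_particular mu P Q n s = - 1 / (2 * zeta mu n) *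
     (backward (zeta mu n) (\<lambda>t. \<i> * of_int n * P n t - zeta mu n * Q n t) s +
      forward (zeta mu n) (\<lambda>t. \<i> * of_int n * P n t + zeta mu n * Q n t) s)"

text \<open>To the particular solution a multiple of the decaying exponential is added. The multiple
  is chosen such that \<open>phi_plus\<close> of the sum takes the value \<open>\<gamma> n\<close> at the circle, see
  \<open>phi_plus_w_0\<close>; since \<open>phi_plus\<close> is \<open>\<phi>' + |n| \<phi>\<close>, this prescribes the tangential velocity.
  In the mode \<open>0\<close> the equation integrates to \<open>w' = - Q\<close>, and decay leaves no free constant.\<close>

definition lin_solve :: "real \<Rightarrow> (int \<Rightarrow> complex) \<Rightarrow> modes \<Rightarrow> modes \<Rightarrow> modes" where
  "lin_solve mu \<gamma> P Q n s = (if n = 0 then backward 0 (Q 0) s else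
     lin_particular mu P Q n s - (zeta mu n + of_int \<bar>n\<bar> - 2) * (\<gamma> n - phi_plus (lin_particular mu P Q) n 0) * exp (- (zeta mu n * of_real s)))"

text
  \<open>A fixed point is a vorticity whose own stream function produces the quadratic terms that drive it.\<close>

definition fix_map :: "real \<Rightarrow> (int \<Rightarrow> complex) \<Rightarrow> complex \<Rightarrow> (int \<Rightarrow> complex) \<Rightarrow> modes \<Rightarrow> modes" where
  "fix_map mu b m \<gamma> w = lin_solve mu \<gamma> (conv (phi_s b m w) w) (conv (phi_theta b w) w)"

text \<open>Balls of the weighted sup norm. The factor \<open>exp (- c |n| s)\<close> costs nothing under
  convolution, by the triangle inequality for indices, and is the source of all interior
  smoothness.\<close>

definition mode_decay :: "real \<Rightarrow> real \<Rightarrow> real \<Rightarrow> modes \<Rightarrow> bool" where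
  "mode_decay c \<beta> M f \<longleftrightarrow> (\<forall>n. exp_decay (\<beta> + c * \<bar>of_int n\<bar>) (M * wt n) (f n))"

lemma mode_decayD: "mode_decay c \<beta> M f \<Longrightarrow> exp_decay (\<beta> + c * \<bar>of_int n\<bar>) (M * wt n) (f n)"
  by (simp add: mode_decay_def)

lemma mode_decay_nonneg: "mode_decay c \<beta> M f \<Longrightarrow> 0 \<le> M"
  using exp_decay_nonneg[OF mode_decayD[of c \<beta> M f 0]] by (simp add: wt_def)

lemma mode_decay_mono: "mode_decay c \<beta> M f \<Longrightarrow> M \<le> M' \<Longrightarrow> mode_decay c \<beta> M' f"
  unfolding mode_decay_def by (meson exp_decay_mono mult_right_mono order.refl less_imp_le wt_pos)

lemma mode_decay_add: "mode_decay c \<beta> M f \<Longrightarrow> mode_decay c \<beta> N g \<Longrightarrow> mode_decay c \<beta> (M + N) (\<lambda>n s. f n s + g n s)"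
  unfolding mode_decay_def distrib_right by (auto intro: exp_decay_add)

lemma exp_decay_cong: "(\<And>t. 0 \<le> t \<Longrightarrow> f t = g t) \<Longrightarrow> exp_decay \<alpha> C f \<Longrightarrow> exp_decay \<alpha> C g"
  unfolding exp_decay_def using continuous_on_cong[of "{0..}" "{0..}" f g] by auto

lemma mode_decay_cong: "(\<And>n t. 0 \<le> t \<Longrightarrow> f n t = g n t) \<Longrightarrow> mode_decay c \<beta> M f \<Longrightarrow> mode_decay c \<beta> M g"
  unfolding mode_decay_def using exp_decay_cong by blast

lemma mode_decay_conv_term:
  assumes c: "0 \<le> c" and f: "mode_decay c \<beta> M f" and g: "mode_decay c \<beta>' N g" and s: "0 \<le> s"
  shows "norm (f k s * g (n - k) s) \<le> (M * N * exp (- ((\<beta> + \<beta>' + c * \<bar>of_int n\<bar>) * s))) * (wt k * wt (n - k))"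
proof -
  have M: "0 \<le> M" "0 \<le> N" using mode_decay_nonneg f g by auto
  have w: "0 \<le> wt k" "0 \<le> wt (n - k)" using wt_pos less_imp_le by auto
  have "norm (f k s * g (n - k) s) \<le> (M * wt k * exp (- ((\<beta> + c * \<bar>of_int k\<bar>) * s))) * (N * wt (n - k) * exp (- ((\<beta>' + c * \<bar>of_int (n - k)\<bar>) * s)))"
    unfolding norm_mult using M w by (intro mult_mono exp_decayD[OF mode_decayD[OF f] s] exp_decayD[OF mode_decayD[OF g] s]) auto
  also have "\<dots> = (M * N * exp (- ((\<beta> + \<beta>' + c * (\<bar>of_int k\<bar> + \<bar>of_int (n - k)\<bar>)) * s))) * (wt k * wt (n - k))"
  proof -
    have "exp (- ((\<beta> + c * \<bar>of_int k\<bar>) * s)) * exp (- ((\<beta>' + c * \<bar>of_int (n - k)\<bar>) * s)) = exp (- ((\<beta> + \<beta>' + c * (\<bar>of_int k\<bar> + \<bar>of_int (n - k)\<bar>)) * s))"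
      by (simp add: exp_add[symmetric] algebra_simps)
    then show ?thesis by (simp only: mult_ac)
  qed
  also have "\<dots> \<le> (M * N * exp (- ((\<beta> + \<beta>' + c * \<bar>of_int n\<bar>) * s))) * (wt k * wt (n - k))"
  proof -
    have "\<bar>of_int n\<bar> \<le> \<bar>real_of_int k\<bar> + \<bar>real_of_int (n - k)\<bar>" by simp
    then have "(\<beta> + \<beta>' + c * \<bar>of_int n\<bar>) * s \<le> (\<beta> + \<beta>' + c * (\<bar>of_int k\<bar> + \<bar>of_int (n - k)\<bar>)) * s"
      using c s by (intro mult_right_mono add_left_mono mult_left_mono) auto
    then show ?thesis using M w by (intro mult_right_mono mult_left_mono) auto
  qed
  finally show ?thesis .
qed

lemma mode_decay_conv_summable:
  assumes "0 \<le> c" "mode_decay c \<beta> M f" "mode_decay c \<beta>' N g" "0 \<le> s"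
  shows "(\<lambda>k. f k s * g (n - k) s) summable_on UNIV"
  by (rule norm_infsum_le_majorant(1)[OF summable_on_cmult_right[OF conv_majorant(1)] mode_decay_conv_term[OF assms]])

lemma mode_decay_conv:
  assumes c: "0 \<le> c" and b: "0 \<le> \<beta>" "0 \<le> \<beta>'" and f: "mode_decay c \<beta> M f" and g: "mode_decay c \<beta>' N g"
  shows "mode_decay c (\<beta> + \<beta>') (4 * wt_total * M * N) (conv f g)"
  unfolding mode_decay_def exp_decay_def
proof (intro allI conjI impI)
  fix n :: int
  have MN: "0 \<le> M" "0 \<le> N" using mode_decay_nonneg f g by auto
  show "continuous_on {0..} (conv f g n)"
    unfolding conv_def[abs_def]
  proof (rule continuous_on_infsum_majorant[OF summable_on_cmult_right[OF conv_majorant(1)[of n], of "M * N"]])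
    fix k and s :: real assume "s \<in> {0..}"
    then have s: "0 \<le> s" by simp
    have "norm (f k s * g (n - k) s) \<le> (M * N * exp (- ((\<beta> + \<beta>' + c * \<bar>of_int n\<bar>) * s))) * (wt k * wt (n - k))"
      by (rule mode_decay_conv_term[OF c f g s])
    also have "\<dots> \<le> (M * N * 1) * (wt k * wt (n - k))"
      using MN b c s by (intro mult_right_mono mult_left_mono) (auto simp: less_imp_le[OF wt_pos])
    finally show "norm (f k s * g (n - k) s) \<le> M * N * (wt k * wt (n - k))" by simp
  next
    fix k show "continuous_on {0..} (\<lambda>s. f k s * g (n - k) s)"
      by (intro continuous_intros exp_decay_cont[OF mode_decayD[OF f]] exp_decay_cont[OF mode_decayD[OF g]])
  qed
  fix s :: real assume s: "0 \<le> s"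
  let ?E = "exp (- ((\<beta> + \<beta>' + c * \<bar>of_int n\<bar>) * s))"
  have "norm (conv f g n s) \<le> (\<Sum>\<^sub>\<infinity>k. M * N * ?E * (wt k * wt (n - k)))"
    unfolding conv_def
    by (rule norm_infsum_le_majorant(2)[OF summable_on_cmult_right[OF conv_majorant(1)] mode_decay_conv_term[OF c f g s]])
  also have "\<dots> = M * N * ?E * (\<Sum>\<^sub>\<infinity>k. wt k * wt (n - k))" by (rule infsum_cmult_right')
  also have "\<dots> \<le> M * N * ?E * (4 * wt_total * wt n)"
    using MN by (intro mult_left_mono conv_majorant(2)) auto
  finally show "norm (conv f g n s) \<le> 4 * wt_total * M * N * wt n * ?E" by (simp add: mult_ac)
qed

text \<open>The usual splitting of a difference of products, which turns bounds for \<open>conv\<close> into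
  Lipschitz bounds.\<close>

lemma conv_diff:
  assumes c: "0 \<le> c" and f: "mode_decay c \<beta> M f" and f': "mode_decay c \<beta> M' f'" and g: "mode_decay c \<beta>' N g" and g': "mode_decay c \<beta>' N' g'" and s: "0 \<le> s"
  shows "conv f g n s - conv f' g' n s = conv f (\<lambda>n s. g n s - g' n s) n s + conv (\<lambda>n s. f n s - f' n s) g' n s"
proof -
  note sm = mode_decay_conv_summable[OF c _ _ s]
  have m: "(\<lambda>k. - (f k s * g' (n - k) s)) summable_on UNIV" "(\<lambda>k. - (f' k s * g' (n - k) s)) summable_on UNIV"
    using sm[OF f g'] sm[OF f' g'] by (simp_all add: summable_on_uminus)
  have "conv f (\<lambda>n s. g n s - g' n s) n s = conv f g n s - conv f g' n s"
    using infsum_add[OF sm[OF f g] m(1)] by (simp add: conv_def right_diff_distrib infsum_uminus)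
  moreover have "conv (\<lambda>n s. f n s - f' n s) g' n s = conv f g' n s - conv f' g' n s"
    using infsum_add[OF sm[OF f g'] m(2)] by (simp add: conv_def left_diff_distrib infsum_uminus)
  ultimately show ?thesis by simp
qed

section \<open>Bounds for the integral operators\<close>

text \<open>A swirl strength together with decay rates as provided by \<open>decay_rates_exist\<close>.\<close>

locale swirl =
  fixes mu a c :: real
  assumes a2: "2 < a" and c0: "0 < c" and ac: "a - 2 + c \<le> 1/2" and mu0: "mu \<noteq> 0"
    and gap: "\<And>n. n \<noteq> 0 \<Longrightarrow> a + 2 * c * \<bar>of_int n\<bar> \<le> Re (zeta mu n)"
begin

text \<open>\<open>K1\<close> bounds the map from the vorticity to the derivatives of the stream function, \<open>KS\<close>
  the map from the quadratic terms to the vorticity, and \<open>KG\<close> the map from the boundary value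
  \<open>\<gamma>\<close> to the vorticity.\<close>

definition K1 :: real where "K1 = 3 / (a - 2)"
definition KG :: real where "KG = \<bar>mu\<bar> + 4"
definition KS :: real where "KS = (2 + \<bar>mu\<bar>) / c * (1 + KG) + 1 / a"

lemma K_pos: "0 < K1" "0 < KG" "0 < KS"
proof -
  show "0 < K1" "0 < KG" using a2 by (simp_all add: K1_def KG_def add_nonneg_pos)
  then have "0 < (2 + \<bar>mu\<bar>) / c * (1 + KG)" using c0 by (intro mult_pos_pos divide_pos_pos) (auto intro: add_pos_nonneg)
  then show "0 < KS" using a2 unfolding KS_def by (intro add_pos_pos) auto
qed

lemma abs_int_ge1: "n \<noteq> 0 \<Longrightarrow> 1 \<le> \<bar>real_of_int n\<bar>"
  by linarith

lemma e2_exp_decay: "mode_decay c a M w \<Longrightarrow> exp_decay (a - 2 + c * \<bar>of_int n\<bar>) (M * wt n) (\<lambda>t. of_real (exp (2 * t)) * w n t)"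
  using exp_decay_exp2[OF mode_decayD, of c a M w n] by (simp add: algebra_simps)

lemma rate_pos: "0 < a - 2 + c * \<bar>real_of_int n\<bar>"
  using a2 c0 by (intro add_pos_nonneg) auto

lemma phi_plus_exp_decay:
  assumes w: "mode_decay c a M w"
  shows "exp_decay (a - 2 + c * \<bar>of_int n\<bar>) (M / (a - 2) * wt n) (phi_plus w n)"
proof -
  have p: "0 < a - 2 + c * \<bar>real_of_int n\<bar> + Re (of_int \<bar>n\<bar>)" using rate_pos[of n] by simp
  have "exp_decay (a - 2 + c * \<bar>of_int n\<bar>) (norm (-1 :: complex) * (M * wt n / (a - 2 + c * \<bar>of_int n\<bar> + Re (of_int \<bar>n\<bar>)))) (phi_plus w n)"
    using exp_decay_cmult[OF exp_decay_backward[OF e2_exp_decay[OF w] p], of "-1"] unfolding phi_plus_def[abs_def] by simp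
  then show ?thesis
  proof (rule exp_decay_mono)
    have "M * wt n / (a - 2 + c * \<bar>of_int n\<bar> + Re (of_int \<bar>n\<bar>)) \<le> M * wt n / (a - 2)"
      using mode_decay_nonneg[OF w] wt_pos[of n] a2 c0 by (intro divide_left_mono) (auto intro!: mult_pos_pos add_pos_nonneg)
    then show "norm (-1 :: complex) * (M * wt n / (a - 2 + c * \<bar>of_int n\<bar> + Re (of_int \<bar>n\<bar>))) \<le> M / (a - 2) * wt n" by simp
  qed simp
qed

lemma half_gap: "x \<le> 2 * (x - y) \<Longrightarrow> 0 < x \<Longrightarrow> 0 < x - y" for x y :: real
  by simp

text \<open>The rate of the stream function stays below half its characteristic exponent \<open>|n|\<close>, so
  integration from the circle costs at most the factor \<open>2 / |n|\<close>, and the derivative of \<open>\<phi>\<close> in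
  the angle is controlled without loss.\<close>

lemma rate_half: "n \<noteq> 0 \<Longrightarrow> \<bar>real_of_int n\<bar> \<le> 2 * (\<bar>of_int n\<bar> - (a - 2 + c * \<bar>of_int n\<bar>))"
proof -
  assume n: "n \<noteq> 0"
  have "a - 2 + c * \<bar>real_of_int n\<bar> \<le> (a - 2) * \<bar>real_of_int n\<bar> + c * \<bar>real_of_int n\<bar>"
    using mult_left_mono[OF abs_int_ge1[OF n], of "a - 2"] a2 by simp
  also have "\<dots> = (a - 2 + c) * \<bar>real_of_int n\<bar>" by (simp add: distrib_right)
  also have "\<dots> \<le> 1/2 * \<bar>real_of_int n\<bar>" using ac by (intro mult_right_mono) auto
  finally show ?thesis by (simp add: field_simps)
qed

lemma phi_exp_decay:
  assumes w: "mode_decay c a M w" and b: "norm (of_int n * b n) \<le> e * wt n" and n: "n \<noteq> 0"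
  shows "exp_decay (a - 2 + c * \<bar>of_int n\<bar>) ((2 * M / (a - 2) + e) * wt n) (\<lambda>s. of_int n * phi b w n s)"
proof -
  let ?r = "a - 2 + c * \<bar>real_of_int n\<bar>"
  have n0: "0 < \<bar>real_of_int n\<bar>" using n by simp
  have r: "?r < Re (of_int \<bar>n\<bar>)" using rate_half[OF n] n0 by simp
  have 1: "exp_decay ?r (norm (of_int n :: complex) * (M / (a - 2) * wt n / (Re (of_int \<bar>n\<bar>) - ?r))) (\<lambda>s. of_int n * forward (of_int \<bar>n\<bar>) (phi_plus w n) s)"
    by (rule exp_decay_cmult[OF exp_decay_forward[OF phi_plus_exp_decay[OF w] r]])
  have 2: "exp_decay ?r (norm (of_int n * b n)) (\<lambda>s. (of_int n * b n) * exp (- (of_int \<bar>n\<bar> * of_real s)))"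
    by (rule exp_decay_exponential) (use r in simp)
  have "exp_decay ?r (2 * M / (a - 2) * wt n + e * wt n) (\<lambda>s. of_int n * forward (of_int \<bar>n\<bar>) (phi_plus w n) s + (of_int n * b n) * exp (- (of_int \<bar>n\<bar> * of_real s)))"
  proof (rule exp_decay_add)
    show "exp_decay ?r (e * wt n) (\<lambda>s. (of_int n * b n) * exp (- (of_int \<bar>n\<bar> * of_real s)))"
      by (rule exp_decay_mono[OF 2 _ b]) simp
    have "\<bar>real_of_int n\<bar> * (M / (a - 2) * wt n / (\<bar>real_of_int n\<bar> - ?r)) \<le> 2 * (M / (a - 2) * wt n)"
    proof -
      have X: "0 \<le> M / (a - 2) * wt n" using mode_decay_nonneg[OF w] a2 wt_pos[of n] by simp
      have "\<bar>real_of_int n\<bar> / (\<bar>real_of_int n\<bar> - ?r) \<le> 2"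
      proof -
        have "0 < \<bar>real_of_int n\<bar> - ?r" using half_gap[OF rate_half[OF n] n0] .
        note this rate_half[OF n]
        then show ?thesis by (simp only: pos_divide_le_eq)
      qed
      from mult_right_mono[OF this X] show ?thesis by (simp add: mult.commute)
    qed
    then show "exp_decay ?r (2 * M / (a - 2) * wt n) (\<lambda>s. of_int n * forward (of_int \<bar>n\<bar>) (phi_plus w n) s)"
      by (intro exp_decay_mono[OF 1]) auto
  qed
  then show ?thesis using n by (simp add: phi_def distrib_left distrib_right mult.assoc)
qed

lemma phi_theta_exp_decay:
  assumes w: "mode_decay c a M w" and b: "norm (of_int n * b n) \<le> e * wt n" and n: "n \<noteq> 0"
  shows "exp_decay (a - 2 + c * \<bar>of_int n\<bar>) ((K1 * M + e) * wt n) (phi_theta b w n)"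
proof -
  have "exp_decay (a - 2 + c * \<bar>of_int n\<bar>) (norm \<i> * ((2 * M / (a - 2) + e) * wt n)) (phi_theta b w n)"
    unfolding phi_theta_def[abs_def] by (rule exp_decay_cmult[OF phi_exp_decay[where b=b and n=n, OF w b n]])
  then show ?thesis
  proof (rule exp_decay_mono)
    have "2 * M / (a - 2) \<le> K1 * M" using a2 mode_decay_nonneg[OF w] by (simp add: K1_def divide_right_mono)
    then show "norm \<i> * ((2 * M / (a - 2) + e) * wt n) \<le> (K1 * M + e) * wt n"
      using wt_pos[of n] by simp
  qed simp
qed

lemma phi_s_exp_decay:
  assumes w: "mode_decay c a M w" and b: "norm (of_int n * b n) \<le> e * wt n" and n: "n \<noteq> 0"
  shows "exp_decay (a - 2 + c * \<bar>of_int n\<bar>) ((K1 * M + e) * wt n) (phi_s b m w n)"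
proof -
  have sg: "of_int \<bar>n\<bar> * x = of_int (sgn n) * (of_int n * x)" for x :: complex
  proof -
    have "of_int \<bar>n\<bar> = (of_int (sgn n) * of_int n :: complex)"
      by (simp only: abs_sgn[of n] of_int_mult mult.commute)
    then show ?thesis by (simp only: mult.assoc)
  qed
  have "exp_decay (a - 2 + c * \<bar>of_int n\<bar>) (norm (of_int (sgn n) :: complex) * ((2 * M / (a - 2) + e) * wt n)) (\<lambda>s. of_int \<bar>n\<bar> * phi b w n s)"
    unfolding sg by (rule exp_decay_cmult[OF phi_exp_decay[where b=b and n=n, OF w b n]])
  moreover have "norm (of_int (sgn n) :: complex) = 1" using n by (auto simp: sgn_if)
  ultimately have "exp_decay (a - 2 + c * \<bar>of_int n\<bar>) (M / (a - 2) * wt n + (2 * M / (a - 2) + e) * wt n) (\<lambda>s. phi_plus w n s - of_int \<bar>n\<bar> * phi b w n s)"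
    by (intro exp_decay_diff phi_plus_exp_decay w) simp
  moreover have "M / (a - 2) * wt n + (2 * M / (a - 2) + e) * wt n = (K1 * M + e) * wt n"
    by (simp add: K1_def algebra_simps)
  ultimately show ?thesis using n by (simp add: phi_s_def[abs_def])
qed

lemma phi_theta_mode_decay:
  assumes w: "mode_decay c a M w" and b: "\<And>n. norm (of_int n * b n) \<le> e * wt n"
  shows "mode_decay c 0 (K1 * M + e) (phi_theta b w)"
  unfolding mode_decay_def
proof
  fix n
  have C: "0 \<le> K1 * M + e"
    using K_pos(1) mode_decay_nonneg[OF w] order_trans[OF norm_ge_zero b[of 0]] by (simp add: wt_def)
  show "exp_decay (0 + c * \<bar>of_int n\<bar>) ((K1 * M + e) * wt n) (phi_theta b w n)"
  proof (cases "n = 0")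
    case True
    then show ?thesis using C by (simp add: exp_decay_def phi_theta_def[abs_def] wt_def)
  next
    case False
    then show ?thesis by (intro exp_decay_mono[OF phi_theta_exp_decay[where b=b and n=n, OF w b False]]) (use a2 in auto)
  qed
qed

lemma phi_s_mode_decay:
  assumes w: "mode_decay c a M w" and b: "\<And>n. norm (of_int n * b n) \<le> e * wt n" and m: "norm m \<le> e"
  shows "mode_decay c 0 (K1 * M + e) (phi_s b m w)"
  unfolding mode_decay_def
proof
  fix n
  show "exp_decay (0 + c * \<bar>of_int n\<bar>) ((K1 * M + e) * wt n) (phi_s b m w n)"
  proof (cases "n = 0")
    case True
    have g: "exp_decay (a - 2) (M / (a - 2)) (phi_plus w 0)" using phi_plus_exp_decay[OF w, of 0] by (simp add: wt_def)
    then have "exp_decay 0 (M / (a - 2)) (phi_plus w 0)" by (rule exp_decay_mono) (use a2 in auto)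
    moreover have "exp_decay 0 (norm (m - phi_plus w 0 0)) (\<lambda>s. m - phi_plus w 0 0)" by (simp add: exp_decay_def)
    ultimately have "exp_decay 0 (M / (a - 2) + norm (m - phi_plus w 0 0)) (\<lambda>s. phi_plus w 0 s + (m - phi_plus w 0 0))"
      by (rule exp_decay_add)
    then show ?thesis unfolding True phi_s_def[abs_def]
    proof (rule exp_decay_mono[of _ _ "\<lambda>s. phi_plus w 0 s + (m - phi_plus w 0 0)", THEN exp_decay_cong[rotated]])
      have "norm (m - phi_plus w 0 0) \<le> e + M / (a - 2)"
        using norm_triangle_ineq4[of m "phi_plus w 0 0"] m exp_decayD[OF g, of 0] by simp
      moreover have "M / (a - 2) + (e + M / (a - 2)) \<le> K1 * M + e"
      proof -
        have "0 \<le> M / (a - 2)" "K1 * M = 3 * (M / (a - 2))" using mode_decay_nonneg[OF w] a2 by (simp_all add: K1_def)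
        then show ?thesis by linarith
      qed
      ultimately show "M / (a - 2) + norm (m - phi_plus w 0 0) \<le> (K1 * M + e) * wt 0" by (simp add: wt_def)
    qed auto
  next
    case False
    then show ?thesis by (intro exp_decay_mono[OF phi_s_exp_decay[where b=b and n=n, OF w b False]]) (use a2 in auto)
  qed
qed

lemma phi_plus_diff:
  assumes "mode_decay c a M w" "mode_decay c a M' w'" "0 \<le> s"
  shows "phi_plus (\<lambda>n s. w n s - w' n s) n s = phi_plus w n s - phi_plus w' n s"
  unfolding phi_plus_def right_diff_distrib
  using backward_diff[OF e2_exp_decay[OF assms(1)] e2_exp_decay[OF assms(2)] _ assms(3), of n "of_int \<bar>n\<bar>"] rate_pos[of n] by simp

lemma phi_diff:
  assumes w: "mode_decay c a M w" "mode_decay c a M' w'" and s: "0 \<le> s"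
  shows "phi (\<lambda>_. 0) (\<lambda>n s. w n s - w' n s) n s = phi b w n s - phi b w' n s"
proof (cases "n = 0")
  case False
  have "forward (of_int \<bar>n\<bar>) (phi_plus (\<lambda>n s. w n s - w' n s) n) s = forward (of_int \<bar>n\<bar>) (\<lambda>t. phi_plus w n t - phi_plus w' n t) s"
    by (rule forward_cong) (rule phi_plus_diff[OF w])
  also have "\<dots> = forward (of_int \<bar>n\<bar>) (phi_plus w n) s - forward (of_int \<bar>n\<bar>) (phi_plus w' n) s"
    by (rule forward_diff[OF exp_decay_cont[OF phi_plus_exp_decay[OF w(1)]] exp_decay_cont[OF phi_plus_exp_decay[OF w(2)]]])
  finally show ?thesis using False by (simp add: phi_def)
qed (simp add: phi_def)

lemma phi_theta_diff:
  assumes "mode_decay c a M w" "mode_decay c a M' w'" "0 \<le> s"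
  shows "phi_theta (\<lambda>_. 0) (\<lambda>n s. w n s - w' n s) n s = phi_theta b w n s - phi_theta b w' n s"
  unfolding phi_theta_def phi_diff[OF assms, of n b] by (simp add: right_diff_distrib)

lemma phi_s_diff:
  assumes w: "mode_decay c a M w" "mode_decay c a M' w'" and s: "0 \<le> s"
  shows "phi_s (\<lambda>_. 0) 0 (\<lambda>n s. w n s - w' n s) n s = phi_s b m w n s - phi_s b m w' n s"
  unfolding phi_s_def phi_diff[OF assms, of n b] phi_plus_diff[OF assms] using phi_plus_diff[OF w order.refl, of 0]
  by (simp add: right_diff_distrib)

lemma Re_zeta_pos: "n \<noteq> 0 \<Longrightarrow> 0 < Re (zeta mu n)"
  using gap[of n] a2 c0 by (smt (verit, ccfv_threshold) abs_ge_zero mult_nonneg_nonneg)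

lemma zeta_ne0: "n \<noteq> 0 \<Longrightarrow> zeta mu n \<noteq> 0"
  using Re_zeta_pos[of n] by auto

lemma source_exp_decay:
  assumes P: "mode_decay c a N P" and Q: "mode_decay c a N Q"
  shows "exp_decay (a + c * \<bar>of_int n\<bar>) ((2 + \<bar>mu\<bar>) * \<bar>of_int n\<bar> * (N * wt n)) (\<lambda>t. \<i> * of_int n * P n t - zeta mu n * Q n t)"
    "exp_decay (a + c * \<bar>of_int n\<bar>) ((2 + \<bar>mu\<bar>) * \<bar>of_int n\<bar> * (N * wt n)) (\<lambda>t. \<i> * of_int n * P n t + zeta mu n * Q n t)"
proof -
  have N: "0 \<le> N * wt n" using mode_decay_nonneg[OF P] wt_pos[of n] by simp
  have le: "norm (\<i> * of_int n) * (N * wt n) + norm (zeta mu n) * (N * wt n) \<le> (2 + \<bar>mu\<bar>) * \<bar>of_int n\<bar> * (N * wt n)"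
  proof -
    have "norm (\<i> * of_int n) + norm (zeta mu n) \<le> (2 + \<bar>mu\<bar>) * \<bar>of_int n\<bar>"
      using norm_zeta_le[of mu n] by (simp add: norm_mult algebra_simps)
    from mult_right_mono[OF this N] show ?thesis by (simp add: distrib_right)
  qed
  show "exp_decay (a + c * \<bar>of_int n\<bar>) ((2 + \<bar>mu\<bar>) * \<bar>of_int n\<bar> * (N * wt n)) (\<lambda>t. \<i> * of_int n * P n t - zeta mu n * Q n t)"
    by (rule exp_decay_mono[OF exp_decay_diff[OF exp_decay_cmult[OF mode_decayD[OF P]] exp_decay_cmult[OF mode_decayD[OF Q]]] order.refl le])
  show "exp_decay (a + c * \<bar>of_int n\<bar>) ((2 + \<bar>mu\<bar>) * \<bar>of_int n\<bar> * (N * wt n)) (\<lambda>t. \<i> * of_int n * P n t + zeta mu n * Q n t)"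
    by (rule exp_decay_mono[OF exp_decay_add[OF exp_decay_cmult[OF mode_decayD[OF P]] exp_decay_cmult[OF mode_decayD[OF Q]]] order.refl le])
qed

lemma rate_lt: "n \<noteq> 0 \<Longrightarrow> a + c * \<bar>real_of_int n\<bar> < Re (zeta mu n)"
  "n \<noteq> 0 \<Longrightarrow> c * \<bar>real_of_int n\<bar> \<le> Re (zeta mu n) - (a + c * \<bar>real_of_int n\<bar>)"
  "n \<noteq> 0 \<Longrightarrow> c * \<bar>real_of_int n\<bar> \<le> a + c * \<bar>real_of_int n\<bar> + Re (zeta mu n)"
  using gap[of n] a2 Re_zeta_pos[of n] mult_pos_pos[OF c0, of "\<bar>real_of_int n\<bar>"] by auto

text \<open>The source carries the factor \<open>|n|\<close>. It is compensated by the gap \<open>c |n|\<close> between the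
  rates, and the prefactor \<open>1 / \<zeta>\<close> gains another power of \<open>|n|\<close>, which \<open>lin_solve_mode_decay\<close>
  spends on the factor \<open>\<zeta> + |n| - 2\<close>.\<close>

lemma lin_particular_exp_decay:
  assumes P: "mode_decay c a N P" and Q: "mode_decay c a N Q" and n: "n \<noteq> 0"
  shows "exp_decay (a + c * \<bar>of_int n\<bar>) ((2 + \<bar>mu\<bar>) / c * N * wt n / \<bar>of_int n\<bar>) (lin_particular mu P Q n)"
proof -
  let ?r = "a + c * \<bar>real_of_int n\<bar>" let ?F = "(2 + \<bar>mu\<bar>) * \<bar>real_of_int n\<bar> * (N * wt n)"
  have n0: "0 < \<bar>real_of_int n\<bar>" using n by simp
  have F: "0 \<le> ?F" using mode_decay_nonneg[OF P] wt_pos[of n] by simp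
  have cn: "0 < c * \<bar>real_of_int n\<bar>" using c0 n0 by simp
  have "exp_decay ?r (?F / (c * \<bar>of_int n\<bar>)) (backward (zeta mu n) (\<lambda>t. \<i> * of_int n * P n t - zeta mu n * Q n t))"
  proof (rule exp_decay_mono[OF exp_decay_backward[OF source_exp_decay(1)[OF P Q]] order.refl])
    show "0 < ?r + Re (zeta mu n)" using rate_lt(3)[OF n] cn by linarith
    then show "?F / (?r + Re (zeta mu n)) \<le> ?F / (c * \<bar>of_int n\<bar>)"
      by (intro divide_left_mono rate_lt(3)[OF n] F mult_pos_pos cn)
  qed
  moreover have "exp_decay ?r (?F / (c * \<bar>of_int n\<bar>)) (forward (zeta mu n) (\<lambda>t. \<i> * of_int n * P n t + zeta mu n * Q n t))"
  proof (rule exp_decay_mono[OF exp_decay_forward[OF source_exp_decay(2)[OF P Q] rate_lt(1)[OF n]] order.refl])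
    have "0 < Re (zeta mu n) - ?r" using rate_lt(1)[OF n] by linarith
    then show "?F / (Re (zeta mu n) - ?r) \<le> ?F / (c * \<bar>of_int n\<bar>)"
      by (intro divide_left_mono rate_lt(2)[OF n] F mult_pos_pos cn)
  qed
  ultimately have "exp_decay ?r (norm (- 1 / (2 * zeta mu n)) * (?F / (c * \<bar>of_int n\<bar>) + ?F / (c * \<bar>of_int n\<bar>))) (lin_particular mu P Q n)"
    unfolding lin_particular_def[abs_def] by (intro exp_decay_cmult exp_decay_add)
  then show ?thesis
  proof (rule exp_decay_mono)
    have z: "\<bar>real_of_int n\<bar> \<le> norm (zeta mu n)" by (rule norm_zeta_ge)
    have "norm (- 1 / (2 * zeta mu n)) * (?F / (c * \<bar>of_int n\<bar>) + ?F / (c * \<bar>of_int n\<bar>)) = ?F / (c * \<bar>of_int n\<bar>) / norm (zeta mu n)"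
      by (simp add: norm_divide norm_mult)
    also have "\<dots> \<le> ?F / (c * \<bar>of_int n\<bar>) / \<bar>of_int n\<bar>"
      by (intro divide_left_mono z divide_nonneg_nonneg F less_imp_le[OF cn] mult_pos_pos less_le_trans[OF n0 z] n0)
    also have "\<dots> = (2 + \<bar>mu\<bar>) / c * N * wt n / \<bar>of_int n\<bar>" using n0 by simp
    finally show "norm (- 1 / (2 * zeta mu n)) * (?F / (c * \<bar>of_int n\<bar>) + ?F / (c * \<bar>of_int n\<bar>)) \<le> (2 + \<bar>mu\<bar>) / c * N * wt n / \<bar>of_int n\<bar>" .
  qed simp
qed

lemma e2_lin_particular:
  assumes P: "mode_decay c a N P" and Q: "mode_decay c a N Q" and n: "n \<noteq> 0"
  shows "exp_decay (a - 2 + c * \<bar>of_int n\<bar>) ((2 + \<bar>mu\<bar>) / c * N * wt n / \<bar>of_int n\<bar>) (\<lambda>t. of_real (exp (2 * t)) * lin_particular mu P Q n t)"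
  using exp_decay_exp2[OF lin_particular_exp_decay[OF assms]] by (simp add: algebra_simps)

lemma phi_plus_lin_particular_bound:
  assumes P: "mode_decay c a N P" and Q: "mode_decay c a N Q" and n: "n \<noteq> 0"
  shows "norm (phi_plus (lin_particular mu P Q) n 0) \<le> (2 + \<bar>mu\<bar>) / c * N * wt n / \<bar>of_int n\<bar>"
proof -
  let ?A = "(2 + \<bar>mu\<bar>) / c * N * wt n / \<bar>real_of_int n\<bar>"
  have A: "0 \<le> ?A" using mode_decay_nonneg[OF P] wt_pos[of n] c0 by simp
  have n1: "1 \<le> \<bar>real_of_int n\<bar>" using n by (rule abs_int_ge1)
  have p: "0 < a - 2 + c * \<bar>real_of_int n\<bar> + Re (of_int \<bar>n\<bar>)" using rate_pos[of n] by simp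
  have "norm (phi_plus (lin_particular mu P Q) n 0) \<le> ?A / (a - 2 + c * \<bar>of_int n\<bar> + \<bar>of_int n\<bar>)"
    using exp_decayD[OF exp_decay_backward[OF e2_lin_particular[OF assms] p], of 0] by (simp add: phi_plus_def)
  also have "\<dots> \<le> ?A / 1"
    using A n1 rate_pos[of n] by (intro divide_left_mono) auto
  finally show ?thesis by simp
qed

lemma lin_solve_mode_decay:
  assumes P: "mode_decay c a N P" and Q: "mode_decay c a N Q" and g: "\<And>n. norm (of_int n * \<gamma> n) \<le> e * wt n"
  shows "mode_decay c a (KS * N + KG * e) (lin_solve mu \<gamma> P Q)"
  unfolding mode_decay_def
proof
  fix n
  have N: "0 \<le> N" using mode_decay_nonneg[OF P] .
  have e: "0 \<le> e" using order_trans[OF norm_ge_zero g[of 0]] by (simp add: wt_def)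
  let ?A = "(2 + \<bar>mu\<bar>) / c * N"
  have A: "0 \<le> ?A" using N c0 by simp
  have KS: "KS * N = ?A * (1 + KG) + N / a" using c0 a2 by (simp add: KS_def field_simps)
  show "exp_decay (a + c * \<bar>of_int n\<bar>) ((KS * N + KG * e) * wt n) (lin_solve mu \<gamma> P Q n)"
  proof (cases "n = 0")
    case True
    have "exp_decay a (N * wt 0 / (a + Re 0)) (backward 0 (Q 0))"
      by (rule exp_decay_backward) (use mode_decayD[OF Q, of 0] a2 in auto)
    moreover have "N / a \<le> KS * N + KG * e" 
    proof -
      have "0 \<le> ?A * (1 + KG)" by (rule mult_nonneg_nonneg[OF A]) (use K_pos in simp)
      moreover have "0 \<le> KG * e" by (rule mult_nonneg_nonneg[OF less_imp_le[OF K_pos(2)] e])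
      ultimately show ?thesis unfolding KS by linarith
    qed
    ultimately have "exp_decay a (KS * N + KG * e) (backward 0 (Q 0))"
      by (elim exp_decay_mono[OF _ order.refl]) (simp add: wt_def)
    then show ?thesis using True by (simp add: lin_solve_def[abs_def] wt_def)
  next
    case False
    let ?n = "\<bar>real_of_int n\<bar>"
    have n1: "1 \<le> ?n" using abs_int_ge1[OF False] .
    define Y where "Y = (zeta mu n + of_int \<bar>n\<bar> - 2) * (\<gamma> n - phi_plus (lin_particular mu P Q) n 0)"
    have Y: "norm Y \<le> KG * (e + ?A) * wt n"
    proof -
      have "norm (zeta mu n + of_int \<bar>n\<bar> - 2) \<le> norm (zeta mu n + of_int \<bar>n\<bar>) + 2"
        using norm_triangle_ineq4[of "zeta mu n + of_int \<bar>n\<bar>" 2] by simp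
      also have "\<dots> \<le> norm (zeta mu n) + ?n + 2"
        using norm_triangle_ineq[of "zeta mu n" "of_int \<bar>n\<bar>"] by simp
      also have "\<dots> \<le> (1 + \<bar>mu\<bar>) * ?n + ?n + 2 * ?n" using norm_zeta_le[of mu n] n1 by linarith
      also have "\<dots> = KG * ?n" by (simp add: KG_def algebra_simps)
      finally have 1: "norm (zeta mu n + of_int \<bar>n\<bar> - 2) \<le> KG * ?n" .
      have "norm (\<gamma> n) \<le> e * wt n / ?n" using g[of n] n1 by (simp add: norm_mult pos_le_divide_eq mult.commute)
      then have 2: "norm (\<gamma> n - phi_plus (lin_particular mu P Q) n 0) \<le> e * wt n / ?n + ?A * wt n / ?n"
        using norm_triangle_ineq4[of "\<gamma> n" "phi_plus (lin_particular mu P Q) n 0"] phi_plus_lin_particular_bound[OF P Q False] by simp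
      have "norm Y \<le> (KG * ?n) * (e * wt n / ?n + ?A * wt n / ?n)"
        unfolding Y_def norm_mult using K_pos n1 by (intro mult_mono 1 2) auto
      also have "\<dots> = KG * (e * wt n + ?A * wt n)"
      proof -
        have "(k * x) * (p / x + q / x) = k * (p + q)" if "x \<noteq> 0" for k x p q :: real
          using that by (simp add: field_simps)
        then show ?thesis using n1 by (metis abs_0 not_one_le_zero)
      qed
      also have "\<dots> = KG * (e + ?A) * wt n" by (simp only: distrib_right mult.assoc)
      finally show ?thesis .
    qed
    have d1: "exp_decay (a + c * ?n) (?A * wt n) (lin_particular mu P Q n)"
    proof (rule exp_decay_mono[OF lin_particular_exp_decay[OF P Q False] order.refl])
      have "?A * wt n / ?n \<le> ?A * wt n / 1"
        by (intro divide_left_mono n1 mult_nonneg_nonneg[OF A less_imp_le[OF wt_pos]]) (use n1 in auto)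
      then show "?A * wt n / ?n \<le> ?A * wt n" by simp
    qed
    have d2: "exp_decay (a + c * ?n) (KG * (e + ?A) * wt n) (\<lambda>s. Y * exp (- (zeta mu n * of_real s)))"
      by (rule exp_decay_mono[OF exp_decay_exponential order.refl Y]) (use rate_lt(1)[OF False] in simp)
    have "exp_decay (a + c * ?n) (?A * wt n + KG * (e + ?A) * wt n) (lin_solve mu \<gamma> P Q n)"
      using exp_decay_diff[OF d1 d2] False by (simp add: lin_solve_def[abs_def] Y_def)
    moreover have "?A * wt n + KG * (e + ?A) * wt n \<le> (KS * N + KG * e) * wt n"
    proof -
      have "?A + KG * (e + ?A) \<le> KS * N + KG * e" 
      proof -
        have "x + KG * (e + x) = x * (1 + KG) + KG * e" for x by (simp add: algebra_simps)
        moreover have "0 \<le> N / a" using N a2 by simp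
        ultimately show ?thesis unfolding KS by simp
      qed
      from mult_right_mono[OF this less_imp_le[OF wt_pos[of n]]] show ?thesis by (simp add: distrib_right)
    qed
    ultimately show ?thesis by (elim exp_decay_mono[OF _ order.refl])
  qed
qed

lemma lin_particular_diff:
  assumes P: "mode_decay c a N P" "mode_decay c a N' P'" and Q: "mode_decay c a N Q" "mode_decay c a N' Q'" and n: "n \<noteq> 0" and s: "0 \<le> s"
  shows "lin_particular mu (\<lambda>n s. P n s - P' n s) (\<lambda>n s. Q n s - Q' n s) n s = lin_particular mu P Q n s - lin_particular mu P' Q' n s"
proof -
  have "0 < c * \<bar>real_of_int n\<bar>" using c0 n by simp
  then have p: "0 < a + c * \<bar>real_of_int n\<bar> + Re (zeta mu n)"
    using rate_lt(3)[OF n] by linarith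
  have 1: "(\<lambda>t. \<i> * of_int n * (P n t - P' n t) - zeta mu n * (Q n t - Q' n t)) =
      (\<lambda>t. (\<i> * of_int n * P n t - zeta mu n * Q n t) - (\<i> * of_int n * P' n t - zeta mu n * Q' n t))"
    by (simp add: fun_eq_iff algebra_simps)
  have 2: "(\<lambda>t. \<i> * of_int n * (P n t - P' n t) + zeta mu n * (Q n t - Q' n t)) =
      (\<lambda>t. (\<i> * of_int n * P n t + zeta mu n * Q n t) - (\<i> * of_int n * P' n t + zeta mu n * Q' n t))"
    by (simp add: fun_eq_iff algebra_simps)
  show ?thesis unfolding lin_particular_def 1 2
      backward_diff[OF source_exp_decay(1)[OF P(1) Q(1)] source_exp_decay(1)[OF P(2) Q(2)] p s]
      forward_diff[OF exp_decay_cont[OF source_exp_decay(2)[OF P(1) Q(1)]] exp_decay_cont[OF source_exp_decay(2)[OF P(2) Q(2)]]]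
    by (simp add: algebra_simps add_divide_distrib diff_divide_distrib)
qed

lemma lin_solve_diff:
  assumes P: "mode_decay c a N P" "mode_decay c a N' P'" and Q: "mode_decay c a N Q" "mode_decay c a N' Q'" and s: "0 \<le> s"
  shows "lin_solve mu (\<lambda>_. 0) (\<lambda>n s. P n s - P' n s) (\<lambda>n s. Q n s - Q' n s) n s = lin_solve mu \<gamma> P Q n s - lin_solve mu \<gamma> P' Q' n s"
proof (cases "n = 0")
  case True
  have "backward 0 (\<lambda>s. Q 0 s - Q' 0 s) s = backward 0 (Q 0) s - backward 0 (Q' 0) s"
    by (rule backward_diff[OF mode_decayD[OF Q(1)] mode_decayD[OF Q(2)] _ s]) (use a2 in simp)
  then show ?thesis using True by (simp add: lin_solve_def)
next
  case False
  let ?w = "lin_particular mu (\<lambda>n s. P n s - P' n s) (\<lambda>n s. Q n s - Q' n s)"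
  have "phi_plus ?w n 0 = - backward (of_int \<bar>n\<bar>) (\<lambda>t. of_real (exp (2 * t)) * lin_particular mu P Q n t - of_real (exp (2 * t)) * lin_particular mu P' Q' n t) 0"
    unfolding phi_plus_def by (rule arg_cong[where f=uminus], rule backward_cong)
      (simp_all add: lin_particular_diff[OF P Q False] right_diff_distrib)
  also have "\<dots> = phi_plus (lin_particular mu P Q) n 0 - phi_plus (lin_particular mu P' Q') n 0"
    unfolding phi_plus_def using backward_diff[OF e2_lin_particular[OF P(1) Q(1) False] e2_lin_particular[OF P(2) Q(2) False], of "of_int \<bar>n\<bar>" 0]
      rate_pos[of n] by simp
  finally have g: "phi_plus ?w n 0 = phi_plus (lin_particular mu P Q) n 0 - phi_plus (lin_particular mu P' Q') n 0" .
  show ?thesis using False unfolding lin_solve_def g lin_particular_diff[OF P Q False s]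
    by (simp add: algebra_simps)
qed

end

section \<open>The fixed point\<close>

context swirl
begin

text \<open>Boundary data of size \<open>e\<close> and a radius \<open>M\<close> such that the ball of radius \<open>M\<close> is mapped into
  itself and the quadratic terms have Lipschitz constant at most \<open>1/2\<close> there.\<close>

context
  fixes b \<gamma> :: "int \<Rightarrow> complex" and m :: complex and e M :: real
  assumes b: "\<And>n. norm (of_int n * b n) \<le> e * wt n" and m: "norm m \<le> e"
    and g: "\<And>n. norm (of_int n * \<gamma> n) \<le> e * wt n"
    and small: "KS * (4 * wt_total) * (2 * K1 * M + e) \<le> 1 / 2" and Me: "2 * KG * e \<le> M"
begin

lemma e_nonneg: "0 \<le> e" using order_trans[OF norm_ge_zero m] .
lemma M_nonneg: "0 \<le> M"
  using Me e_nonneg K_pos(2) by (meson mult_nonneg_nonneg order_trans less_imp_le zero_le_numeral)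

lemma source_mode_decay:
  assumes w: "mode_decay c a M w"
  shows "mode_decay c a (4 * wt_total * (K1 * M + e) * M) (conv (phi_s b m w) w)"
    "mode_decay c a (4 * wt_total * (K1 * M + e) * M) (conv (phi_theta b w) w)"
  using mode_decay_conv[OF less_imp_le[OF c0] order.refl _ phi_s_mode_decay[where b=b, OF w b m] w]
    mode_decay_conv[OF less_imp_le[OF c0] order.refl _ phi_theta_mode_decay[where b=b, OF w b] w] a2 by auto

text
  \<open>Half of the ball is filled by the boundary data, the other half is left for the quadratic terms.\<close>

lemma fix_map_mode_decay:
  assumes w: "mode_decay c a M w"
  shows "mode_decay c a M (fix_map mu b m \<gamma> w)"
  unfolding fix_map_def
proof (rule mode_decay_mono[OF lin_solve_mode_decay[where \<gamma>=\<gamma>, OF source_mode_decay[OF w] g]])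
  have KW: "0 \<le> KS * (4 * wt_total)" using K_pos(3) wt_total_nonneg by simp
  have "KS * (4 * wt_total) * (K1 * M + e) \<le> KS * (4 * wt_total) * (2 * K1 * M + e)"
    using KW M_nonneg K_pos by (intro mult_left_mono) auto
  also have "\<dots> \<le> 1/2" by (rule small)
  finally have "KS * (4 * wt_total) * (K1 * M + e) * M \<le> 1/2 * M" using M_nonneg by (rule mult_right_mono)
  then show "KS * (4 * wt_total * (K1 * M + e) * M) + KG * e \<le> M" using Me by (simp add: mult.assoc)
qed

lemma fix_map_contraction:
  assumes w: "mode_decay c a M w" "mode_decay c a M w'" and d: "mode_decay c a D (\<lambda>n s. w n s - w' n s)"
  shows "mode_decay c a (D / 2) (\<lambda>n s. fix_map mu b m \<gamma> w n s - fix_map mu b m \<gamma> w' n s)"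
proof -
  have D: "0 \<le> D" using mode_decay_nonneg[OF d] .
  let ?N = "4 * wt_total * (K1 * M + e) * D + 4 * wt_total * (K1 * D + 0) * M"
  note cc = less_imp_le[OF c0]
  have a0: "0 \<le> a" using a2 by simp
  have z: "norm (of_int n * 0 :: complex) \<le> 0 * wt n" "norm (0 :: complex) \<le> 0" for n by simp_all
  note p1 = phi_s_mode_decay[where b=b, OF w(1) b m] phi_s_mode_decay[where b=b, OF w(2) b m]
  note pt = phi_theta_mode_decay[where b=b, OF w(1) b] phi_theta_mode_decay[where b=b, OF w(2) b]
  have p1d: "mode_decay c 0 (K1 * D + 0) (\<lambda>n s. phi_s b m w n s - phi_s b m w' n s)"
    by (rule mode_decay_cong[OF _ phi_s_mode_decay[where b="\<lambda>_. 0", OF d z]]) (rule phi_s_diff[OF w])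
  have ptd: "mode_decay c 0 (K1 * D + 0) (\<lambda>n s. phi_theta b w n s - phi_theta b w' n s)"
    by (rule mode_decay_cong[OF _ phi_theta_mode_decay[where b="\<lambda>_. 0", OF d z(1)]]) (rule phi_theta_diff[OF w])
  have P: "mode_decay c a ?N (\<lambda>n s. conv (phi_s b m w) w n s - conv (phi_s b m w') w' n s)"
  proof (rule mode_decay_cong)
    show "mode_decay c a ?N (\<lambda>n s. conv (phi_s b m w) (\<lambda>n s. w n s - w' n s) n s + conv (\<lambda>n s. phi_s b m w n s - phi_s b m w' n s) w' n s)"
      using mode_decay_add[OF mode_decay_conv[OF cc order.refl a0 p1(1) d] mode_decay_conv[OF cc order.refl a0 p1d w(2)]] by simp
  qed (rule conv_diff[OF cc p1 w, symmetric])
  have Q: "mode_decay c a ?N (\<lambda>n s. conv (phi_theta b w) w n s - conv (phi_theta b w') w' n s)"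
  proof (rule mode_decay_cong)
    show "mode_decay c a ?N (\<lambda>n s. conv (phi_theta b w) (\<lambda>n s. w n s - w' n s) n s + conv (\<lambda>n s. phi_theta b w n s - phi_theta b w' n s) w' n s)"
      using mode_decay_add[OF mode_decay_conv[OF cc order.refl a0 pt(1) d] mode_decay_conv[OF cc order.refl a0 ptd w(2)]] by simp
  qed (rule conv_diff[OF cc pt w, symmetric])
  have zg: "norm (of_int n * (\<lambda>_. 0 :: complex) n) \<le> 0 * wt n" for n by simp
  have "mode_decay c a (KS * ?N + KG * 0) (\<lambda>n s. fix_map mu b m \<gamma> w n s - fix_map mu b m \<gamma> w' n s)"
    unfolding fix_map_def
    by (rule mode_decay_cong[OF _ lin_solve_mode_decay[OF P Q zg]])
      (rule lin_solve_diff[OF source_mode_decay(1)[OF w(1)] source_mode_decay(1)[OF w(2)] source_mode_decay(2)[OF w(1)] source_mode_decay(2)[OF w(2)]])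
  moreover have "KS * ?N + KG * 0 \<le> D / 2"
  proof -
    have "KS * ?N + KG * 0 = KS * (4 * wt_total) * (2 * K1 * M + e) * D" by (simp add: algebra_simps)
    also have "\<dots> \<le> 1/2 * D" using small D by (rule mult_right_mono)
    finally show ?thesis by simp
  qed
  ultimately show ?thesis by (rule mode_decay_mono)
qed

lemma mode_decay_limit:
  assumes w: "\<And>k. mode_decay c a N (w k)" and lim: "\<And>n s. 0 \<le> s \<Longrightarrow> (\<lambda>k. w k n s) \<longlonglongrightarrow> v n s"
    and cont: "\<And>n. continuous_on {0..} (v n)"
  shows "mode_decay c a N v"
  unfolding mode_decay_def exp_decay_def
proof (intro allI conjI impI cont)
  fix n and s :: real assume s: "0 \<le> s"
  show "norm (v n s) \<le> N * wt n * exp (- ((a + c * \<bar>of_int n\<bar>) * s))"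
    by (rule Lim_norm_ubound[OF _ lim[OF s]]) (use exp_decayD[OF mode_decayD[OF w] s] in auto)
qed

text \<open>Picard iteration. The balls of the norm are only predicates here, so the limit is taken
  mode by mode, uniformly in \<open>s\<close>; the bounds pass to the limit pointwise.\<close>

lemma fix_map_fixpoint_exists: "\<exists>w. mode_decay c a M w \<and> (\<forall>n s. 0 \<le> s \<longrightarrow> w n s = fix_map mu b m \<gamma> w n s)"
proof -
  define w where "w k = (fix_map mu b m \<gamma> ^^ k) (\<lambda>_ _. 0)" for k
  have w0: "w 0 n s = 0" and wS: "w (Suc k) = fix_map mu b m \<gamma> (w k)" for k n s by (simp_all add: w_def)
  have z: "mode_decay c a M (\<lambda>_ _. 0)" using M_nonneg wt_pos by (simp add: mode_decay_def exp_decay_def less_imp_le)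
  have wb: "mode_decay c a M (w k)" for k
    by (induction k) (use z fix_map_mode_decay wS in \<open>auto simp: w_def\<close>)
  have wd: "mode_decay c a (2 * M * (1/2) ^ k) (\<lambda>n s. w (Suc k) n s - w k n s)" for k
  proof (induction k)
    case 0
    have "mode_decay c a M (\<lambda>n s. w (Suc 0) n s - w 0 n s)" using wb[of "Suc 0"] by (simp add: w0)
    then have "mode_decay c a (2 * M) (\<lambda>n s. w (Suc 0) n s - w 0 n s)" by (rule mode_decay_mono) (use M_nonneg in simp)
    then show ?case by simp
  next
    case (Suc k)
    from fix_map_contraction[OF wb wb Suc] show ?case by (simp add: wS)
  qed
  define v where "v n s = (\<Sum>i. w (Suc i) n s - w i n s)" for n s
  have ul: "uniform_limit {0..} (\<lambda>k s. w k n s) (v n) sequentially" for n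
  proof -
    have "uniform_limit {0..} (\<lambda>k s. \<Sum>i<k. w (Suc i) n s - w i n s) (\<lambda>s. \<Sum>i. w (Suc i) n s - w i n s) sequentially"
    proof (rule Weierstrass_m_test)
      show "norm (w (Suc i) n s - w i n s) \<le> 2 * M * wt n * (1/2) ^ i" if "s \<in> {0..}" for i s
      proof -
        have "norm (w (Suc i) n s - w i n s) \<le> 2 * M * (1/2) ^ i * wt n * exp (- ((a + c * \<bar>of_int n\<bar>) * s))"
          using exp_decayD[OF mode_decayD[OF wd[of i], of n], of s] that by simp
        also have "\<dots> \<le> 2 * M * (1/2) ^ i * wt n * 1"
          using M_nonneg wt_pos[of n] a2 c0 that by (intro mult_left_mono) auto
        finally show ?thesis by (simp add: mult_ac)
      qed
      show "summable (\<lambda>i. 2 * M * wt n * (1/2 :: real) ^ i)" by (intro summable_mult summable_geometric) simp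
    qed
    moreover have "(\<Sum>i<k. w (Suc i) n s - w i n s) = w k n s" for k s
      using sum_lessThan_telescope[of "\<lambda>i. w i n s" k] by (simp add: w0)
    ultimately show ?thesis by (simp add: v_def[abs_def])
  qed
  have cont: "continuous_on {0..} (v n)" for n
    by (rule uniform_limit_theorem[OF _ ul]) (use exp_decay_cont[OF mode_decayD[OF wb]] in auto)
  have lim: "(\<lambda>k. w k n s) \<longlonglongrightarrow> v n s" if "0 \<le> s" for n s
    using tendsto_uniform_limitI[OF ul, of s n] that by simp
  have v: "mode_decay c a M v" by (rule mode_decay_limit[OF wb lim cont])
  have part: "mode_decay c a (4 * M * (1/2) ^ k) (\<lambda>n s. w (j + k) n s - w k n s)" for j k
  proof -
    have "mode_decay c a (4 * M * (1/2) ^ k * (1 - (1/2) ^ j)) (\<lambda>n s. w (j + k) n s - w k n s)"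
    proof (induction j)
      case 0
      show ?case by (simp add: mode_decay_def exp_decay_def)
    next
      case (Suc j)
      have "mode_decay c a (2 * M * (1/2) ^ (j + k) + 4 * M * (1/2) ^ k * (1 - (1/2) ^ j))
          (\<lambda>n s. (w (Suc (j + k)) n s - w (j + k) n s) + (w (j + k) n s - w k n s))"
        by (rule mode_decay_add[OF wd Suc])
      then show ?case by (simp add: power_add algebra_simps)
    qed
    then show ?thesis by (rule mode_decay_mono) (use M_nonneg in \<open>simp add: mult_left_le\<close>)
  qed
  have tail: "mode_decay c a (4 * M * (1/2) ^ k) (\<lambda>n s. v n s - w k n s)" for k
  proof (rule mode_decay_limit[where w="\<lambda>j n s. w (j + k) n s - w k n s"])
    show "mode_decay c a (4 * M * (1/2) ^ k) (\<lambda>n s. w (j + k) n s - w k n s)" for j by (rule part)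
    show "(\<lambda>j. w (j + k) n s - w k n s) \<longlonglongrightarrow> v n s - w k n s" if "0 \<le> s" for n s
      by (rule tendsto_diff[OF LIMSEQ_ignore_initial_segment[OF lim[OF that]] tendsto_const])
    show "continuous_on {0..} (\<lambda>s. v n s - w k n s)" for n
      by (intro continuous_on_diff cont exp_decay_cont[OF mode_decayD[OF wb]])
  qed
  have "v n s = fix_map mu b m \<gamma> v n s" if s: "0 \<le> s" for n s
  proof -
    have le: "norm (w (Suc k) n s - fix_map mu b m \<gamma> v n s) \<le> (4 * M * wt n * exp (- ((a + c * \<bar>of_int n\<bar>) * s)) / 2) * (1/2) ^ k" for k
      using exp_decayD[OF mode_decayD[OF fix_map_contraction[OF v wb tail[of k]], of n] s] by (simp add: wS norm_minus_commute mult_ac)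
    have "(\<lambda>k. w (Suc k) n s - fix_map mu b m \<gamma> v n s) \<longlonglongrightarrow> 0"
    proof (rule Lim_null_comparison)
      show "\<forall>\<^sub>F k in sequentially. norm (w (Suc k) n s - fix_map mu b m \<gamma> v n s) \<le> (4 * M * wt n * exp (- ((a + c * \<bar>of_int n\<bar>) * s)) / 2) * (1/2) ^ k"
        using le by simp
      show "(\<lambda>k. (4 * M * wt n * exp (- ((a + c * \<bar>of_int n\<bar>) * s)) / 2) * (1/2 :: real) ^ k) \<longlonglongrightarrow> 0"
        by (intro tendsto_mult_right_zero LIMSEQ_power_zero) simp
    qed
    then have "(\<lambda>k. w (Suc k) n s) \<longlonglongrightarrow> fix_map mu b m \<gamma> v n s" by (simp add: LIM_zero_iff)
    moreover have "(\<lambda>k. w (Suc k) n s) \<longlonglongrightarrow> v n s" using lim[OF s, of n] by (rule LIMSEQ_Suc)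
    ultimately show ?thesis by (rule LIMSEQ_unique[OF _ _, symmetric])
  qed
  with v show ?thesis by blast
qed

lemma fix_map_fixpoint_unique:
  assumes w: "mode_decay c a M w" "mode_decay c a M w'"
    and fx: "\<And>n s. 0 \<le> s \<Longrightarrow> w n s = fix_map mu b m \<gamma> w n s" "\<And>n s. 0 \<le> s \<Longrightarrow> w' n s = fix_map mu b m \<gamma> w' n s"
    and s: "0 \<le> s"
  shows "w n s = w' n s"
proof -
  have "mode_decay c a ((2 * M) * (1/2) ^ k) (\<lambda>n s. w n s - w' n s)" for k
  proof (induction k)
    case 0
    have "mode_decay c a (M + M) (\<lambda>n s. w n s - w' n s)" unfolding mode_decay_def
    proof
      fix n show "exp_decay (a + c * \<bar>of_int n\<bar>) ((M + M) * wt n) (\<lambda>s. w n s - w' n s)"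
        unfolding distrib_right by (rule exp_decay_diff[OF mode_decayD[OF w(1)] mode_decayD[OF w(2)]])
    qed
    then show ?case by simp
  next
    case (Suc k)
    from fix_map_contraction[OF w Suc] have "mode_decay c a (2 * M * (1/2) ^ k / 2) (\<lambda>n s. w n s - w' n s)"
      by (rule mode_decay_cong[rotated]) (use fx in auto)
    then show ?case by simp
  qed
  note all = this
  have le: "norm (w n s - w' n s) \<le> (2 * M * wt n * exp (- ((a + c * \<bar>of_int n\<bar>) * s))) * (1/2) ^ k" for k
    using exp_decayD[OF mode_decayD[OF all[of k], of n] s] by (simp add: mult_ac)
  have "(\<lambda>k. (2 * M * wt n * exp (- ((a + c * \<bar>of_int n\<bar>) * s))) * (1/2 :: real) ^ k) \<longlonglongrightarrow> (2 * M * wt n * exp (- ((a + c * \<bar>of_int n\<bar>) * s))) * 0"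
    by (intro tendsto_mult tendsto_const LIMSEQ_power_zero) simp
  then have "norm (w n s - w' n s) \<le> (2 * M * wt n * exp (- ((a + c * \<bar>of_int n\<bar>) * s))) * 0"
    by (rule LIMSEQ_le_const) (use le in blast)
  then show ?thesis by simp
qed

end

end

section \<open>Reality of the mode families\<close>

text \<open>The modes of the complex conjugate field. All operators commute with this reflection,
  because conjugation exchanges \<open>\<zeta>_n\<close> and \<open>\<zeta>_(-n)\<close>.\<close>

definition conj_fam :: "modes \<Rightarrow> modes" where
  "conj_fam f n s = cnj (f (- n) s)"

lemma conj_famD:
  assumes "conj_fam f = f"
  shows "f (- n) s = cnj (f n s)"
proof -
  have "conj_fam f (- n) s = f (- n) s" by (simp only: assms)
  then show ?thesis unfolding conj_fam_def minus_minus by (rule sym)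
qed

lemma conj_fam_conv: "conv (conj_fam f) (conj_fam g) n s = conj_fam (conv f g) n s"
proof -
  have "conj_fam (conv f g) n s = (\<Sum>\<^sub>\<infinity>k. (\<lambda>k. cnj (f (- k) s) * cnj (g (- n + k) s)) (- k))"
    unfolding conj_fam_def conv_def by (simp flip: infsum_cnj)
  also have "\<dots> = (\<Sum>\<^sub>\<infinity>k. cnj (f (- k) s) * cnj (g (- n + k) s))" by (rule infsum_shift_int(4))
  finally show ?thesis unfolding conj_fam_def conv_def by (simp add: algebra_simps)
qed

lemma conj_fam_phi_plus: "phi_plus (conj_fam w) n s = conj_fam (phi_plus w) n s"
proof -
  have "backward (cnj (of_int \<bar>n\<bar>)) (\<lambda>t. cnj (of_real (exp (2 * t)) * w (- n) t)) s = cnj (backward (of_int \<bar>n\<bar>) (\<lambda>t. of_real (exp (2 * t)) * w (- n) t) s)"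
    by (rule backward_cnj)
  then show ?thesis by (simp add: phi_plus_def conj_fam_def)
qed

lemma conj_fam_phi: 
  assumes "\<And>n. b (- n) = cnj (b n)"
  shows "phi b (conj_fam w) n s = conj_fam (phi b w) n s"
proof -
  have "forward (cnj (of_int \<bar>n\<bar>)) (\<lambda>t. cnj (phi_plus w (- n) t)) s = cnj (forward (of_int \<bar>n\<bar>) (phi_plus w (- n)) s)"
    by (rule forward_cnj)
  moreover have "phi_plus (conj_fam w) n = (\<lambda>t. cnj (phi_plus w (- n) t))" by (simp add: fun_eq_iff conj_fam_phi_plus) (simp add: conj_fam_def)
  ultimately show ?thesis using assms by (simp add: phi_def conj_fam_def exp_cnj)
qed

lemma conj_fam_phi_s:
  assumes "\<And>n. b (- n) = cnj (b n)" "cnj m = m"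
  shows "phi_s b m (conj_fam w) = conj_fam (phi_s b m w)"
  unfolding fun_eq_iff phi_s_def conj_fam_phi[where b=b, OF assms(1)] conj_fam_phi_plus using assms by (simp add: conj_fam_def phi_s_def)

lemma conj_fam_phi_theta:
  assumes "\<And>n. b (- n) = cnj (b n)"
  shows "phi_theta b (conj_fam w) = conj_fam (phi_theta b w)"
  unfolding fun_eq_iff phi_theta_def conj_fam_phi[where b=b, OF assms] by (simp add: conj_fam_def phi_theta_def)

lemma conj_fam_lin_particular:
  assumes "mu \<noteq> 0" "n \<noteq> 0"
  shows "lin_particular mu (conj_fam P) (conj_fam Q) n s = conj_fam (lin_particular mu P Q) n s"
proof -
  have z: "zeta mu n = cnj (zeta mu (- n))" using zeta_minus[of "- n" mu] assms by simp
  have 1: "backward (zeta mu n) (\<lambda>t. \<i> * of_int n * conj_fam P n t - zeta mu n * conj_fam Q n t) s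
    = cnj (backward (zeta mu (- n)) (\<lambda>t. \<i> * of_int (- n) * P (- n) t - zeta mu (- n) * Q (- n) t) s)"
    unfolding backward_cnj[symmetric] by (simp add: z conj_fam_def)
  have 2: "forward (zeta mu n) (\<lambda>t. \<i> * of_int n * conj_fam P n t + zeta mu n * conj_fam Q n t) s
    = cnj (forward (zeta mu (- n)) (\<lambda>t. \<i> * of_int (- n) * P (- n) t + zeta mu (- n) * Q (- n) t) s)"
    unfolding forward_cnj[symmetric] by (simp add: z conj_fam_def add.commute)
  show ?thesis unfolding lin_particular_def 1 2 unfolding z by (simp add: conj_fam_def lin_particular_def)
qed

lemma conj_fam_lin_solve:
  assumes "mu \<noteq> 0" "\<And>n. \<gamma> (- n) = cnj (\<gamma> n)"
  shows "lin_solve mu \<gamma> (conj_fam P) (conj_fam Q) n s = conj_fam (lin_solve mu \<gamma> P Q) n s"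
proof (cases "n = 0")
  case True
  have "backward (cnj 0) (\<lambda>t. cnj (Q 0 t)) s = cnj (backward 0 (Q 0) s)" by (rule backward_cnj)
  then show ?thesis using True by (simp add: lin_solve_def conj_fam_def[abs_def])
next
  case False
  have z: "zeta mu n = cnj (zeta mu (- n))" using zeta_minus[of "- n" mu] assms False by simp
  have "phi_plus (lin_particular mu (conj_fam P) (conj_fam Q)) n 0 = phi_plus (conj_fam (lin_particular mu P Q)) n 0"
    unfolding phi_plus_def by (simp add: conj_fam_lin_particular[OF assms(1) False])
  then have g: "phi_plus (lin_particular mu (conj_fam P) (conj_fam Q)) n 0 = cnj (phi_plus (lin_particular mu P Q) (- n) 0)"
    unfolding conj_fam_phi_plus by (simp add: conj_fam_def)
  show ?thesis using False assms(2)[of n] unfolding lin_solve_def g conj_fam_lin_particular[OF assms(1) False] conj_fam_def z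
    by (simp add: exp_cnj)
qed

lemma conj_fam_fix_map:
  assumes "mu \<noteq> 0" "\<And>n. \<gamma> (- n) = cnj (\<gamma> n)" "\<And>n. b (- n) = cnj (b n)" "cnj m = m"
  shows "fix_map mu b m \<gamma> (conj_fam w) n s = conj_fam (fix_map mu b m \<gamma> w) n s"
proof -
  have 1: "conv (phi_s b m (conj_fam w)) (conj_fam w) = conj_fam (conv (phi_s b m w) w)"
    unfolding conj_fam_phi_s[where b=b, OF assms(3,4)] by (simp add: fun_eq_iff conj_fam_conv)
  have 2: "conv (phi_theta b (conj_fam w)) (conj_fam w) = conj_fam (conv (phi_theta b w) w)"
    unfolding conj_fam_phi_theta[where b=b, OF assms(3)] by (simp add: fun_eq_iff conj_fam_conv)
  show ?thesis unfolding fix_map_def 1 2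
    using conj_fam_lin_solve[where \<gamma>=\<gamma>, OF assms(1,2)] by (simp add: conj_fam_def)
qed

lemma conj_fam_mode_decay: "mode_decay c \<beta> M w \<Longrightarrow> mode_decay c \<beta> M (conj_fam w)"
  unfolding mode_decay_def exp_decay_def conj_fam_def
proof (intro allI conjI impI)
  fix n assume *: "\<forall>n. continuous_on {0..} (w n) \<and> (\<forall>t\<ge>0. norm (w n t) \<le> M * wt n * exp (- ((\<beta> + c * \<bar>of_int n\<bar>) * t)))"
  show "continuous_on {0..} (\<lambda>s. cnj (w (- n) s))" using * by (intro continuous_intros) auto
  show "norm (cnj (w (- n) t)) \<le> M * wt n * exp (- ((\<beta> + c * \<bar>of_int n\<bar>) * t))" if "t \<ge> 0" for t
    using *[rule_format, of "- n"] that by simp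
qed

section \<open>From the fixed point to the mode system\<close>

context swirl
begin

context
  fixes b \<gamma> :: "int \<Rightarrow> complex" and m :: complex and e M :: real
  assumes b: "\<And>n. norm (of_int n * b n) \<le> e * wt n" and m: "norm m \<le> e"
    and g: "\<And>n. norm (of_int n * \<gamma> n) \<le> e * wt n"
    and small: "KS * (4 * wt_total) * (2 * K1 * M + e) \<le> 1 / 2" and Me: "2 * KG * e \<le> M"
    and bc: "\<And>n. b (- n) = cnj (b n)" and mc: "cnj m = m" and gc: "\<And>n. \<gamma> (- n) = cnj (\<gamma> n)"
begin

lemma fix_map_cong:
  assumes w: "mode_decay c a M w" "mode_decay c a M w'" and eq: "\<And>n s. 0 \<le> s \<Longrightarrow> w n s = w' n s" and s: "0 \<le> s"
  shows "fix_map mu b m \<gamma> w n s = fix_map mu b m \<gamma> w' n s"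
proof -
  have "mode_decay c a 0 (\<lambda>n s. w n s - w' n s)" unfolding mode_decay_def exp_decay_def
  proof (intro allI conjI impI)
    fix n
    show "continuous_on {0..} (\<lambda>s. w n s - w' n s)"
      by (intro continuous_on_diff exp_decay_cont[OF mode_decayD[OF w(1)]] exp_decay_cont[OF mode_decayD[OF w(2)]])
  qed (use eq in auto)
  from fix_map_contraction[OF b m g small Me w this] have "mode_decay c a (0 / 2) (\<lambda>n s. fix_map mu b m \<gamma> w n s - fix_map mu b m \<gamma> w' n s)" .
  from exp_decayD[OF mode_decayD[OF this, of n] s] show ?thesis by simp
qed

text
  \<open>For real data the reflected family is again a fixed point in the same ball, so uniqueness makes the fixed point equal to its reflection.\<close>

lemma real_fixpoint_exists:
  "\<exists>w. mode_decay c a M w \<and> (\<forall>n s. 0 \<le> s \<longrightarrow> w n s = fix_map mu b m \<gamma> w n s) \<and> conj_fam w = w"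
proof -
  obtain w where w: "mode_decay c a M w" and fx: "\<And>n s. 0 \<le> s \<Longrightarrow> w n s = fix_map mu b m \<gamma> w n s"
    using fix_map_fixpoint_exists[OF b m g small Me] by blast
  \<comment> \<open>The fixed point equation only concerns \<open>s \<ge> 0\<close>. Constant continuation to the left turns the
    symmetry on the half-line into an equality of functions.\<close>
  define w' where "w' n s = w n (max 0 s)" for n s
  have eq: "w n s = w' n s" if "0 \<le> s" for n s using that by (simp add: w'_def max_absorb2)
  have w': "mode_decay c a M w'" by (rule mode_decay_cong[OF eq w])
  have fx': "w' n s = fix_map mu b m \<gamma> w' n s" if "0 \<le> s" for n s
    using fx[OF that, of n] eq[OF that, of n] fix_map_cong[OF w w' eq that, of n] by simp
  have fxc: "conj_fam w' n s = fix_map mu b m \<gamma> (conj_fam w') n s" if "0 \<le> s" for n s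
    unfolding conj_fam_fix_map[where \<gamma>=\<gamma> and b=b, OF mu0 gc bc mc] using fx'[OF that, of "- n"] by (simp add: conj_fam_def)
  have un: "conj_fam w' n s = w' n s" if "0 \<le> s" for n s
    by (rule fix_map_fixpoint_unique[OF b m g small Me conj_fam_mode_decay[OF w'] w' fxc fx' that])
  have "conj_fam w' n s = w' n s" for n s
    using un[of "max 0 s" n] by (simp add: conj_fam_def w'_def)
  then show ?thesis using w' fx' by (intro exI[of _ w']) (simp add: fun_eq_iff)
qed

text \<open>From here on \<open>w\<close> is the real fixed point.\<close>

context
  fixes w
  assumes w: "mode_decay c a M w" and fx: "\<And>n s. 0 \<le> s \<Longrightarrow> w n s = fix_map mu b m \<gamma> w n s" and wc: "conj_fam w = w"
begin

abbreviation "P \<equiv> conv (phi_s b m w) w"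
abbreviation "Q \<equiv> conv (phi_theta b w) w"
abbreviation "NN \<equiv> 4 * wt_total * (K1 * M + e) * M"

lemmas PQ = source_mode_decay[OF b m g small Me w]

text \<open>The full stream function \<open>psi\<close> adds the swirl to \<open>\<phi>\<close>, and \<open>psi_s\<close> is its derivative. The
  mode \<open>0\<close> is determined by the velocity only up to a constant; it is normalised to vanish on
  the circle.\<close>

definition psi_s :: "modes" where
  "psi_s n s = phi_s b m w n s + (if n = 0 then of_real mu else 0)"

definition psi :: "modes" where
  "psi n s = (if n = 0 then integral {0..s} (psi_s 0) else phi b w n s)"

text \<open>For \<open>n \<noteq> 0\<close> this is \<open>w' + Q\<close>, expressed without derivatives so that it can be
  differentiated. It equals \<open>i n H\<close>, which defines the total head in these modes; the mode \<open>0\<close>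
  of the head is fixed by its derivative.\<close>

definition chi :: "modes" where
  "chi n s = - backward (zeta mu n) (\<lambda>t. \<i> * of_int n * P n t - zeta mu n * Q n t) s - zeta mu n * w n s"

definition head :: "modes" where
  "head n s = (if n = 0 then integral {0..s} (conv psi_s w 0) else - \<i> * chi n s / of_int n)"

lemma w_nonzero:
  assumes "n \<noteq> 0" "0 \<le> s"
  shows "w n s = lin_particular mu P Q n s - (zeta mu n + of_int \<bar>n\<bar> - 2) * (\<gamma> n - phi_plus (lin_particular mu P Q) n 0) * exp (- (zeta mu n * of_real s))"
  using fx[OF assms(2), of n] assms(1) by (simp add: fix_map_def lin_solve_def)

lemma w_zero: "0 \<le> s \<Longrightarrow> w 0 s = backward 0 (Q 0) s"
  using fx[of s 0] by (simp add: fix_map_def lin_solve_def)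

lemma cont_w: "continuous_on {0..} (w n)" by (rule exp_decay_cont[OF mode_decayD[OF w]])
lemma cont_P: "continuous_on {0..} (P n)" by (rule exp_decay_cont[OF mode_decayD[OF PQ(1)]])
lemma cont_phi_s: "continuous_on {0..} (phi_s b m w n)"
  by (rule exp_decay_cont[OF mode_decayD[OF phi_s_mode_decay[where b=b, OF w b m]]])
lemma cont_psi_s: "continuous_on {0..} (psi_s n)"
  unfolding psi_s_def[abs_def] by (intro continuous_intros cont_phi_s)

text \<open>Convolution with the swirl is multiplication by its strength. This is the term that
  turns \<open>n^2\<close> into \<open>\<zeta>^2 = n^2 + i \<mu>\<^sub>0 n\<close>.\<close>

lemma conv_psi_s:
  assumes "0 \<le> s"
  shows "conv psi_s w n s = P n s + of_real mu * w n s"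
proof -
  note sm = mode_decay_conv_summable[OF less_imp_le[OF c0] phi_s_mode_decay[where b=b, OF w b m] w assms, of n]
  have d: "(if k = 0 then of_real mu else 0) * w (n - k) s = (if k = 0 then of_real mu * w n s else 0)" for k
    by simp
  have hs: "((\<lambda>k. if k = 0 then of_real mu * w n s else 0) has_sum of_real mu * w n s) (UNIV :: int set)"
    using has_sum_finite_neutralI[of "{0::int}" UNIV "\<lambda>k. if k = 0 then of_real mu * w n s else 0"] by simp
  have "conv psi_s w n s = (\<Sum>\<^sub>\<infinity>k. phi_s b m w k s * w (n - k) s + (if k = 0 then of_real mu else 0) * w (n - k) s)"
    unfolding conv_def psi_s_def by (simp add: distrib_right)
  also have "\<dots> = P n s + of_real mu * w n s"
    unfolding d using infsum_add[OF sm has_sum_imp_summable[OF hs]] infsumI[OF hs] by (simp add: conv_def)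
  finally show ?thesis .
qed

lemma cont_conv_psi_s: "continuous_on {0..} (conv psi_s w n)"
  by (rule continuous_on_cong[THEN iffD1, OF refl _ continuous_on_add[OF cont_P continuous_on_mult_left[OF cont_w]]])
    (simp add: conv_psi_s)

lemma deriv_psi: "fam_deriv psi psi_s"
  unfolding fam_deriv_def
proof (intro allI impI)
  fix n :: int and s :: real assume s: "0 < s"
  show "(psi n has_vector_derivative psi_s n s) (at s)"
  proof (rule at_of_within_0[OF _ s], cases "n = 0")
    case True
    show "(psi n has_vector_derivative psi_s n s) (at s within {0..})"
      using integral_0_has_vector_derivative[OF cont_psi_s less_imp_le[OF s], of 0] True by (simp add: psi_def[abs_def])
  next
    case False
    have e: "((\<lambda>s. b n * exp (- of_int \<bar>n\<bar> * of_real s)) has_vector_derivative b n * (- of_int \<bar>n\<bar> * exp (- of_int \<bar>n\<bar> * of_real s))) (at s within {0..})"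
      by (rule has_vector_derivative_mult_right[OF exp_has_vector_derivative_within])
    have "((\<lambda>s. forward (of_int \<bar>n\<bar>) (phi_plus w n) s + b n * exp (- of_int \<bar>n\<bar> * of_real s)) has_vector_derivative
      (phi_plus w n s - of_int \<bar>n\<bar> * forward (of_int \<bar>n\<bar>) (phi_plus w n) s) + b n * (- of_int \<bar>n\<bar> * exp (- of_int \<bar>n\<bar> * of_real s))) (at s within {0..})"
      by (rule has_vector_derivative_add[OF has_vector_derivative_forward[OF exp_decay_cont[OF phi_plus_exp_decay[OF w]] less_imp_le[OF s]] e])
    moreover have "(phi_plus w n s - of_int \<bar>n\<bar> * forward (of_int \<bar>n\<bar>) (phi_plus w n) s) + b n * (- of_int \<bar>n\<bar> * exp (- of_int \<bar>n\<bar> * of_real s)) = psi_s n s"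
      using False by (simp add: psi_s_def phi_s_def phi_def algebra_simps)
    ultimately show "(psi n has_vector_derivative psi_s n s) (at s within {0..})"
      using False by (simp add: psi_def[abs_def] phi_def)
  qed
qed

lemma deriv_phi_plus: "0 \<le> s \<Longrightarrow> (phi_plus w n has_vector_derivative of_int \<bar>n\<bar> * phi_plus w n s + of_real (exp (2 * s)) * w n s) (at s within {0..})"
  using has_vector_derivative_minus[OF has_vector_derivative_backward[OF e2_exp_decay[OF w], of n "of_int \<bar>n\<bar>" s]] rate_pos[of n]
  by (simp add: phi_plus_def[abs_def] algebra_simps)

lemma deriv_psi_s: "fam_deriv psi_s (\<lambda>n s. of_int n * (of_int n * psi n s) + of_real (exp (2 * s)) * w n s)"
  unfolding fam_deriv_def
proof (intro allI impI)
  fix n :: int and s :: real assume s: "0 < s"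
  have g: "(phi_plus w n has_vector_derivative of_int \<bar>n\<bar> * phi_plus w n s + of_real (exp (2 * s)) * w n s) (at s)"
    by (rule at_of_within_0[OF deriv_phi_plus[OF less_imp_le[OF s]] s])
  show "(psi_s n has_vector_derivative of_int n * (of_int n * psi n s) + of_real (exp (2 * s)) * w n s) (at s)"
  proof (cases "n = 0")
    case True
    have "((\<lambda>s. phi_plus w 0 s + (m - phi_plus w 0 0 + of_real mu)) has_vector_derivative of_real (exp (2 * s)) * w 0 s + 0) (at s)"
      using has_vector_derivative_add[OF g has_vector_derivative_const] True by simp
    then show ?thesis using True by (simp add: psi_s_def[abs_def] phi_s_def add.assoc)
  next
    case False
    have "(psi n has_vector_derivative psi_s n s) (at s)" using deriv_psi s unfolding fam_deriv_def by blast
    then have "(phi b w n has_vector_derivative phi_s b m w n s) (at s)" using False by (simp add: psi_def[abs_def] psi_s_def)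
    from has_vector_derivative_diff[OF g has_vector_derivative_mult_right[OF this, of "of_int \<bar>n\<bar>"]]
    have "((\<lambda>s. phi_plus w n s - of_int \<bar>n\<bar> * phi b w n s) has_vector_derivative
       of_int \<bar>n\<bar> * phi_plus w n s + of_real (exp (2 * s)) * w n s - of_int \<bar>n\<bar> * phi_s b m w n s) (at s)" .
    moreover have "of_int \<bar>n\<bar> * phi_plus w n s + of_real (exp (2 * s)) * w n s - of_int \<bar>n\<bar> * phi_s b m w n s
      = of_int n * (of_int n * psi n s) + of_real (exp (2 * s)) * w n s"
    proof -
      have "(of_int \<bar>n\<bar> * of_int \<bar>n\<bar> :: complex) = of_int n * of_int n" by (simp flip: of_int_mult)
      then show ?thesis using False by (simp add: psi_def phi_s_def right_diff_distrib flip: mult.assoc)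
    qed
    ultimately have "((\<lambda>s. phi_plus w n s - of_int \<bar>n\<bar> * phi b w n s) has_vector_derivative
       of_int n * (of_int n * psi n s) + of_real (exp (2 * s)) * w n s) (at s)" by (simp only:)
    then show ?thesis using False by (simp add: psi_s_def[abs_def] phi_s_def)
  qed
qed

lemma Q_psi: "conv (\<lambda>n s. of_int n * psi n s) w n s = - \<i> * Q n s"
proof -
  have "phi_theta b w k s = \<i> * (of_int k * psi k s)" for k by (simp add: phi_theta_def psi_def)
  then have "Q n s = (\<Sum>\<^sub>\<infinity>k. \<i> * (of_int k * psi k s * w (n - k) s))" by (simp add: conv_def mult.assoc)
  also have "\<dots> = \<i> * conv (\<lambda>n s. of_int n * psi n s) w n s" unfolding conv_def by (rule infsum_cmult_right')
  finally show ?thesis by simp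
qed

lemma rate_backward: "n \<noteq> 0 \<Longrightarrow> 0 < a + c * \<bar>real_of_int n\<bar> + Re (zeta mu n)"
  using rate_lt(3)[of n] mult_pos_pos[OF c0, of "\<bar>real_of_int n\<bar>"] by simp

lemma deriv_w_nonzero:
  assumes n: "n \<noteq> 0" and s: "0 \<le> s"
  shows "(w n has_vector_derivative chi n s - Q n s) (at s within {0..})"
    "(chi n has_vector_derivative \<i> * of_int n * P n s + (of_int n * of_int n + \<i> * of_real mu * of_int n) * w n s) (at s within {0..})"
proof -
  let ?z = "zeta mu n"
  have z: "?z \<noteq> 0" by (rule zeta_ne0[OF n])
  let ?fm = "\<lambda>t. \<i> * of_int n * P n t - ?z * Q n t" let ?fp = "\<lambda>t. \<i> * of_int n * P n t + ?z * Q n t"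
  let ?Y = "(?z + of_int \<bar>n\<bar> - 2) * (\<gamma> n - phi_plus (lin_particular mu P Q) n 0)"
  have dB: "(backward ?z ?fm has_vector_derivative ?z * backward ?z ?fm s - ?fm s) (at s within {0..})"
    by (rule has_vector_derivative_backward[OF source_exp_decay(1)[OF PQ] rate_backward[OF n] s])
  have dF: "(forward ?z ?fp has_vector_derivative ?fp s - ?z * forward ?z ?fp s) (at s within {0..})"
    by (rule has_vector_derivative_forward[OF exp_decay_cont[OF source_exp_decay(2)[OF PQ]] s])
  have dE: "((\<lambda>s. ?Y * exp (- ?z * of_real s)) has_vector_derivative ?Y * (- ?z * exp (- ?z * of_real s))) (at s within {0..})"
    by (rule has_vector_derivative_mult_right[OF exp_has_vector_derivative_within])
  have wf: "w n t = - 1 / (2 * ?z) * (backward ?z ?fm t + forward ?z ?fp t) - ?Y * exp (- ?z * of_real t)" if "0 \<le> t" for t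
    using w_nonzero[OF n that] by (simp add: lin_particular_def)
  have "((\<lambda>t. - 1 / (2 * ?z) * (backward ?z ?fm t + forward ?z ?fp t) - ?Y * exp (- ?z * of_real t)) has_vector_derivative
      - 1 / (2 * ?z) * ((?z * backward ?z ?fm s - ?fm s) + (?fp s - ?z * forward ?z ?fp s)) - ?Y * (- ?z * exp (- ?z * of_real s))) (at s within {0..})"
    by (rule has_vector_derivative_diff[OF has_vector_derivative_mult_right[OF has_vector_derivative_add[OF dB dF]] dE])
  then have "(w n has_vector_derivative
      - 1 / (2 * ?z) * ((?z * backward ?z ?fm s - ?fm s) + (?fp s - ?z * forward ?z ?fp s)) - ?Y * (- ?z * exp (- ?z * of_real s))) (at s within {0..})"
    by (rule has_vector_derivative_transform[rotated 2]) (use s wf in \<open>auto simp only: atLeast_iff\<close>)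
  moreover have "- 1 / (2 * ?z) * ((?z * backward ?z ?fm s - ?fm s) + (?fp s - ?z * forward ?z ?fp s)) - ?Y * (- ?z * exp (- ?z * of_real s)) = chi n s - Q n s"
  proof -
    define B F E Y where "B = backward ?z ?fm s" and "F = forward ?z ?fp s" and "E = exp (- ?z * of_real s)" and "Y = ?Y"
    show ?thesis unfolding chi_def wf[OF s] B_def[symmetric] F_def[symmetric] E_def[symmetric] Y_def[symmetric]
      using z by (simp add: field_simps)
  qed
  ultimately show dw: "(w n has_vector_derivative chi n s - Q n s) (at s within {0..})" by simp
  have "((\<lambda>s. - backward ?z ?fm s - ?z * w n s) has_vector_derivative - (?z * backward ?z ?fm s - ?fm s) - ?z * (chi n s - Q n s)) (at s within {0..})"
    by (intro has_vector_derivative_diff has_vector_derivative_minus has_vector_derivative_mult_right dB dw)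
  moreover have "- (?z * backward ?z ?fm s - ?fm s) - ?z * (chi n s - Q n s) = \<i> * of_int n * P n s + (?z * ?z) * w n s"
    unfolding chi_def by (simp add: algebra_simps)
  ultimately show "(chi n has_vector_derivative \<i> * of_int n * P n s + (of_int n * of_int n + \<i> * of_real mu * of_int n) * w n s) (at s within {0..})"
    unfolding zeta_sq chi_def[abs_def] by (simp only:)
qed

lemma deriv_w: "fam_deriv w (\<lambda>n s. \<i> * (of_int n * head n s) + (- \<i>) * conv (\<lambda>n s. of_int n * psi n s) w n s)"
  unfolding fam_deriv_def
proof (intro allI impI)
  fix n :: int and s :: real assume s: "0 < s"
  show "(w n has_vector_derivative \<i> * (of_int n * head n s) + (- \<i>) * conv (\<lambda>n s. of_int n * psi n s) w n s) (at s)"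
  proof (rule at_of_within_0[OF _ s], cases "n = 0")
    case True
    have "(backward 0 (Q 0) has_vector_derivative 0 * backward 0 (Q 0) s - Q 0 s) (at s within {0..})"
      by (rule has_vector_derivative_backward[OF mode_decayD[OF PQ(2)]]) (use a2 s in auto)
    then have "(w 0 has_vector_derivative 0 * backward 0 (Q 0) s - Q 0 s) (at s within {0..})"
      by (rule has_vector_derivative_transform[rotated 2]) (use s w_zero in \<open>auto simp only: atLeast_iff\<close>)
    then show "(w n has_vector_derivative \<i> * (of_int n * head n s) + (- \<i>) * conv (\<lambda>n s. of_int n * psi n s) w n s) (at s within {0..})"
      unfolding Q_psi using True by simp
  next
    case False
    show "(w n has_vector_derivative \<i> * (of_int n * head n s) + (- \<i>) * conv (\<lambda>n s. of_int n * psi n s) w n s) (at s within {0..})"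
      unfolding Q_psi using deriv_w_nonzero(1)[OF False less_imp_le[OF s]] False by (simp add: head_def)
  qed
qed

lemma deriv_head: "fam_deriv head (\<lambda>n s. (- \<i>) * (of_int n * w n s) + conv psi_s w n s)"
  unfolding fam_deriv_def
proof (intro allI impI)
  fix n :: int and s :: real assume s: "0 < s"
  show "(head n has_vector_derivative (- \<i>) * (of_int n * w n s) + conv psi_s w n s) (at s)"
  proof (rule at_of_within_0[OF _ s], cases "n = 0")
    case True
    then show "(head n has_vector_derivative (- \<i>) * (of_int n * w n s) + conv psi_s w n s) (at s within {0..})"
      using integral_0_has_vector_derivative[OF cont_conv_psi_s less_imp_le[OF s], of 0] by (simp add: head_def[abs_def])
  next
    case False
    have "((\<lambda>s. (- \<i> / of_int n) * chi n s) has_vector_derivative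
       (- \<i> / of_int n) * (\<i> * of_int n * P n s + (of_int n * of_int n + \<i> * of_real mu * of_int n) * w n s)) (at s within {0..})"
      by (rule has_vector_derivative_mult_right[OF deriv_w_nonzero(2)[OF False less_imp_le[OF s]]])
    moreover have "(- \<i> / of_int n) * (\<i> * of_int n * P n s + (of_int n * of_int n + \<i> * of_real mu * of_int n) * w n s)
      = (- \<i>) * (of_int n * w n s) + conv psi_s w n s"
      unfolding conv_psi_s[OF less_imp_le[OF s]] using False by (simp add: field_simps)
    ultimately show "(head n has_vector_derivative (- \<i>) * (of_int n * w n s) + conv psi_s w n s) (at s within {0..})"
      using False by (simp add: head_def[abs_def])
  qed
qed

lemma weighted_bound:
  assumes "exp_decay (\<beta> + c * \<bar>of_int n\<bar>) (C * wt n) f" "0 \<le> \<beta>" "0 \<le> s"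
  shows "norm (f s) \<le> C * exp (- (c * \<bar>of_int n\<bar> * s))" "norm (f s) \<le> C * wt n * exp (- (\<beta> * s))"
proof -
  have C: "0 \<le> C * wt n" using exp_decay_nonneg[OF assms(1)] .
  then have C0: "0 \<le> C" using wt_pos[of n] by (simp add: zero_le_mult_iff)
  have "norm (f s) \<le> C * wt n * exp (- ((\<beta> + c * \<bar>of_int n\<bar>) * s))" by (rule exp_decayD[OF assms(1,3)])
  also have "\<dots> \<le> C * 1 * exp (- (c * \<bar>of_int n\<bar> * s))"
    using C0 wt_le1[of n] wt_pos[of n] assms(2,3) by (intro mult_mono mult_left_mono) (auto simp: distrib_right)
  finally show "norm (f s) \<le> C * exp (- (c * \<bar>of_int n\<bar> * s))" by simp
  have "norm (f s) \<le> C * wt n * exp (- ((\<beta> + c * \<bar>of_int n\<bar>) * s))" by (rule exp_decayD[OF assms(1,3)])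
  also have "\<dots> \<le> C * wt n * exp (- (\<beta> * s))"
    using C c0 assms(3) by (intro mult_left_mono) (auto simp: distrib_right)
  finally show "norm (f s) \<le> C * wt n * exp (- (\<beta> * s))" .
qed

lemma norm_le_index: "n \<noteq> 0 \<Longrightarrow> norm (x :: complex) \<le> norm (of_int n * x)"
  using mult_right_mono[OF abs_int_ge1, of n "norm x"] by (simp add: norm_mult)

lemma norm_phi_theta: "norm (phi_theta b w n s) = norm (of_int n * psi n s)"
  by (simp add: phi_theta_def psi_def norm_mult)

lemma psi_decay:
  assumes n: "n \<noteq> 0" and s: "0 \<le> s"
  shows "norm (of_int n * psi n s) \<le> (K1 * M + e) * wt n * exp (- ((a - 2) * s))"
    "norm (psi_s n s) \<le> (K1 * M + e) * wt n * exp (- ((a - 2) * s))"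
  using weighted_bound(2)[OF phi_theta_exp_decay[where b=b and n=n, OF w b n] _ s] norm_phi_theta[of n s]
    weighted_bound(2)[OF phi_s_exp_decay[where b=b and n=n and m=m, OF w b n] _ s] a2 n by (auto simp: psi_s_def)

lemma psi_s_0_decay:
  assumes s: "0 \<le> s"
  shows "norm (psi_s 0 s - (of_real mu + m - phi_plus w 0 0)) \<le> M / (a - 2) * exp (- ((a - 2) * s))"
  using exp_decayD[OF phi_plus_exp_decay[OF w, of 0] s] by (simp add: psi_s_def phi_s_def wt_def)

lemma phi_plus_0_bound: "norm (phi_plus w 0 0) \<le> M / (a - 2)"
  using exp_decayD[OF phi_plus_exp_decay[OF w, of 0], of 0] by (simp add: wt_def)

lemma rapid_psi: "rapid psi"
proof (rule rapidI_exp[OF c0])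
  show "norm (psi n s) \<le> (K1 * M + e) * exp (- (c * \<bar>of_int n\<bar> * s))" if n: "n \<noteq> 0" and s: "0 \<le> s" for n s
    using weighted_bound(1)[OF phi_theta_exp_decay[where b=b and n=n, OF w b n] _ s] norm_phi_theta[of n s] norm_le_index[OF n, of "psi n s"] a2 by simp
  show "continuous_on {0..} (psi 0)"
    by (rule continuous_on_vector_derivative) (use integral_0_has_vector_derivative[OF cont_psi_s, of _ 0] in \<open>auto simp: psi_def[abs_def]\<close>)
qed

lemma rapid_psi_s: "rapid psi_s"
proof (rule rapidI_exp[OF c0 _ cont_psi_s])
  show "norm (psi_s n s) \<le> (K1 * M + e) * exp (- (c * \<bar>of_int n\<bar> * s))" if n: "n \<noteq> 0" and s: "0 \<le> s" for n s
    using weighted_bound(1)[OF phi_s_exp_decay[where b=b and n=n and m=m, OF w b n] _ s] a2 n by (simp add: psi_s_def)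
qed

lemma rapid_w: "rapid w"
proof (rule rapidI_exp[OF c0 _ cont_w])
  show "norm (w n s) \<le> M * exp (- (c * \<bar>of_int n\<bar> * s))" if s: "0 \<le> s" for n s
    using weighted_bound(1)[OF mode_decayD[OF w] _ s] a2 by simp
qed

lemma rapid_head: "rapid head"
proof (rule rapidI_exp[OF c0])
  fix n :: int and s :: real assume n: "n \<noteq> 0" and s: "0 \<le> s"
  let ?n = "\<bar>real_of_int n\<bar>"
  have n1: "1 \<le> ?n" by (rule abs_int_ge1[OF n])
  have N: "0 \<le> NN" using mode_decay_nonneg[OF PQ(1)] .
  have cn: "0 \<le> c * ?n" using c0 by simp
  let ?B = "backward (zeta mu n) (\<lambda>t. \<i> * of_int n * P n t - zeta mu n * Q n t)"
  have "exp_decay (a + c * ?n) ((2 + \<bar>mu\<bar>) * ?n * NN * wt n) ?B"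
  proof (rule exp_decay_mono[OF exp_decay_backward[OF source_exp_decay(1)[OF PQ] rate_backward[OF n]] order.refl])
    have "1 \<le> a + c * ?n + Re (zeta mu n)" using a2 cn Re_zeta_pos[OF n] by linarith
    then have "(2 + \<bar>mu\<bar>) * ?n * (NN * wt n) / (a + c * ?n + Re (zeta mu n)) \<le> (2 + \<bar>mu\<bar>) * ?n * (NN * wt n) / 1"
    proof (rule divide_left_mono)
      show "0 \<le> (2 + \<bar>mu\<bar>) * ?n * (NN * wt n)"
        by (rule mult_nonneg_nonneg[OF _ mult_nonneg_nonneg[OF N less_imp_le[OF wt_pos]]]) simp
      show "0 < (a + c * ?n + Re (zeta mu n)) * 1" using rate_backward[OF n] by simp
    qed
    then show "(2 + \<bar>mu\<bar>) * ?n * (NN * wt n) / (a + c * ?n + Re (zeta mu n)) \<le> (2 + \<bar>mu\<bar>) * ?n * NN * wt n"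
      by (simp only: div_by_1 mult.assoc)
  qed
  then have B: "norm (?B s) \<le> (2 + \<bar>mu\<bar>) * ?n * NN * exp (- (c * ?n * s))"
    by (rule weighted_bound(1)) (use a2 s in auto)
  have W: "norm (w n s) \<le> M * exp (- (c * ?n * s))"
    using weighted_bound(1)[OF mode_decayD[OF w] _ s] a2 by simp
  have "norm (chi n s) \<le> norm (?B s) + norm (zeta mu n) * norm (w n s)"
    unfolding chi_def using norm_triangle_ineq4[of "- ?B s" "zeta mu n * w n s"] by (simp add: norm_mult)
  also have "\<dots> \<le> (2 + \<bar>mu\<bar>) * ?n * NN * exp (- (c * ?n * s)) + ((1 + \<bar>mu\<bar>) * ?n) * (M * exp (- (c * ?n * s)))"
    by (intro add_mono B mult_mono norm_zeta_le W) auto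
  also have "\<dots> = ?n * (((2 + \<bar>mu\<bar>) * NN + (1 + \<bar>mu\<bar>) * M) * exp (- (c * ?n * s)))" by (simp add: algebra_simps)
  finally have "norm (chi n s) / ?n \<le> ((2 + \<bar>mu\<bar>) * NN + (1 + \<bar>mu\<bar>) * M) * exp (- (c * ?n * s))"
    using n1 by (simp add: pos_divide_le_eq mult.commute)
  then show "norm (head n s) \<le> ((2 + \<bar>mu\<bar>) * NN + (1 + \<bar>mu\<bar>) * M) * exp (- (c * ?n * s))"
    using n by (simp add: head_def norm_divide norm_mult)
next
  show "continuous_on {0..} (head 0)"
    by (rule continuous_on_vector_derivative) (use integral_0_has_vector_derivative[OF cont_conv_psi_s, of _ 0] in \<open>auto simp: head_def[abs_def]\<close>)
qed

text \<open>The homogeneous solution \<open>e^(- \<zeta> s)\<close> has \<open>phi_plus\<close> equal to \<open>- 1 / (\<zeta> + |n| - 2)\<close> at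
  the circle, which is why this factor appears in \<open>lin_solve\<close>.\<close>

lemma phi_plus_w_0:
  assumes n: "n \<noteq> 0"
  shows "phi_plus w n 0 = \<gamma> n"
proof -
  let ?z = "zeta mu n" and ?k = "of_int \<bar>n\<bar> :: complex"
  define Y where "Y = (?z + ?k - 2) * (\<gamma> n - phi_plus (lin_particular mu P Q) n 0)"
  have r: "0 < a - 2 + c * \<bar>real_of_int n\<bar> + Re ?k" using rate_pos[of n] by simp
  have p: "0 < Re (?z + ?k - 2)" using rate_lt(1)[OF n] rate_pos[of n] by simp
  then have p0: "?z + ?k - 2 \<noteq> 0" by (metis less_irrefl zero_complex.sel(1))
  have dE: "exp_decay (a - 2 + c * \<bar>of_int n\<bar>) (norm Y) (\<lambda>t. Y * exp (- ((?z - 2) * of_real t)))"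
    by (rule exp_decay_exponential) (use rate_lt(1)[OF n] in simp)
  have eq: "of_real (exp (2 * t)) * w n t = of_real (exp (2 * t)) * lin_particular mu P Q n t - Y * exp (- ((?z - 2) * of_real t))" if "0 \<le> t" for t
  proof -
    have "of_real (exp (2 * t)) * exp (- (?z * of_real t)) = exp (- ((?z - 2) * of_real t))"
      by (simp add: exp_of_real[symmetric] exp_add[symmetric] algebra_simps)
    then show ?thesis unfolding w_nonzero[OF n that] Y_def[symmetric]
      by (simp add: right_diff_distrib mult.left_commute)
  qed
  have "phi_plus w n 0 = - backward ?k (\<lambda>t. of_real (exp (2 * t)) * lin_particular mu P Q n t - Y * exp (- ((?z - 2) * of_real t))) 0"
    unfolding phi_plus_def using backward_cong[of _ _ 0, OF eq] by simp
  also have "\<dots> = phi_plus (lin_particular mu P Q) n 0 + backward ?k (\<lambda>t. Y * exp (- ((?z - 2) * of_real t))) 0"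
    unfolding phi_plus_def using backward_diff[OF e2_lin_particular[OF PQ n] dE r, of 0] by simp
  also have "backward ?k (\<lambda>t. Y * exp (- ((?z - 2) * of_real t))) 0 = integral {0..} (\<lambda>t. Y * exp (- ((?z + ?k - 2) * of_real t)))"
  proof -
    have "exp (- (?k * of_real t)) * (Y * exp (- ((?z - 2) * of_real t))) = Y * exp (- ((?z + ?k - 2) * of_real t))" for t
    proof -
      have "exp (- (?k * of_real t)) * exp (- ((?z - 2) * of_real t)) = exp (- ((?z + ?k - 2) * of_real t))"
        by (simp add: exp_add[symmetric] algebra_simps)
      then show ?thesis by (simp only: mult.left_commute[of _ Y])
    qed
    then show ?thesis unfolding backward_def by (simp only: of_real_0 mult_zero_right exp_zero mult_1_left)
  qed
  also have "\<dots> = Y * (1 / (?z + ?k - 2))"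
    unfolding integral_cexp[OF p, symmetric] by (rule Henstock_Kurzweil_Integration.integral_mult_right)
  also have "phi_plus (lin_particular mu P Q) n 0 + Y * (1 / (?z + ?k - 2)) = \<gamma> n"
    using p0 by (simp add: Y_def)
  finally show ?thesis .
qed

lemma psi_0: "n \<noteq> 0 \<Longrightarrow> psi n 0 = b n"
  by (simp add: psi_def phi_def forward_def)

lemma psi_s_at_0: "n \<noteq> 0 \<Longrightarrow> psi_s n 0 = \<gamma> n - of_int \<bar>n\<bar> * b n" "psi_s 0 0 = of_real mu + m"
  using phi_plus_w_0[of n] psi_0[of n] by (auto simp: psi_s_def phi_s_def psi_def)

lemma conj_fam_phi_s_w: "phi_s b m w (- n) s = cnj (phi_s b m w n s)"
  by (rule conj_famD) (rule conj_fam_phi_s[where b=b, OF bc mc, of w, unfolded wc, symmetric])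

lemma conj_fam_psi_s: "psi_s (- n) s = cnj (psi_s n s)"
  by (simp add: psi_s_def conj_fam_phi_s_w)

lemma conj_fam_w: "w (- n) s = cnj (w n s)"
  by (rule conj_famD[OF wc])

lemma real_psi: "real_fam psi"
proof -
  have "phi b w (- n) s = cnj (phi b w n s)" for n s
    by (rule conj_famD, intro ext) (rule conj_fam_phi[where b=b, OF bc, of w, unfolded wc, symmetric])
  moreover have "cnj (integral {0..s} (psi_s 0)) = integral {0..s} (psi_s 0)" for s
    using conj_fam_psi_s[of 0] by (simp flip: hk_integral_cnj)
  ultimately show ?thesis by (simp add: real_fam_def psi_def)
qed

lemma real_w: "real_fam w"
  by (simp add: real_fam_def conj_fam_w)

lemma real_head: "real_fam head"
proof -
  have P: "P (- n) s = cnj (P n s)" for n s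
  proof (rule conj_famD, intro ext)
    show "conj_fam P n s = P n s" for n s
      using conj_fam_conv[of "phi_s b m w" w n s] unfolding conj_fam_phi_s[where b=b, OF bc mc, of w, symmetric] wc by (rule sym)
  qed
  have Q: "Q (- n) s = cnj (Q n s)" for n s
  proof (rule conj_famD, intro ext)
    show "conj_fam Q n s = Q n s" for n s
      using conj_fam_conv[of "phi_theta b w" w n s] unfolding conj_fam_phi_theta[where b=b, OF bc, of w, symmetric] wc by (rule sym)
  qed
  have cp: "cnj (conv psi_s w 0 s) = conv psi_s w 0 s" for s
  proof -
    have "conj_fam psi_s = psi_s" by (simp add: fun_eq_iff conj_fam_def conj_fam_psi_s)
    then have "conj_fam (conv psi_s w) = conv psi_s w"
      using conj_fam_conv[of psi_s w] unfolding wc by (intro ext) (simp only:)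
    from conj_famD[OF this, of 0 s] show ?thesis by simp
  qed
  have "cnj (integral {0..s} (conv psi_s w 0)) = integral {0..s} (conv psi_s w 0)" for s
    using cp by (simp flip: hk_integral_cnj)
  moreover have "chi (- n) s = cnj (chi n s)" if "n \<noteq> 0" for n s
  proof -
    have z: "zeta mu (- n) = cnj (zeta mu n)" by (rule zeta_minus[OF that mu0])
    have "backward (cnj (zeta mu n)) (\<lambda>t. cnj (\<i> * of_int n * P n t - zeta mu n * Q n t)) s = cnj (backward (zeta mu n) (\<lambda>t. \<i> * of_int n * P n t - zeta mu n * Q n t) s)"
      by (rule backward_cnj)
    then show ?thesis by (simp add: chi_def z P Q conj_fam_w)
  qed
  ultimately show ?thesis by (simp add: real_fam_def head_def)
qed

end
end
end

section \<open>Fourier inversion on the circle\<close>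

definition cexp_mode :: "modes" where
  "cexp_mode n t = exp (\<i> * of_int n * of_real t)"

lemma cexp_mode_mult: "cexp_mode n t * cexp_mode k t = cexp_mode (n + k) t"
  by (simp add: cexp_mode_def exp_add[symmetric] algebra_simps)

lemma norm_cexp_mode [simp]: "norm (cexp_mode n t) = 1"
  by (simp add: cexp_mode_def)

lemma continuous_on_cexp_mode [continuous_intros]: "continuous_on S (cexp_mode n)"
  unfolding cexp_mode_def[abs_def] by (intro continuous_intros)

lemma integral_cexp_mode: "(cexp_mode n has_integral (if n = 0 then 2 * of_real pi else 0)) {-pi..pi}"
proof (cases "n = 0")
  case True
  have "((\<lambda>t. 1 :: complex) has_integral (pi - (- pi)) *\<^sub>R 1) {-pi..pi}"
    using has_integral_const_real[of "1 :: complex" "- pi" pi] by simp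
  then show ?thesis using True by (simp add: cexp_mode_def[abs_def] scaleR_conv_of_real)
next
  case False
  have "((\<lambda>t. exp (\<i> * of_int n * of_real t)) has_integral
     exp (\<i> * of_int n * of_real pi) / (\<i> * of_int n) - exp (\<i> * of_int n * of_real (- pi)) / (\<i> * of_int n)) {-pi..pi}"
  proof (rule fundamental_theorem_of_calculus)
    fix t assume "t \<in> {-pi..pi}"
    show "((\<lambda>t. exp (\<i> * of_int n * of_real t) / (\<i> * of_int n)) has_vector_derivative exp (\<i> * of_int n * of_real t)) (at t within {-pi..pi})"
      using False by (intro has_vector_derivative_real_field[where f="\<lambda>z. exp (\<i> * of_int n * z) / (\<i> * of_int n)"])
        (auto intro!: derivative_eq_intros)
  qed simp
  moreover have "exp (\<i> * of_int n * of_real pi) = exp (\<i> * of_int n * of_real (- pi))"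
  proof -
    have "exp (\<i> * of_int n * of_real pi) = exp (\<i> * of_int n * of_real (- pi) + 2 * of_int n * of_real pi * \<i>)"
      by (simp add: algebra_simps)
    also have "\<dots> = exp (\<i> * of_int n * of_real (- pi))"
      unfolding exp_add by (simp add: exp_integer_2pi mult_ac)
    finally show ?thesis .
  qed
  ultimately show ?thesis using False by (simp add: cexp_mode_def[abs_def])
qed

lemma cos_le_cos_away:
  assumes "\<delta> \<le> \<bar>d\<bar>" "\<bar>d\<bar> \<le> 2 * pi - \<delta>" "0 \<le> \<delta>"
  shows "cos d \<le> cos \<delta>"
proof (cases "\<bar>d\<bar> \<le> pi")
  case True
  have "cos \<bar>d\<bar> \<le> cos \<delta>" using assms True by (intro cos_monotone_0_pi_le) auto
  then show ?thesis by simp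
next
  case False
  have "cos (2 * pi - \<bar>d\<bar>) \<le> cos \<delta>" using assms False by (intro cos_monotone_0_pi_le) auto
  then show ?thesis by (simp add: cos_diff)
qed

text \<open>A peaked trigonometric polynomial is tested against \<open>h\<close>. The polynomial
  \<open>1 + cos (t - t0) - cos \<delta>\<close> exceeds \<open>1\<close> by a fixed amount near \<open>t0\<close> and has absolute value at
  most \<open>1\<close> away from \<open>t0\<close>, so its powers would make the integral arbitrarily large if \<open>h t0\<close>
  did not vanish.\<close>

lemma continuous_on_zero_if_modes_zero:
  fixes h :: "real \<Rightarrow> complex"
  assumes h: "continuous_on {-pi..pi} h"
    and z: "\<And>n. integral {-pi..pi} (\<lambda>t. h t * cexp_mode n t) = 0"
    and t0: "t0 \<in> {-pi<..<pi}"
  shows "h t0 = 0"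
proof (rule ccontr)
  assume ne: "h t0 \<noteq> 0"
  define r where "r t = Re (cnj (h t0) * h t)" for t
  have rc: "continuous_on {-pi..pi} r" unfolding r_def by (intro continuous_intros h)
  define R where "R = r t0"
  have R: "0 < R" using ne by (simp add: R_def r_def cmod_power2[symmetric] flip: power2_eq_square)
  have "bounded (r ` {-pi..pi})" by (intro compact_imp_bounded compact_continuous_image rc) auto
  then obtain B where B: "\<forall>x\<in>r ` {-pi..pi}. norm x \<le> B" unfolding bounded_iff by blast
  have Bt: "\<bar>r t\<bar> \<le> B" if "t \<in> {-pi..pi}" for t using B that by auto
  have t0': "t0 \<in> {-pi..pi}" using t0 by auto
  obtain \<eta> where \<eta>: "\<eta> > 0" "\<forall>t\<in>{-pi..pi}. dist t t0 < \<eta> \<longrightarrow> dist (r t) (r t0) < R / 2"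
    using rc[unfolded continuous_on_iff] t0' R by (meson half_gt_zero)
  define \<delta> where "\<delta> = min (\<eta> / 2) (min ((pi - \<bar>t0\<bar>) / 2) 1)"
  have \<delta>: "0 < \<delta>" "\<delta> < \<eta>" "\<delta> \<le> pi - \<bar>t0\<bar>" "\<delta> \<le> 1"
    using \<eta>(1) t0 by (auto simp: \<delta>_def min_def abs_if field_simps)
  define T where "T t = 1 + cos (t - t0) - cos \<delta>" for t
  have Tc: "continuous_on S T" for S unfolding T_def by (intro continuous_intros)
  \<comment> \<open>A power of \<open>T\<close> is a trigonometric polynomial, so \<open>h\<close> is orthogonal to it.\<close>
  have zN: "integral {-pi..pi} (\<lambda>t. h t * cexp_mode n t * of_real (T t) ^ N) = 0" for n N
  proof (induction N arbitrary: n)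
    case 0
    then show ?case using z by simp
  next
    case (Suc N)
    define A where "A = complex_of_real (1 - cos \<delta>)"
    define p where "p = exp (- (\<i> * of_real t0)) / 2"
    define q where "q = exp (\<i> * of_real t0) / 2"
    have T: "of_real (T t) = A + p * cexp_mode 1 t + q * cexp_mode (-1) t" for t
    proof -
      have "complex_of_real (cos (t - t0)) = (exp (\<i> * of_real (t - t0)) + exp (- (\<i> * of_real (t - t0)))) / 2"
        by (simp add: cos_of_real[symmetric] cos_exp_eq del: cos_of_real)
      also have "exp (\<i> * of_real (t - t0)) = exp (- (\<i> * of_real t0)) * cexp_mode 1 t"
        by (simp add: cexp_mode_def exp_add[symmetric] algebra_simps)
      also have "exp (- (\<i> * of_real (t - t0))) = exp (\<i> * of_real t0) * cexp_mode (-1) t"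
        by (simp add: cexp_mode_def exp_add[symmetric] algebra_simps)
      finally have c: "complex_of_real (cos (t - t0)) = (exp (- (\<i> * of_real t0)) * cexp_mode 1 t + exp (\<i> * of_real t0) * cexp_mode (-1) t) / 2" .
      show ?thesis unfolding T_def A_def p_def q_def of_real_diff of_real_add c by (simp add: add_divide_distrib)
    qed
    let ?g = "\<lambda>n t. h t * cexp_mode n t * of_real (T t) ^ N"
    have gi: "?g n integrable_on {-pi..pi}" for n
      by (intro integrable_continuous_interval continuous_intros h Tc)
    have "(\<lambda>t. h t * cexp_mode n t * of_real (T t) ^ Suc N) = (\<lambda>t. A * ?g n t + p * ?g (n + 1) t + q * ?g (n + -1) t)"
      unfolding power_Suc T cexp_mode_mult[symmetric] by (simp add: fun_eq_iff algebra_simps)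
    moreover have "((\<lambda>t. A * ?g n t + p * ?g (n + 1) t + q * ?g (n + -1) t) has_integral A * 0 + p * 0 + q * 0) {-pi..pi}"
      using gi Suc by (intro has_integral_add has_integral_mult_right) (metis integrable_integral)+
    ultimately show ?case by (simp add: integral_unique)
  qed
  have rN: "integral {-pi..pi} (\<lambda>t. r t * T t ^ N) = 0" for N
  proof -
    have i: "(\<lambda>t. h t * cexp_mode 0 t * of_real (T t) ^ N) integrable_on {-pi..pi}"
      by (intro integrable_continuous_interval continuous_intros h Tc)
    have "((\<lambda>t. h t * cexp_mode 0 t * of_real (T t) ^ N) has_integral 0) {-pi..pi}"
      using integrable_integral[OF i] zN[of 0 N] by simp
    then have "((\<lambda>t. cnj (h t0) * (h t * cexp_mode 0 t * of_real (T t) ^ N)) has_integral cnj (h t0) * 0) {-pi..pi}"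
      by (rule has_integral_mult_right)
    from has_integral_linear[OF this bounded_linear_Re]
    have "((\<lambda>t. Re (cnj (h t0) * (h t * cexp_mode 0 t * of_real (T t) ^ N))) has_integral 0) {-pi..pi}" by (simp add: o_def)
    moreover have "Re (cnj (h t0) * (h t * cexp_mode 0 t * of_real (T t) ^ N)) = r t * T t ^ N" for t
    proof -
      have "cnj (h t0) * (h t * cexp_mode 0 t * of_real (T t) ^ N) = (cnj (h t0) * h t) * of_real (T t ^ N)"
        by (simp add: cexp_mode_def mult.assoc)
      then show ?thesis by (simp only: r_def cexp_mode_def)
        (simp add: of_real_power[symmetric] algebra_simps del: of_real_power)
    qed
    ultimately show ?thesis by (simp add: integral_unique)
  qed
  \<comment> \<open>On the middle half of the peak \<open>T\<close> is at least this \<open>Q > 1\<close>. Adding the bound \<open>B\<close> makes the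
    integrand nonnegative everywhere, so the integral over that half can be compared with the
    whole.\<close>
  define Q where "Q = 1 + cos (\<delta> / 2) - cos \<delta>"
  have dp: "\<delta> < pi" using \<delta>(4) pi_gt3 by linarith
  have Q: "1 < Q" using cos_monotone_0_pi[of "\<delta> / 2" \<delta>] \<delta>(1) dp by (simp add: Q_def)
  have near: "R / 2 \<le> r t" if "\<bar>t - t0\<bar> \<le> \<delta>" "t \<in> {-pi..pi}" for t
    using \<eta>(2)[rule_format, OF that(2)] that \<delta>(2) unfolding R_def dist_real_def by (auto simp: abs_if split: if_splits)
  have B0: "0 \<le> B" using Bt[OF t0'] by simp
  have ge: "0 \<le> r t * T t ^ N + B" if t: "t \<in> {-pi..pi}" for t N
  proof (cases "\<bar>t - t0\<bar> \<le> \<delta>")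
    case True
    have "cos \<delta> \<le> cos \<bar>t - t0\<bar>" using True dp by (intro cos_monotone_0_pi_le) auto
    then have "0 \<le> T t" by (simp add: T_def)
    then show ?thesis using near[OF True t] R B0 by (intro add_nonneg_nonneg mult_nonneg_nonneg) auto
  next
    case False
    have "cos (t - t0) \<le> cos \<delta>"
      by (rule cos_le_cos_away) (use False t \<delta> in \<open>auto simp: abs_if split: if_splits\<close>)
    moreover have "-1 \<le> cos (t - t0)" "cos \<delta> \<le> 1" by simp_all
    ultimately have "\<bar>T t\<bar> \<le> 1" unfolding T_def by linarith
    then have "\<bar>T t ^ N\<bar> \<le> 1" by (simp add: power_abs power_le_one)
    then have "\<bar>r t * T t ^ N\<bar> \<le> B * 1" unfolding abs_mult using Bt[OF t] B0 by (intro mult_mono) auto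
    then show ?thesis by linarith
  qed
  have gr: "R / 2 * Q ^ N \<le> r t * T t ^ N + B" if t: "t \<in> {t0 - \<delta> / 2..t0 + \<delta> / 2}" for t N
  proof -
    have tt: "t \<in> {-pi..pi}" using t \<delta>(1,3) by (auto simp: abs_if field_simps split: if_splits)
    have d: "\<bar>t - t0\<bar> \<le> \<delta> / 2" using t by (auto simp: abs_if)
    have "cos (\<delta> / 2) \<le> cos \<bar>t - t0\<bar>" using d dp \<delta>(1) by (intro cos_monotone_0_pi_le) auto
    then have "Q \<le> T t" by (simp add: Q_def T_def)
    then have "Q ^ N \<le> T t ^ N" using Q by (intro power_mono) auto
    moreover have "R / 2 \<le> r t" using near[OF _ tt] d \<delta>(1) by simp
    ultimately have "R / 2 * Q ^ N \<le> r t * T t ^ N" using R Q by (intro mult_mono) auto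
    then show ?thesis using B0 by simp
  qed
  have "\<delta> * (R / 2 * Q ^ N) \<le> 2 * pi * B" for N
  proof -
    let ?f = "\<lambda>t. r t * T t ^ N + B"
    have sub: "{t0 - \<delta> / 2..t0 + \<delta> / 2} \<subseteq> {-pi..pi}" using \<delta>(1,3) by (auto simp: abs_if field_simps split: if_splits)
    have c: "continuous_on {-pi..pi} ?f" by (intro continuous_intros rc Tc)
    have i: "?f integrable_on {-pi..pi}" "?f integrable_on {t0 - \<delta> / 2..t0 + \<delta> / 2}"
      using c continuous_on_subset[OF c sub] by (auto intro: integrable_continuous_interval)
    have "integral {t0 - \<delta> / 2..t0 + \<delta> / 2} (\<lambda>t. R / 2 * Q ^ N) \<le> integral {t0 - \<delta> / 2..t0 + \<delta> / 2} ?f"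
      by (rule integral_le[OF integrable_const_ivl i(2)]) (use gr in auto)
    also have "\<dots> \<le> integral {-pi..pi} ?f" by (rule integral_subset_le[OF sub i(2,1)]) (use ge in auto)
    also have "\<dots> = integral {-pi..pi} (\<lambda>t. r t * T t ^ N) + integral {-pi..pi} (\<lambda>t. B)"
      by (rule Henstock_Kurzweil_Integration.integral_add) (auto intro!: integrable_continuous_interval continuous_intros rc Tc)
    also have "\<dots> = 2 * pi * B" unfolding rN by simp
    finally show ?thesis using \<delta>(1) by (simp add: mult_ac)
  qed
  moreover have "\<exists>N. 2 * pi * B / (\<delta> * (R / 2)) < Q ^ N" using Q by (rule real_arch_pow)
  then obtain N where "2 * pi * B / (\<delta> * (R / 2)) < Q ^ N" by blast
  then have "2 * pi * B < \<delta> * (R / 2 * Q ^ N)" using \<delta>(1) R by (simp add: pos_divide_less_eq mult_ac)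
  ultimately show False by (meson not_le)
qed

text \<open>The Fourier sum converges uniformly and has the same coefficients as \<open>f\<close>, so the
  difference is a continuous function all of whose modes vanish.\<close>

lemma fourier_inversion:
  fixes f :: "real \<Rightarrow> complex"
  assumes f: "continuous_on {-pi..pi} f"
    and C: "\<And>n. norm (C n) \<le> B * wt n"
    and Cf: "\<And>n. C n = 1 / (2 * pi) * integral {-pi..pi} (\<lambda>t. f t * cexp_mode (- n) t)"
    and t: "t \<in> {-pi..pi}"
  shows "f t = (\<Sum>\<^sub>\<infinity>n. C n * cexp_mode n t)"
proof -
  have sB: "(\<lambda>n. B * wt n) summable_on UNIV" by (intro summable_on_cmult_right wt_summable)
  define S where "S t = (\<Sum>\<^sub>\<infinity>n. C n * cexp_mode n t)" for t
  have Sc: "continuous_on {-pi..pi} S" unfolding S_def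
    by (rule continuous_on_infsum_majorant[OF sB]) (use C in \<open>auto simp: norm_mult intro!: continuous_intros\<close>)
  define h where "h t = f t - S t" for t
  have hc: "continuous_on {-pi..pi} h" unfolding h_def by (intro continuous_intros f Sc)
  have Sk: "integral {-pi..pi} (\<lambda>t. S t * cexp_mode k t) = 2 * of_real pi * C (- k)" for k
  proof -
    have ul: "uniform_limit {-pi..pi} (\<lambda>X t. \<Sum>n\<in>X. C n * cexp_mode (n + k) t) (\<lambda>t. \<Sum>\<^sub>\<infinity>n. C n * cexp_mode (n + k) t) (finite_subsets_at_top UNIV)"
      by (rule Weierstrass_m_test_general[OF _ sB]) (use C in \<open>simp add: norm_mult\<close>)
    have Seq: "(\<Sum>\<^sub>\<infinity>n. C n * cexp_mode (n + k) t) = S t * cexp_mode k t" for t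
      unfolding S_def infsum_cmult_left'[symmetric] cexp_mode_mult[symmetric] by (simp add: mult.assoc)
    obtain I J where I: "\<And>X. ((\<lambda>t. \<Sum>n\<in>X. C n * cexp_mode (n + k) t) has_integral I X) {-pi..pi}"
      and J: "((\<lambda>t. S t * cexp_mode k t) has_integral J) {-pi..pi}" and L: "(I \<longlongrightarrow> J) (finite_subsets_at_top UNIV)"
    proof (rule uniform_limit_integral[OF ul[unfolded Seq]])
      show "continuous_on {-pi..pi} (\<lambda>t. \<Sum>n\<in>X. C n * cexp_mode (n + k) t)" for X
        by (intro continuous_intros)
    qed (simp, blast)
    have IX: "I X = 2 * of_real pi * C (- k)" if "finite X" "- k \<in> X" for X
    proof -
      have "((\<lambda>t. \<Sum>n\<in>X. C n * cexp_mode (n + k) t) has_integral (\<Sum>n\<in>X. C n * (if n + k = 0 then 2 * of_real pi else 0))) {-pi..pi}"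
        by (intro has_integral_sum has_integral_mult_right integral_cexp_mode that)
      moreover have "(\<Sum>n\<in>X. C n * (if n + k = 0 then 2 * of_real pi else 0)) = (\<Sum>n\<in>X. if n = - k then C (- k) * (2 * of_real pi) else 0)"
        by (intro sum.cong refl) (auto simp: add_eq_0_iff2)
      ultimately show ?thesis using has_integral_unique[OF I[of X]] that by (simp add: mult.commute)
    qed
    have "(I \<longlongrightarrow> 2 * of_real pi * C (- k)) (finite_subsets_at_top UNIV)"
    proof (rule tendsto_eventually)
      show "\<forall>\<^sub>F X in finite_subsets_at_top UNIV. I X = 2 * of_real pi * C (- k)"
        unfolding eventually_finite_subsets_at_top by (rule exI[of _ "{- k}"]) (use IX in auto)
    qed
    then have "J = 2 * of_real pi * C (- k)" using L tendsto_unique finite_subsets_at_top_neq_bot by blast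
    then show ?thesis using J by (simp add: integral_unique)
  qed
  have z: "integral {-pi..pi} (\<lambda>t. h t * cexp_mode k t) = 0" for k
  proof -
    have "integral {-pi..pi} (\<lambda>t. h t * cexp_mode k t) = integral {-pi..pi} (\<lambda>t. f t * cexp_mode k t) - integral {-pi..pi} (\<lambda>t. S t * cexp_mode k t)"
      unfolding h_def left_diff_distrib
      by (rule Henstock_Kurzweil_Integration.integral_diff) (auto intro!: integrable_continuous_interval continuous_intros f Sc)
    then show ?thesis unfolding Sk Cf by simp
  qed
  have h0: "h t = 0" if "t \<in> {-pi<..<pi}" for t
    by (rule continuous_on_zero_if_modes_zero[OF hc z that])
  have cl: "closure {-pi<..<pi} = {-pi..pi}" by (simp add: closure_greaterThanLessThan)
  have "h t = 0"
    by (rule continuous_constant_on_closure[of "{-pi<..<pi}" h 0]) (use hc h0 t in \<open>auto simp: cl\<close>)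
  then show ?thesis by (simp add: h_def S_def)
qed

section \<open>Solvability of the mode system for small data\<close>

lemma swirl_threshold:
  fixes A B D \<delta> L :: real
  assumes "0 \<le> A" "0 \<le> B" "0 < D" "0 < \<delta>" "0 < L"
  shows "\<exists>e>0. A * (2 * B * (D * e) + e) \<le> 1 / 2 \<and> e + D * e / L < \<delta>"
proof -
  define X where "X = A * (2 * B * D + 1)"
  define Z where "Z = 1 + D / L"
  have X: "0 \<le> X" using assms by (simp add: X_def)
  have Z: "0 < Z" using assms by (simp add: Z_def add_pos_pos)
  define e where "e = min (1 / (2 * (X + 1))) (\<delta> / (2 * Z))"
  have e0: "0 < e" using X Z assms by (simp add: e_def)
  have "e \<le> 1 / (2 * (X + 1))" by (simp add: e_def)
  then have "e * (2 * (X + 1)) \<le> 1" using X by (subst (asm) pos_le_divide_eq) auto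
  then have "e * X \<le> 1 / 2" using e0 by (simp add: algebra_simps)
  moreover have "A * (2 * B * (D * e) + e) = e * X" by (simp add: X_def algebra_simps)
  moreover have "e * Z \<le> \<delta> / (2 * Z) * Z" using Z by (intro mult_right_mono) (auto simp: e_def)
  then have "e * Z < \<delta>" using Z assms by simp
  moreover have "e + D * e / L = e * Z" by (simp add: Z_def algebra_simps)
  ultimately show ?thesis using e0 by (intro exI[of _ e]) simp
qed

text \<open>Boundary data in terms of the stream function: \<open>b\<close> are its modes on the circle
  (\<open>n \<noteq> 0\<close>), \<open>v\<close> the modes of the tangential velocity, and \<open>m\<close> the deviation of the mean
  tangential velocity from \<open>\<mu>\<^sub>0\<close>.\<close>

definition mode_data :: "real \<Rightarrow> (int \<Rightarrow> complex) \<Rightarrow> (int \<Rightarrow> complex) \<Rightarrow> complex \<Rightarrow> bool" where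
  "mode_data e b v m \<longleftrightarrow>
    (\<forall>n. b (- n) = cnj (b n)) \<and> (\<forall>n. v (- n) = cnj (v n)) \<and> cnj m = m \<and>
    (\<forall>n. norm (of_int n * b n) \<le> e * wt n) \<and> norm m \<le> e \<and>
    (\<forall>n. norm (of_int n * (v n + of_int \<bar>n\<bar> * b n)) \<le> e * wt n)"

text \<open>All that the later parts need to know about the solution of the mode system: the
  equations, reality, continuity up to the circle, decay at rate \<open>\<alpha>\<close> towards the swirl of
  strength \<open>\<mu>\<close>, and the boundary values.\<close>

definition mode_solution :: "real \<Rightarrow> real \<Rightarrow> (int \<Rightarrow> complex) \<Rightarrow> (int \<Rightarrow> complex) \<Rightarrow> complex \<Rightarrow>
    modes \<Rightarrow> modes \<Rightarrow> modes \<Rightarrow> modes \<Rightarrow>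
    real \<Rightarrow> real \<Rightarrow> real \<Rightarrow> bool" where
  "mode_solution mu \<delta> b v m \<psi> \<psi>1 w H \<alpha> K \<mu> \<longleftrightarrow>
      0 < \<alpha> \<and>
      rapid \<psi> \<and> rapid \<psi>1 \<and> rapid w \<and> rapid H \<and>
      fam_deriv \<psi> \<psi>1 \<and>
      fam_deriv \<psi>1 (\<lambda>n s. of_int n * (of_int n * \<psi> n s) + of_real (exp (2 * s)) * w n s) \<and>
      fam_deriv w (\<lambda>n s. \<i> * (of_int n * H n s) + (- \<i>) * conv (\<lambda>n s. of_int n * \<psi> n s) w n s) \<and>
      fam_deriv H (\<lambda>n s. (- \<i>) * (of_int n * w n s) + conv \<psi>1 w n s) \<and>
      real_fam \<psi> \<and> real_fam w \<and> real_fam H \<and>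
      (\<forall>n. continuous_on {0..} (\<psi> n)) \<and> (\<forall>n. continuous_on {0..} (\<psi>1 n)) \<and>
      (\<forall>n s. n \<noteq> 0 \<longrightarrow> 0 \<le> s \<longrightarrow> norm (of_int n * \<psi> n s) \<le> K * wt n * exp (- (\<alpha> * s)) \<and>
         norm (\<psi>1 n s) \<le> K * wt n * exp (- (\<alpha> * s))) \<and>
      (\<forall>s\<ge>0. norm (\<psi>1 0 s - of_real \<mu>) \<le> K * exp (- (\<alpha> * s))) \<and>
      \<bar>\<mu> - mu\<bar> < \<delta> \<and>
      (\<forall>n. n \<noteq> 0 \<longrightarrow> \<psi> n 0 = b n \<and> \<psi>1 n 0 = v n) \<and> \<psi>1 0 0 = of_real mu + m"

text \<open>Once the rates are chosen, the constants of the contraction depend only on \<open>\<mu>\<^sub>0\<close>; it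
  remains to take the data so small that the ball of radius \<open>M\<close> is mapped into itself and that
  the circulation at infinity, which the vorticity shifts by \<open>phi_plus w 0 0\<close>, moves by less
  than \<open>\<delta>\<close>.\<close>

lemma mode_solution_exists:
  fixes mu \<delta> :: real
  assumes mu: "sqrt 48 < mu" and \<delta>: "0 < \<delta>"
  shows "\<exists>e>0. \<forall>b v m. mode_data e b v m \<longrightarrow>
    (\<exists>\<psi> \<psi>1 w H \<alpha> K \<mu>. mode_solution mu \<delta> b v m \<psi> \<psi>1 w H \<alpha> K \<mu>)"
proof -
  obtain a c where ac: "2 < a" "0 < c" "a - 2 + c \<le> 1/2" "\<And>n. n \<noteq> 0 \<Longrightarrow> a + 2 * c * \<bar>of_int n\<bar> \<le> Re (zeta mu n)"
    using decay_rates_exist[OF mu] by blast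
  have "0 < sqrt 48" by simp
  then have mu0: "mu \<noteq> 0" using mu by linarith
  interpret swirl mu a c by standard (use ac mu0 in auto)
  have "0 \<le> KS * (4 * wt_total)" "0 < 2 * KG" "0 < a - 2" using K_pos wt_total_nonneg a2 by simp_all
  \<comment> \<open>The ball radius must be \<open>M = 2 KG e\<close>, so all smallness conditions are conditions on \<open>e\<close>.\<close>
  from swirl_threshold[OF this(1) less_imp_le[OF K_pos(1)] this(2) \<delta> this(3)]
  obtain e where e: "0 < e" "KS * (4 * wt_total) * (2 * K1 * (2 * KG * e) + e) \<le> 1 / 2" "e + 2 * KG * e / (a - 2) < \<delta>"
    by blast
  define M where "M = 2 * KG * e"
  have M: "KS * (4 * wt_total) * (2 * K1 * M + e) \<le> 1 / 2" "2 * KG * e \<le> M" "e + M / (a - 2) < \<delta>"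
    using e by (simp_all add: M_def)
  show ?thesis
  proof (rule exI[of _ e], rule conjI[OF e(1)], intro allI impI)
    fix b v :: "int \<Rightarrow> complex" and m :: complex
    assume "mode_data e b v m"
    then have bc: "\<forall>n. b (- n) = cnj (b n)" and vc: "\<forall>n. v (- n) = cnj (v n)" and mc: "cnj m = m"
      and b: "\<forall>n. norm (of_int n * b n) \<le> e * wt n" and m: "norm m \<le> e"
      and g: "\<forall>n. norm (of_int n * (v n + of_int \<bar>n\<bar> * b n)) \<le> e * wt n"
      unfolding mode_data_def by blast+
    define \<gamma> where "\<gamma> n = v n + of_int \<bar>n\<bar> * b n" for n
    have g': "norm (of_int n * \<gamma> n) \<le> e * wt n" for n using g by (simp add: \<gamma>_def)
    have gc: "\<gamma> (- n) = cnj (\<gamma> n)" for n using bc vc by (simp add: \<gamma>_def)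
    note ctx = b[rule_format] m g' M(1,2) bc[rule_format] mc gc
    obtain w where w: "mode_decay c a M w" "\<And>n s. 0 \<le> s \<Longrightarrow> w n s = fix_map mu b m \<gamma> w n s" "conj_fam w = w"
      using real_fixpoint_exists[where b=b and \<gamma>=\<gamma>, OF ctx] by blast
    note cw = ctx w
    let ?\<psi> = "psi b m w" and ?\<psi>1 = "psi_s b m w"
    define K where "K = K1 * M + e + M / (a - 2)"
    have M0: "0 \<le> M" using K_pos e by (simp add: M_def)
    have K: "K1 * M + e \<le> K" "M / (a - 2) \<le> K" using M0 a2 K_pos e by (simp_all add: K_def add_nonneg_nonneg)
    obtain H where H: "rapid H" "real_fam H"
       "fam_deriv w (\<lambda>n s. \<i> * (of_int n * H n s) + (- \<i>) * conv (\<lambda>n s. of_int n * ?\<psi> n s) w n s)"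
       "fam_deriv H (\<lambda>n s. (- \<i>) * (of_int n * w n s) + conv ?\<psi>1 w n s)"
      using rapid_head[where b=b and \<gamma>=\<gamma>, OF cw] real_head[where b=b and \<gamma>=\<gamma>, OF cw]
        deriv_w[where b=b and \<gamma>=\<gamma>, OF cw] deriv_head[where b=b and \<gamma>=\<gamma>, OF cw] by blast
    \<comment> \<open>The circulation at infinity: its value at the circle minus what the vorticity of mode \<open>0\<close>
      takes away.\<close>
    define mm where "mm = of_real mu + m - phi_plus w 0 0"
    have gr: "cnj (phi_plus w 0 0) = phi_plus w 0 0"
      using conj_fam_phi_plus[of w 0 0] w(3) by (simp add: conj_fam_def)
    then have mr: "of_real (Re mm) = mm" using mc by (simp add: mm_def complex_eq_iff)
    have "norm (mm - of_real mu) \<le> norm m + norm (phi_plus w 0 0)"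
      using norm_triangle_ineq4[of m "phi_plus w 0 0"] by (simp add: mm_def)
    also have "\<dots> \<le> e + M / (a - 2)"
      using phi_plus_0_bound[where b=b and \<gamma>=\<gamma>, OF cw] m by simp
    also have "\<dots> < \<delta>" by (rule M(3))
    finally have "\<bar>Re mm - mu\<bar> < \<delta>"
      using abs_Re_le_cmod[of "mm - of_real mu"] by simp
    have bd1: "norm (of_int n * ?\<psi> n s) \<le> K * wt n * exp (- ((a - 2) * s))"
      "norm (?\<psi>1 n s) \<le> K * wt n * exp (- ((a - 2) * s))" if "n \<noteq> 0" "0 \<le> s" for n s
    proof -
      have "(K1 * M + e) * wt n * exp (- ((a - 2) * s)) \<le> K * wt n * exp (- ((a - 2) * s))"
        using K(1) wt_pos[of n] by (intro mult_right_mono) auto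
      then show "norm (of_int n * ?\<psi> n s) \<le> K * wt n * exp (- ((a - 2) * s))"
        "norm (?\<psi>1 n s) \<le> K * wt n * exp (- ((a - 2) * s))"
        using psi_decay[where b=b and \<gamma>=\<gamma>, OF cw that] by auto
    qed
    have bd0: "norm (?\<psi>1 0 s - of_real (Re mm)) \<le> K * exp (- ((a - 2) * s))" if "0 \<le> s" for s
    proof -
      have "M / (a - 2) * exp (- ((a - 2) * s)) \<le> K * exp (- ((a - 2) * s))" using K(2) by (intro mult_right_mono) auto
      from order_trans[OF psi_s_0_decay[where b=b and \<gamma>=\<gamma>, OF cw that] this]
      show ?thesis unfolding mr unfolding mm_def .
    qed
    have pd: "?\<psi> n = (\<lambda>s. if n = 0 then integral {0..s} (?\<psi>1 0) else phi b w n s)" for n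
      by (intro ext) (use psi_def[where b=b and \<gamma>=\<gamma>, OF cw] in simp)
    have c0': "continuous_on {0..} (?\<psi> n)" for n
    proof (cases "n = 0")
      case True
      show ?thesis unfolding True
        by (rule continuous_on_vector_derivative)
          (use integral_0_has_vector_derivative[OF cont_psi_s[where b=b and \<gamma>=\<gamma>, OF cw], of _ 0] in \<open>auto simp: pd\<close>)
    next
      case False
      have "continuous_on {0..} (\<lambda>s. 1 / of_int n * (of_int n * phi b w n s))"
        by (intro continuous_on_mult_left exp_decay_cont[OF phi_exp_decay[where b=b and n=n, OF w(1) b[rule_format] False]])
      then show ?thesis using False by (simp add: pd)
    qed
    show "\<exists>\<psi> \<psi>1 w H \<alpha> K \<mu>. mode_solution mu \<delta> b v m \<psi> \<psi>1 w H \<alpha> K \<mu>"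
    proof (rule exI[of _ ?\<psi>], rule exI[of _ ?\<psi>1], rule exI[of _ w], rule exI[of _ H],
        rule exI[of _ "a - 2"], rule exI[of _ K], rule exI[of _ "Re mm"],
        unfold mode_solution_def, intro conjI allI impI)
      show "?\<psi> n 0 = b n" "?\<psi>1 n 0 = v n" if "n \<noteq> 0" for n
        using psi_0[where b=b and \<gamma>=\<gamma>, OF cw that] psi_s_at_0(1)[where b=b and \<gamma>=\<gamma>, OF cw that] by (simp_all add: \<gamma>_def)
    qed (use a2 H bd0 bd1 c0' \<open>\<bar>Re mm - mu\<bar> < \<delta>\<close> rapid_w[where b=b and \<gamma>=\<gamma>, OF cw] rapid_psi[where b=b and \<gamma>=\<gamma>, OF cw] rapid_psi_s[where b=b and \<gamma>=\<gamma>, OF cw]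
        deriv_psi[where b=b and \<gamma>=\<gamma>, OF cw] deriv_psi_s[where b=b and \<gamma>=\<gamma>, OF cw] real_psi[where b=b and \<gamma>=\<gamma>, OF cw] real_w[where b=b and \<gamma>=\<gamma>, OF cw]
        cont_psi_s[where b=b and \<gamma>=\<gamma>, OF cw] psi_s_at_0(2)[where b=b and \<gamma>=\<gamma>, OF cw] in auto)
  qed
qed

section \<open>The velocity field at the circle and at infinity\<close>

lemma cpx_polar: "cpx (r *\<^sub>R e_r \<theta>) = of_real r * cexp_mode 1 \<theta>"
  by (simp add: complex_eq_iff e_r_def cexp_mode_def exp_Euler cos_of_real sin_of_real)

lemma norm_polar: "0 \<le> r \<Longrightarrow> norm (r *\<^sub>R e_r \<theta>) = r"
  using norm_cpx[of "r *\<^sub>R e_r \<theta>"] unfolding cpx_polar by (simp add: norm_mult)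

lemma sgn_cexp_mode_power:
  assumes "0 < r"
  shows "sgn (cpx (r *\<^sub>R e_r \<theta>)) powi n = cexp_mode n \<theta>"
proof -
  have "sgn (cpx (r *\<^sub>R e_r \<theta>)) = cexp_mode 1 \<theta>"
    unfolding cpx_polar using assms by (simp add: sgn_mult sgn_of_real) (simp add: sgn_div_norm)
  then show ?thesis by (simp add: cexp_mode_def exp_power_int mult_ac)
qed

lemma vec2_e_theta: "vec2 (of_real x * (\<i> * cexp_mode 1 \<theta>)) = x *\<^sub>R e_theta \<theta>"
  by (simp add: vec_eq_iff forall_2 e_theta_def cexp_mode_def exp_Euler cos_of_real sin_of_real)

lemma vec2_polar: "vec2 (cexp_mode 1 \<theta> * (of_real x + \<i> * of_real y)) = x *\<^sub>R e_r \<theta> + y *\<^sub>R e_theta \<theta>"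
  by (simp add: vec_eq_iff forall_2 e_r_def e_theta_def cexp_mode_def exp_Euler cos_of_real sin_of_real algebra_simps)

lemma polar_form_exists:
  fixes x :: "real ^ 2"
  assumes "x \<noteq> 0"
  shows "\<exists>\<theta>\<in>{-pi..pi}. x = norm x *\<^sub>R e_r \<theta>"
proof -
  have "cpx x \<noteq> 0" using assms norm_cpx[of x] by (metis norm_eq_zero)
  from Arg_eq[OF this] have "cpx x = of_real (norm x) * cexp_mode 1 (Arg (cpx x))"
    by (simp add: cexp_mode_def)
  then have "cpx x = cpx (norm x *\<^sub>R e_r (Arg (cpx x)))" by (simp only: cpx_polar)
  then have "vec2 (cpx x) = vec2 (cpx (norm x *\<^sub>R e_r (Arg (cpx x))))" by (rule arg_cong)
  then have "x = norm x *\<^sub>R e_r (Arg (cpx x))" by (simp only: vec2_cpx)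
  then show ?thesis using mpi_less_Arg[of "cpx x"] Arg_le_pi[of "cpx x"] by (intro bexI[of _ "Arg (cpx x)"]) auto
qed

text \<open>The modes of \<open>2 i Dbar \<psi>\<close>, with the derivative of \<open>\<psi>\<close> given separately so that the
  formula remains meaningful on the circle itself.\<close>

definition velocity_fam :: "modes \<Rightarrow> modes \<Rightarrow> modes" where
  "velocity_fam \<psi> \<psi>1 n s = of_real (exp (- s)) * (\<i> * (\<psi>1 (n - 1) s - of_int (n - 1) * \<psi> (n - 1) s))"

lemma synth_velocity_fam_polar:
  assumes r: "0 < r"
  shows "synth (velocity_fam \<psi> \<psi>1) (r *\<^sub>R e_r \<theta>) =
    of_real (1 / r) * (\<i> * cexp_mode 1 \<theta>) * (\<Sum>\<^sub>\<infinity>m. (\<psi>1 m (ln r) - of_int m * \<psi> m (ln r)) * cexp_mode m \<theta>)"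
proof -
  let ?g = "\<lambda>m. (\<psi>1 m (ln r) - of_int m * \<psi> m (ln r)) * cexp_mode m \<theta>"
  have er: "exp (- ln r) = 1 / r" using r by (simp add: exp_minus inverse_eq_divide)
  have "synth (velocity_fam \<psi> \<psi>1) (r *\<^sub>R e_r \<theta>) = (\<Sum>\<^sub>\<infinity>n. (of_real (1 / r) * (\<i> * cexp_mode 1 \<theta>)) * ?g (n - 1))"
    unfolding synth_def norm_polar[OF less_imp_le[OF r]] sgn_cexp_mode_power[OF r] velocity_fam_def er
  proof (intro infsum_cong)
    fix n
    have "cexp_mode n \<theta> = cexp_mode 1 \<theta> * cexp_mode (n - 1) \<theta>" by (simp add: cexp_mode_mult)
    then show "of_real (1 / r) * (\<i> * (\<psi>1 (n - 1) (ln r) - of_int (n - 1) * \<psi> (n - 1) (ln r))) * cexp_mode n \<theta> =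
      (of_real (1 / r) * (\<i> * cexp_mode 1 \<theta>)) * ?g (n - 1)" by (simp only: mult_ac)
  qed
  also have "\<dots> = of_real (1 / r) * (\<i> * cexp_mode 1 \<theta>) * (\<Sum>\<^sub>\<infinity>n. ?g (n - 1))" by (rule infsum_cmult_right')
  also have "(\<Sum>\<^sub>\<infinity>n. ?g (n - 1)) = (\<Sum>\<^sub>\<infinity>m. ?g m)" by (rule infsum_shift_int(1)[of ?g])
  finally show ?thesis .
qed

lemma exterior_closure: "closure exterior = {x. 1 \<le> norm x}"
proof -
  have "closure (- closure (ball (0 :: real ^ 2) 1)) = - interior (cball 0 1)" by (simp add: closure_complement)
  then show ?thesis unfolding exterior_def by (auto simp: interior_cball not_less)
qed

lemma tendsto_exp_ln:
  fixes \<alpha> C :: real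
  shows "0 < \<alpha> \<Longrightarrow> ((\<lambda>r. C * exp (- (\<alpha> * ln r))) \<longlongrightarrow> 0) at_top"
proof -
  assume a: "0 < \<alpha>"
  have "filterlim (\<lambda>r. \<alpha> * ln r) at_top at_top"
    by (rule filterlim_tendsto_pos_mult_at_top[OF tendsto_const a ln_at_top])
  then have "filterlim (\<lambda>r. - (\<alpha> * ln r)) at_bot at_top" by (simp add: filterlim_uminus_at_bot)
  then have "((\<lambda>r. exp (- (\<alpha> * ln r))) \<longlongrightarrow> 0) at_top" by (rule filterlim_compose[OF exp_at_bot])
  then show ?thesis by (rule tendsto_mult_right_zero)
qed

lemma fourier_coeff_minus: "fourier_coeff f (- n) = cnj (fourier_coeff f n)"
  unfolding fourier_coeff_def by (simp add: exp_cnj flip: hk_integral_cnj)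

lemma fourier_coeff_0: "fourier_coeff f 0 = of_real (1 / (2 * pi) * integral {-pi..pi} f)"
proof -
  have "integral {-pi..pi} (\<lambda>t. complex_of_real (f t)) = of_real (integral {-pi..pi} f)"
  proof (cases "f integrable_on {-pi..pi}")
    case True
    then show ?thesis using integral_linear[OF True, of "of_real :: real \<Rightarrow> complex"] bounded_linear_of_real by (simp add: o_def)
  next
    case False
    then have "\<not> (\<lambda>t. complex_of_real (f t)) integrable_on {-pi..pi}"
      using integrable_linear[OF _ bounded_linear_Re, of "\<lambda>t. complex_of_real (f t)"] by (auto simp: o_def)
    with False show ?thesis by (simp add: not_integrable_integral)
  qed
  then show ?thesis by (simp add: fourier_coeff_def)
qed

context
  fixes \<psi> \<psi>1 :: "modes" and \<alpha> K \<mu> :: real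
  assumes \<alpha>: "0 < \<alpha>"
    and mode_decay: "\<And>n s. n \<noteq> 0 \<Longrightarrow> 0 \<le> s \<Longrightarrow> norm (of_int n * \<psi> n s) \<le> K * wt n * exp (- (\<alpha> * s))"
      "\<And>n s. n \<noteq> 0 \<Longrightarrow> 0 \<le> s \<Longrightarrow> norm (\<psi>1 n s) \<le> K * wt n * exp (- (\<alpha> * s))"
    and bd0: "\<And>s. 0 \<le> s \<Longrightarrow> norm (\<psi>1 0 s - of_real \<mu>) \<le> K * exp (- (\<alpha> * s))"
    and cont: "\<And>n. continuous_on {0..} (\<psi> n)" "\<And>n. continuous_on {0..} (\<psi>1 n)"
begin

text \<open>The modes of the velocity, apart from a common factor, after subtraction of the swirl of
  strength \<open>\<mu>\<close>.\<close>

definition dev :: "modes" where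
  "dev m s = \<psi>1 m s - of_int m * \<psi> m s - (if m = 0 then of_real \<mu> else 0)"

lemma K_nonneg: "0 \<le> K"
  using order_trans[OF norm_ge_zero bd0[of 0]] by simp

lemma dev_bound: "0 \<le> s \<Longrightarrow> norm (dev m s) \<le> 2 * K * exp (- (\<alpha> * s)) * wt m"
proof (cases "m = 0")
  case True
  assume s: "0 \<le> s"
  have "norm (dev m s) \<le> K * exp (- (\<alpha> * s))" using bd0[OF s] True by (simp add: dev_def)
  also have "\<dots> \<le> 2 * K * exp (- (\<alpha> * s)) * wt m" using K_nonneg True by (simp add: wt_def)
  finally show ?thesis .
next
  case False
  assume s: "0 \<le> s"
  have "norm (dev m s) \<le> norm (\<psi>1 m s) + norm (of_int m * \<psi> m s)"
    using False norm_triangle_ineq4 by (simp add: dev_def)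
  also have "\<dots> \<le> K * wt m * exp (- (\<alpha> * s)) + K * wt m * exp (- (\<alpha> * s))"
    by (intro add_mono mode_decay False s)
  finally show ?thesis by (simp add: mult_ac)
qed

lemma velocity_deviation:
  assumes s: "0 \<le> s"
  shows "norm ((\<Sum>\<^sub>\<infinity>m. (\<psi>1 m s - of_int m * \<psi> m s) * cexp_mode m \<theta>) - of_real \<mu>) \<le> 2 * K * wt_total * exp (- (\<alpha> * s))"
proof -
  let ?C = "2 * K * exp (- (\<alpha> * s))"
  have sm: "(\<lambda>m. ?C * wt m) summable_on UNIV" by (intro summable_on_cmult_right wt_summable)
  have b: "norm (dev m s * cexp_mode m \<theta>) \<le> ?C * wt m" for m using dev_bound[OF s, of m] by (simp add: norm_mult)
  note D = norm_infsum_le_majorant[OF sm b]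
  have hs: "((\<lambda>m. if m = 0 then of_real \<mu> else 0) has_sum (of_real \<mu> :: complex)) (UNIV :: int set)"
    using has_sum_finite_neutralI[of "{0::int}" UNIV "\<lambda>m. if m = 0 then complex_of_real \<mu> else 0"] by simp
  have "(\<psi>1 m s - of_int m * \<psi> m s) * cexp_mode m \<theta> = dev m s * cexp_mode m \<theta> + (if m = 0 then of_real \<mu> else 0)" for m
    by (simp add: dev_def algebra_simps) (simp add: cexp_mode_def)
  then have "(\<Sum>\<^sub>\<infinity>m. (\<psi>1 m s - of_int m * \<psi> m s) * cexp_mode m \<theta>) = (\<Sum>\<^sub>\<infinity>m. dev m s * cexp_mode m \<theta>) + of_real \<mu>"
    using infsum_add[OF D(1) has_sum_imp_summable[OF hs]] infsumI[OF hs] by simp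
  moreover have "(\<Sum>\<^sub>\<infinity>m. ?C * wt m) = ?C * wt_total" by (simp only: infsum_cmult_right' wt_total_def)
  ultimately show ?thesis using D(2) by (simp add: mult_ac)
qed

lemma velocity_continuous: "continuous_on {x. 1 \<le> norm x} (synth (velocity_fam \<psi> \<psi>1))"
  unfolding synth_def[abs_def]
proof (rule continuous_on_infsum_majorant)
  show "(\<lambda>n. (2 * K + \<bar>\<mu>\<bar>) * wt (n - 1)) summable_on UNIV"
    by (intro summable_on_cmult_right) (simp add: summable_shift_int wt_summable)
  fix n and x :: "real ^ 2"
  show "continuous_on {x. 1 \<le> norm x} (\<lambda>x. velocity_fam \<psi> \<psi>1 n (ln (norm x)) * sgn (cpx x) powi n)"
  proof -
    have l: "continuous_on {x :: real ^ 2. 1 \<le> norm x} (\<lambda>x. ln (norm x))" by (intro continuous_intros) auto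
    have v: "continuous_on {0..} (velocity_fam \<psi> \<psi>1 n)" unfolding velocity_fam_def[abs_def] by (intro continuous_intros cont)
    have c: "continuous_on {x. 1 \<le> norm x} cpx"
      by (rule linear_continuous_on[OF bounded_linear_cpx])
    have ne: "cpx x \<noteq> 0" if "1 \<le> norm x" for x using that norm_cpx[of x] by (auto simp del: norm_cpx)
    have "continuous_on {x :: real ^ 2. 1 \<le> norm x} (\<lambda>x. velocity_fam \<psi> \<psi>1 n (ln (norm x)))"
      by (rule continuous_on_compose2[OF v l]) auto
    then show ?thesis using ne by (intro continuous_intros continuous_on_sgn c) (auto simp: sgn_zero_iff)
  qed
  assume "x \<in> {x. 1 \<le> norm x}"
  then have x: "1 \<le> norm x" by simp
  then have s: "0 \<le> ln (norm x)" by simp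
  have sg: "norm (sgn (cpx x) powi n) = 1"
    using x norm_cpx[of x] by (simp add: norm_power_int norm_sgn) (metis norm_zero not_one_le_zero norm_cpx)
  have e1: "exp (- ln (norm x)) \<le> 1" using s by simp
  have ea: "exp (- (\<alpha> * ln (norm x))) \<le> 1" using s \<alpha> by simp
  have w: "0 < wt (n - 1)" by (rule wt_pos)
  have "\<psi>1 (n - 1) (ln (norm x)) - of_int (n - 1) * \<psi> (n - 1) (ln (norm x)) = dev (n - 1) (ln (norm x)) + (if n - 1 = 0 then of_real \<mu> else 0)"
    by (simp add: dev_def)
  also have "norm \<dots> \<le> 2 * K * exp (- (\<alpha> * ln (norm x))) * wt (n - 1) + \<bar>\<mu>\<bar> * wt (n - 1)"
    by (rule norm_triangle_le, rule add_mono[OF dev_bound[OF s]]) (auto simp: wt_def)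
  also have "\<dots> \<le> 2 * K * 1 * wt (n - 1) + \<bar>\<mu>\<bar> * wt (n - 1)"
    using K_nonneg ea w by (intro add_right_mono mult_right_mono mult_left_mono) auto
  finally have d: "norm (\<psi>1 (n - 1) (ln (norm x)) - of_int (n - 1) * \<psi> (n - 1) (ln (norm x))) \<le> (2 * K + \<bar>\<mu>\<bar>) * wt (n - 1)"
    by (simp add: distrib_right)
  have "norm (velocity_fam \<psi> \<psi>1 n (ln (norm x))) = exp (- ln (norm x)) * norm (\<psi>1 (n - 1) (ln (norm x)) - of_int (n - 1) * \<psi> (n - 1) (ln (norm x)))"
    by (simp add: velocity_fam_def norm_mult)
  also have "\<dots> \<le> 1 * ((2 * K + \<bar>\<mu>\<bar>) * wt (n - 1))" by (intro mult_mono e1 d) auto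
  finally show "norm (velocity_fam \<psi> \<psi>1 n (ln (norm x)) * sgn (cpx x) powi n) \<le> (2 * K + \<bar>\<mu>\<bar>) * wt (n - 1)"
    by (simp add: norm_mult sg)
qed

lemma velocity_polar_bound:
  assumes r: "1 \<le> r"
  shows "norm (vec2 (synth (velocity_fam \<psi> \<psi>1) (r *\<^sub>R e_r \<theta>)) - (\<mu> / r) *\<^sub>R e_theta \<theta>) \<le> 2 * K * wt_total * exp (- (\<alpha> * ln r)) / r"
proof -
  have r0: "0 < r" using r by simp
  let ?V = "\<Sum>\<^sub>\<infinity>m. (\<psi>1 m (ln r) - of_int m * \<psi> m (ln r)) * cexp_mode m \<theta>"
  have "vec2 (synth (velocity_fam \<psi> \<psi>1) (r *\<^sub>R e_r \<theta>)) - (\<mu> / r) *\<^sub>R e_theta \<theta>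
     = vec2 (of_real (1 / r) * (\<i> * cexp_mode 1 \<theta>) * ?V) - vec2 (of_real (\<mu> / r) * (\<i> * cexp_mode 1 \<theta>))"
    unfolding synth_velocity_fam_polar[OF r0] vec2_e_theta ..
  also have "\<dots> = vec2 (of_real (1 / r) * (\<i> * cexp_mode 1 \<theta>) * ?V - of_real (\<mu> / r) * (\<i> * cexp_mode 1 \<theta>))"
    by (rule linear_diff[OF bounded_linear.linear[OF bounded_linear_vec2], symmetric])
  also have "of_real (1 / r) * (\<i> * cexp_mode 1 \<theta>) * ?V - of_real (\<mu> / r) * (\<i> * cexp_mode 1 \<theta>)
     = of_real (1 / r) * (\<i> * cexp_mode 1 \<theta>) * (?V - of_real \<mu>)"
    by (simp add: right_diff_distrib)
  finally have "norm (vec2 (synth (velocity_fam \<psi> \<psi>1) (r *\<^sub>R e_r \<theta>)) - (\<mu> / r) *\<^sub>R e_theta \<theta>) = norm (?V - of_real \<mu>) / r"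
    using r0 by (simp add: norm_mult norm_divide)
  also have "\<dots> \<le> 2 * K * wt_total * exp (- (\<alpha> * ln r)) / r"
    using velocity_deviation[of "ln r" \<theta>] r by (intro divide_right_mono) auto
  finally show ?thesis .
qed

lemma velocity_tendsto_0: "((\<lambda>x. vec2 (synth (velocity_fam \<psi> \<psi>1) x)) \<longlongrightarrow> 0) at_infinity"
proof (rule Lim_null_comparison)
  show "\<forall>\<^sub>F x in at_infinity. norm (vec2 (synth (velocity_fam \<psi> \<psi>1) x)) \<le> (2 * K * wt_total + \<bar>\<mu>\<bar>) / norm x"
    unfolding eventually_at_infinity
  proof (rule exI[of _ 1], intro allI impI)
    fix x :: "real ^ 2" assume x: "1 \<le> norm x"
    then have "x \<noteq> 0" by auto
    then obtain \<theta> where \<theta>: "x = norm x *\<^sub>R e_r \<theta>" using polar_form_exists by blast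
    have e1: "norm (e_theta \<theta>) = 1" using norm_vec2[of "of_real 1 * (\<i> * cexp_mode 1 \<theta>)"] unfolding vec2_e_theta by (simp add: norm_mult)
    have ea: "exp (- (\<alpha> * ln (norm x))) \<le> 1" using x \<alpha> by simp
    have "norm (vec2 (synth (velocity_fam \<psi> \<psi>1) x)) \<le> norm (vec2 (synth (velocity_fam \<psi> \<psi>1) x) - (\<mu> / norm x) *\<^sub>R e_theta \<theta>) + norm ((\<mu> / norm x) *\<^sub>R e_theta \<theta>)"
      using norm_triangle_ineq[of "vec2 (synth (velocity_fam \<psi> \<psi>1) x) - (\<mu> / norm x) *\<^sub>R e_theta \<theta>" "(\<mu> / norm x) *\<^sub>R e_theta \<theta>"] by simp
    also have "\<dots> \<le> 2 * K * wt_total * exp (- (\<alpha> * ln (norm x))) / norm x + \<bar>\<mu>\<bar> / norm x"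
      using velocity_polar_bound[OF x, of \<theta>] e1 unfolding \<theta>[symmetric] by (intro add_mono) auto
    also have "\<dots> \<le> 2 * K * wt_total * 1 / norm x + \<bar>\<mu>\<bar> / norm x"
      using K_nonneg wt_total_nonneg ea by (intro add_right_mono divide_right_mono mult_left_mono) auto
    finally show "norm (vec2 (synth (velocity_fam \<psi> \<psi>1) x)) \<le> (2 * K * wt_total + \<bar>\<mu>\<bar>) / norm x"
      by (simp add: add_divide_distrib)
  qed
  show "((\<lambda>x :: real ^ 2. (2 * K * wt_total + \<bar>\<mu>\<bar>) / norm x) \<longlongrightarrow> 0) at_infinity"
    by (rule tendsto_divide_0[OF tendsto_const filterlim_at_top_imp_at_infinity[OF filterlim_norm_at_top]])
qed

text \<open>The factor \<open>r\<close> cancels the \<open>1 / r\<close> of the velocity and leaves the decay \<open>r\<close> to the power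
  \<open>- \<alpha>\<close>. The pointwise bound passes to the essential supremum because the deviation is
  continuous, hence measurable.\<close>

lemma velocity_Linf_limit:
  "((\<lambda>r. ereal r * Linf_norm (\<lambda>\<theta>. vec2 (synth (velocity_fam \<psi> \<psi>1) (r *\<^sub>R e_r \<theta>)) - (\<mu> / r) *\<^sub>R e_theta \<theta>)) \<longlongrightarrow> 0) at_top"
proof (rule tendsto_sandwich)
  let ?d = "\<lambda>r \<theta>. vec2 (synth (velocity_fam \<psi> \<psi>1) (r *\<^sub>R e_r \<theta>)) - (\<mu> / r) *\<^sub>R e_theta \<theta>"
  have meas: "(\<lambda>\<theta>. ereal (norm (?d r \<theta>))) \<in> borel_measurable (lebesgue_on {-pi<..<pi})" if r: "1 \<le> r" for r
  proof -
    have er: "continuous_on UNIV e_r" "continuous_on UNIV e_theta"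
    proof -
      have e: "e_r = (\<lambda>\<theta>. vec2 (cexp_mode 1 \<theta>))" "e_theta = (\<lambda>\<theta>. vec2 (\<i> * cexp_mode 1 \<theta>))"
        using vec2_polar[of _ 1 0] vec2_e_theta[of 1] by (simp_all add: fun_eq_iff)
      show "continuous_on UNIV e_r" "continuous_on UNIV e_theta"
        unfolding e by (intro continuous_on_compose2[OF linear_continuous_on[OF bounded_linear_vec2, of UNIV]] continuous_intros; simp)+
    qed
    have "continuous_on {-pi<..<pi} (\<lambda>\<theta>. synth (velocity_fam \<psi> \<psi>1) (r *\<^sub>R e_r \<theta>))"
      by (rule continuous_on_compose2[OF velocity_continuous])
        (use r norm_polar[of r] in \<open>auto intro!: continuous_intros continuous_on_subset[OF er(1)]\<close>)
    then have "continuous_on {-pi<..<pi} (\<lambda>\<theta>. norm (?d r \<theta>))"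
      by (intro continuous_intros continuous_on_compose2[OF linear_continuous_on[OF bounded_linear_vec2, of UNIV]] continuous_on_subset[OF er(2)]) auto
    then have "(\<lambda>\<theta>. norm (?d r \<theta>)) \<in> borel_measurable (lebesgue_on {-pi<..<pi})"
      by (rule continuous_imp_measurable_on_sets_lebesgue) auto
    then show ?thesis by (rule borel_measurable_ereal)
  qed
  have em: "emeasure (lebesgue_on {-pi<..<pi}) (space (lebesgue_on {-pi<..<pi})) \<noteq> 0"
    by (simp add: emeasure_restrict_space)
  have lower: "0 \<le> Linf_norm (?d r)" for r
  proof (cases "(\<lambda>\<theta>. ereal (norm (?d r \<theta>))) \<in> borel_measurable (lebesgue_on {-pi<..<pi})")
    case True
    have "esssup (lebesgue_on {-pi<..<pi}) (\<lambda>\<theta>. 0 :: ereal) \<le> Linf_norm (?d r)"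
      unfolding Linf_norm_def by (rule esssup_mono) auto
    then show ?thesis by (simp add: esssup_const[OF em])
  next
    case False
    then show ?thesis by (simp add: Linf_norm_def esssup_non_measurable top_ereal_def)
  qed
  show "\<forall>\<^sub>F r in at_top. 0 \<le> ereal r * Linf_norm (?d r)"
    using eventually_ge_at_top[of 0] by eventually_elim (use lower in simp)
  show "\<forall>\<^sub>F r in at_top. ereal r * Linf_norm (?d r) \<le> ereal (2 * K * wt_total * exp (- (\<alpha> * ln r)))"
    using eventually_ge_at_top[of 1]
  proof eventually_elim
    case (elim r)
    have "Linf_norm (?d r) \<le> ereal (2 * K * wt_total * exp (- (\<alpha> * ln r)) / r)"
      unfolding Linf_norm_def
      by (rule esssup_I[OF meas[OF elim]]) (use velocity_polar_bound[OF elim] in auto)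
    then have "ereal r * Linf_norm (?d r) \<le> ereal r * ereal (2 * K * wt_total * exp (- (\<alpha> * ln r)) / r)"
      using elim by (intro ereal_mult_left_mono) auto
    also have "\<dots> = ereal (2 * K * wt_total * exp (- (\<alpha> * ln r)))" using elim by simp
    finally show ?case .
  qed
  show "((\<lambda>r. ereal (2 * K * wt_total * exp (- (\<alpha> * ln r)))) \<longlongrightarrow> 0) at_top"
    using tendsto_ereal[OF tendsto_exp_ln[OF \<alpha>]] by (simp add: zero_ereal_def)
qed (rule tendsto_const)

end

section \<open>Existence of the steady flow\<close>

text \<open>Fourier inversion for the complex field \<open>u_r + i u_\<theta>\<close>, turned back to Cartesian
  components by the factor \<open>e^(i \<theta>)\<close>.\<close>

lemma boundary_velocity:
  fixes ustar :: "real ^ 2 \<Rightarrow> real ^ 2"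
  defines "C \<equiv> \<lambda>n. fourier_coeff (radial_part ustar) n + \<i> * fourier_coeff (angular_part ustar) n"
  assumes c: "continuous_on UNIV (\<lambda>\<theta>. ustar (e_r \<theta>))"
    and mode_decay: "\<And>n. norm (C n) \<le> B * wt n"
    and t: "\<theta> \<in> {-pi..pi}"
  shows "vec2 (cexp_mode 1 \<theta> * (\<Sum>\<^sub>\<infinity>n. C n * cexp_mode n \<theta>)) = ustar (e_r \<theta>)"
proof -
  have er: "continuous_on UNIV e_r" "continuous_on UNIV e_theta"
  proof -
    have e: "e_r = (\<lambda>\<theta>. vec2 (cexp_mode 1 \<theta>))" "e_theta = (\<lambda>\<theta>. vec2 (\<i> * cexp_mode 1 \<theta>))"
      using vec2_polar[of _ 1 0] vec2_e_theta[of 1] by (simp_all add: fun_eq_iff)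
    show "continuous_on UNIV e_r" "continuous_on UNIV e_theta"
      unfolding e by (intro continuous_on_compose2[OF linear_continuous_on[OF bounded_linear_vec2, of UNIV]] continuous_intros; simp)+
  qed
  have rc: "continuous_on S (radial_part ustar)" "continuous_on S (angular_part ustar)" for S
    unfolding radial_part_def[abs_def] angular_part_def[abs_def]
    by (intro continuous_intros continuous_on_subset[OF c] continuous_on_subset[OF er(1)] continuous_on_subset[OF er(2)]; simp)+
  define f where "f t = complex_of_real (radial_part ustar t) + \<i> * of_real (angular_part ustar t)" for t
  have fc: "continuous_on {-pi..pi} f" unfolding f_def by (intro continuous_intros rc)
  have Cf: "C n = 1 / (2 * pi) * integral {-pi..pi} (\<lambda>t. f t * cexp_mode (- n) t)" for n
  proof -
    have e: "exp (- (\<i> * of_int n * of_real t)) = cexp_mode (- n) t" for t by (simp add: cexp_mode_def)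
    have "integral {-pi..pi} (\<lambda>t. f t * cexp_mode (- n) t) =
      integral {-pi..pi} (\<lambda>t. of_real (radial_part ustar t) * cexp_mode (- n) t + \<i> * (of_real (angular_part ustar t) * cexp_mode (- n) t))"
      by (simp add: f_def distrib_right mult.assoc)
    also have "\<dots> = integral {-pi..pi} (\<lambda>t. of_real (radial_part ustar t) * cexp_mode (- n) t) +
       integral {-pi..pi} (\<lambda>t. \<i> * (of_real (angular_part ustar t) * cexp_mode (- n) t))"
      by (rule Henstock_Kurzweil_Integration.integral_add; intro integrable_continuous_interval continuous_intros rc)
    also have "integral {-pi..pi} (\<lambda>t. \<i> * (of_real (angular_part ustar t) * cexp_mode (- n) t)) = \<i> * integral {-pi..pi} (\<lambda>t. of_real (angular_part ustar t) * cexp_mode (- n) t)"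
      by (rule Henstock_Kurzweil_Integration.integral_mult_right)
    finally show ?thesis unfolding C_def fourier_coeff_def e by (simp add: algebra_simps add_divide_distrib)
  qed
  have "f \<theta> = (\<Sum>\<^sub>\<infinity>n. C n * cexp_mode n \<theta>)" by (rule fourier_inversion[OF fc mode_decay Cf t])
  then show ?thesis using vec2_polar[of \<theta> "radial_part ustar \<theta>" "angular_part ustar \<theta>"] polar_components[of ustar \<theta>]
    by (simp add: f_def)
qed

theorem theorem2:
  fixes \<mu>\<^sub>0 \<kappa> :: real
  assumes "\<mu>\<^sub>0 > sqrt 48" and "\<kappa> > 1"
  shows "\<forall>\<delta>>0. \<exists>\<epsilon>>0. \<forall>ustar :: real ^ 2 \<Rightarrow> real ^ 2.
     smooth_on_circle ustar \<longrightarrow>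
     circle_integral (\<lambda>x. ustar x \<bullet> x) = 0 \<longrightarrow>
     \<bar>1 / (2 * pi) * integral {-pi..pi} (angular_part ustar) - \<mu>\<^sub>0\<bar> < \<epsilon> \<longrightarrow>
     (SUP n\<in>UNIV - {0::int}. ereal ((1 + real_of_int \<bar>n\<bar>) powr (\<kappa> + 3) *
        (norm (fourier_coeff (radial_part ustar) n) + norm (fourier_coeff (angular_part ustar) n))))
       < ereal \<epsilon> \<longrightarrow>
     (\<exists>u p. steady_NS_solution ustar u p \<and>
       (\<exists>\<mu>. \<bar>\<mu> - \<mu>\<^sub>0\<bar> < \<delta> \<and>
         ((\<lambda>r. ereal r * Linf_norm (\<lambda>\<theta>. u (r *\<^sub>R e_r \<theta>) - (\<mu> / r) *\<^sub>R e_theta \<theta>)) \<longlongrightarrow> 0) at_top))"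
proof (intro allI impI)
  fix \<delta> :: real assume \<delta>: "\<delta> > 0"
  from mode_solution_exists[OF assms(1) \<delta>] obtain \<epsilon> where \<epsilon>: "\<epsilon> > 0"
    and sol: "\<forall>b v m. mode_data \<epsilon> b v m \<longrightarrow>
      (\<exists>\<psi> \<psi>1 w H \<alpha> K \<mu>. mode_solution \<mu>\<^sub>0 \<delta> b v m \<psi> \<psi>1 w H \<alpha> K \<mu>)"
    by blast
  show "\<exists>\<epsilon>>0. \<forall>ustar :: real ^ 2 \<Rightarrow> real ^ 2.
     smooth_on_circle ustar \<longrightarrow>
     circle_integral (\<lambda>x. ustar x \<bullet> x) = 0 \<longrightarrow>
     \<bar>1 / (2 * pi) * integral {-pi..pi} (angular_part ustar) - \<mu>\<^sub>0\<bar> < \<epsilon> \<longrightarrow>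
     (SUP n\<in>UNIV - {0::int}. ereal ((1 + real_of_int \<bar>n\<bar>) powr (\<kappa> + 3) *
        (norm (fourier_coeff (radial_part ustar) n) + norm (fourier_coeff (angular_part ustar) n))))
       < ereal \<epsilon> \<longrightarrow>
     (\<exists>u p. steady_NS_solution ustar u p \<and>
       (\<exists>\<mu>. \<bar>\<mu> - \<mu>\<^sub>0\<bar> < \<delta> \<and>
         ((\<lambda>r. ereal r * Linf_norm (\<lambda>\<theta>. u (r *\<^sub>R e_r \<theta>) - (\<mu> / r) *\<^sub>R e_theta \<theta>)) \<longlongrightarrow> 0) at_top))"
  proof (rule exI[of _ \<epsilon>], rule conjI[OF \<epsilon>], intro allI impI)
    fix ustar :: "real ^ 2 \<Rightarrow> real ^ 2"
    assume smooth: "smooth_on_circle ustar" and flux: "circle_integral (\<lambda>x. ustar x \<bullet> x) = 0"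
      and mean: "\<bar>1 / (2 * pi) * integral {-pi..pi} (angular_part ustar) - \<mu>\<^sub>0\<bar> < \<epsilon>"
      and sup: "(SUP n\<in>UNIV - {0::int}. ereal ((1 + real_of_int \<bar>n\<bar>) powr (\<kappa> + 3) *
        (norm (fourier_coeff (radial_part ustar) n) + norm (fourier_coeff (angular_part ustar) n)))) < ereal \<epsilon>"
    define uu where "uu n = fourier_coeff (radial_part ustar) n" for n
    define vv where "vv n = fourier_coeff (angular_part ustar) n" for n
    have cc: "continuous_on UNIV (\<lambda>\<theta>. ustar (e_r \<theta>))"
      using smooth unfolding smooth_on_circle_def smooth_on_def by (metis Ck_on.simps(1))
    \<comment> \<open>Three powers of decay: two for the weight and one for the derivative of the data.\<close>
    have uv: "jbracket n * (norm (uu n) + norm (vv n)) \<le> \<epsilon> * wt n" if n: "n \<noteq> 0" for n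
    proof -
      let ?x = "norm (uu n) + norm (vv n)"
      have "ereal (jbracket n powr (\<kappa> + 3) * ?x) < ereal \<epsilon>"
        unfolding jbracket_def uu_def vv_def by (rule le_less_trans[OF SUP_upper sup]) (use n in simp)
      then have "jbracket n powr (\<kappa> + 3) * ?x < \<epsilon>" by simp
      moreover have "jbracket n ^ 3 * ?x \<le> jbracket n powr (\<kappa> + 3) * ?x"
      proof (rule mult_right_mono)
        have "jbracket n ^ 3 = jbracket n powr 3" using jbracket_pos[of n] by (simp add: powr_numeral)
        also have "\<dots> \<le> jbracket n powr (\<kappa> + 3)" using assms(2) jbracket_ge1[of n] by (intro powr_mono) auto
        finally show "jbracket n ^ 3 \<le> jbracket n powr (\<kappa> + 3)" .
      qed simp
      ultimately have "jbracket n ^ 2 * (jbracket n * ?x) \<le> \<epsilon>" by (simp add: power2_eq_square power3_eq_cube mult.assoc)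
      then show ?thesis using jbracket_pos[of n] by (simp add: wt_jbracket pos_le_divide_eq mult.commute)
    qed
    have uv': "\<bar>of_int n\<bar> * (norm (uu n) + norm (vv n)) \<le> \<epsilon> * wt n" for n
    proof (cases "n = 0")
      case True
      then show ?thesis using \<epsilon> by (simp add: wt_def)
    next
      case False
      have "\<bar>of_int n\<bar> * (norm (uu n) + norm (vv n)) \<le> jbracket n * (norm (uu n) + norm (vv n))"
        by (intro mult_right_mono jbracket_abs) auto
      then show ?thesis using uv[OF False] by linarith
    qed
    have u0: "uu 0 = 0"
    proof -
      have "integral {-pi..pi} (radial_part ustar) = 0"
        using flux unfolding circle_integral_def radial_part_def[abs_def] .
      then show ?thesis by (simp add: uu_def fourier_coeff_0)
    qed
    \<comment> \<open>The radial velocity on the circle is \<open>- \<psi>_\<theta>\<close>. The zero flux condition removes its mode \<open>0\<close>,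
      which no single-valued stream function could produce.\<close>
    define b where "b n = (if n = 0 then 0 else \<i> * uu n / of_int n)" for n
    define m where "m = vv 0 - of_real \<mu>\<^sub>0"
    have m_real: "m = of_real (1 / (2 * pi) * integral {-pi..pi} (angular_part ustar) - \<mu>\<^sub>0)"
      by (simp add: m_def vv_def fourier_coeff_0)
    have nb: "of_int n * b n = \<i> * uu n" for n using u0 by (simp add: b_def)
    have c1: "b (- n) = cnj (b n)" for n by (simp add: b_def uu_def fourier_coeff_minus)
    have c2: "vv (- n) = cnj (vv n)" for n by (simp add: vv_def fourier_coeff_minus)
    have c3: "cnj m = m" unfolding m_real by simp
    have n1: "norm (uu n) + norm (vv n) \<le> \<epsilon> * wt n" if "n \<noteq> 0" for n
    proof -
      have "1 * (norm (uu n) + norm (vv n)) \<le> jbracket n * (norm (uu n) + norm (vv n))"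
        by (intro mult_right_mono jbracket_ge1) auto
      from order_trans[OF this uv[OF that]] show ?thesis by simp
    qed
    have c4: "norm (of_int n * b n) \<le> \<epsilon> * wt n" for n
    proof (cases "n = 0")
      case True
      then show ?thesis using \<epsilon> wt_pos[of 0] by simp
    next
      case False
      have "norm (uu n) \<le> \<epsilon> * wt n" using n1[OF False] norm_ge_zero[of "vv n"] by linarith
      then show ?thesis unfolding nb by (simp add: norm_mult)
    qed
    have c5: "norm m \<le> \<epsilon>" unfolding m_real norm_of_real using mean by simp
    have c6: "norm (of_int n * (vv n + of_int \<bar>n\<bar> * b n)) \<le> \<epsilon> * wt n" for n
    proof -
      have "norm (of_int \<bar>n\<bar> * b n) = norm (uu n)" using arg_cong[OF nb[of n], of norm] by (simp add: norm_mult)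
      then have "norm (vv n + of_int \<bar>n\<bar> * b n) \<le> norm (uu n) + norm (vv n)"
        using norm_triangle_ineq[of "vv n" "of_int \<bar>n\<bar> * b n"] by simp
      then have "norm (of_int n * (vv n + of_int \<bar>n\<bar> * b n)) \<le> \<bar>of_int n\<bar> * (norm (uu n) + norm (vv n))"
        unfolding norm_mult by (simp add: mult_left_mono)
      then show ?thesis using uv'[of n] by linarith
    qed
    have "mode_data \<epsilon> b vv m" unfolding mode_data_def by (intro conjI allI c1 c2 c3 c4 c5 c6)
    with sol obtain \<psi> \<psi>1 w H \<alpha> K \<mu> where "mode_solution \<mu>\<^sub>0 \<delta> b vv m \<psi> \<psi>1 w H \<alpha> K \<mu>" by blast
    then have S: "0 < \<alpha>" "rapid \<psi>" "rapid \<psi>1" "rapid w" "rapid H"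
      "fam_deriv \<psi> \<psi>1"
      "fam_deriv \<psi>1 (\<lambda>n s. of_int n * (of_int n * \<psi> n s) + of_real (exp (2 * s)) * w n s)"
      "fam_deriv w (\<lambda>n s. \<i> * (of_int n * H n s) + (- \<i>) * conv (\<lambda>n s. of_int n * \<psi> n s) w n s)"
      "fam_deriv H (\<lambda>n s. (- \<i>) * (of_int n * w n s) + conv \<psi>1 w n s)"
      "real_fam \<psi>" "real_fam w" "real_fam H"
      and cont: "\<forall>n. continuous_on {0..} (\<psi> n)" "\<forall>n. continuous_on {0..} (\<psi>1 n)"
      and exp_decay: "\<forall>n s. n \<noteq> 0 \<longrightarrow> 0 \<le> s \<longrightarrow> norm (of_int n * \<psi> n s) \<le> K * wt n * exp (- (\<alpha> * s)) \<and>
         norm (\<psi>1 n s) \<le> K * wt n * exp (- (\<alpha> * s))"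
      and dec0: "\<forall>s\<ge>0. norm (\<psi>1 0 s - of_real \<mu>) \<le> K * exp (- (\<alpha> * s))"
      and \<mu>: "\<bar>\<mu> - \<mu>\<^sub>0\<bar> < \<delta>"
      and bv: "\<forall>n. n \<noteq> 0 \<longrightarrow> \<psi> n 0 = b n \<and> \<psi>1 n 0 = vv n" and bv0: "\<psi>1 0 0 = of_real \<mu>\<^sub>0 + m"
      unfolding mode_solution_def by simp_all
    note boot = smooth_fam_bootstrap[OF S(2-9)]
    define u where "u x = vec2 (synth (velocity_fam \<psi> \<psi>1) x)" for x
    define p where "p x = Re (synth H x) - (norm (u x))\<^sup>2 / 2" for x
    have d1: "dfam \<psi> n s = \<psi>1 n s" if "0 < s" for n s using fam_deriv_dfam[OF S(6) that] .
    have d2: "dfam (dfam \<psi>) n s - of_int n * (of_int n * \<psi> n s) = of_real (exp (2 * s)) * w n s" if s: "0 < s" for n s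
      using dfam_cong[of "dfam \<psi>" \<psi>1 s n] d1 s fam_deriv_dfam[OF S(7) s, of n] by simp
    have d3: "dfam w n s = \<i> * (of_int n * H n s) - \<i> * conv (\<lambda>n s. of_int n * \<psi> n s) w n s" if "0 < s" for n s
      using fam_deriv_dfam[OF S(8) that, of n] by simp
    have d4: "dfam H n s = conv (dfam \<psi>) w n s - \<i> * (of_int n * w n s)" if s: "0 < s" for n s
    proof -
      have "conv (dfam \<psi>) w n s = conv \<psi>1 w n s" unfolding conv_def using d1[OF s] by simp
      then show ?thesis using fam_deriv_dfam[OF S(9) s, of n] by simp
    qed
    have ue: "u x = vec2 (synth (\<lambda>n s. 2 * \<i> * Dbar \<psi> n s) x)" if "x \<in> exterior" for x
    proof -
      have "velocity_fam \<psi> \<psi>1 n s = 2 * \<i> * Dbar \<psi> n s" if "0 < s" for n s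
        using d1[OF that, of "n - 1"] by (simp add: velocity_fam_def Dbar_def algebra_simps)
      then have "synth (velocity_fam \<psi> \<psi>1) x = synth (\<lambda>n s. 2 * \<i> * Dbar \<psi> n s) x"
        using that by (intro synth_cong) (simp_all add: exterior_iff)
      then show ?thesis by (simp add: u_def)
    qed
    note NS = steady_NS_of_mode_system[OF boot(1,3,4) S(10-12) d2 d3 d4 ue p_def]
    note vel = S(1) exp_decay[rule_format, THEN conjunct1] exp_decay[rule_format, THEN conjunct2] dec0[rule_format] cont[rule_format]
    have bdry: "u x = ustar x" if x: "x \<in> frontier (ball 0 1)" for x
    proof -
      have nx: "norm x = 1" using x by (simp add: frontier_ball)
      then have "x \<noteq> 0" by auto
      then obtain \<theta> where t: "\<theta> \<in> {-pi..pi}" "x = norm x *\<^sub>R e_r \<theta>" using polar_form_exists by blast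
      have xt: "x = 1 *\<^sub>R e_r \<theta>" using t(2) nx by simp
      let ?C = "\<lambda>n. uu n + \<i> * vv n"
      have bC: "norm (?C n) \<le> (\<epsilon> + norm (?C 0)) * wt n" for n
      proof (cases "n = 0")
        case True
        then show ?thesis using \<epsilon> by (simp add: wt_def)
      next
        case False
        have "norm (?C n) \<le> norm (uu n) + norm (vv n)" using norm_triangle_ineq[of "uu n" "\<i> * vv n"] by (simp add: norm_mult)
        also have "\<dots> \<le> \<epsilon> * wt n" by (rule n1[OF False])
        also have "\<dots> \<le> (\<epsilon> + norm (?C 0)) * wt n" using wt_pos[of n] by (intro mult_right_mono) auto
        finally show ?thesis .
      qed
      have coef: "\<i> * (\<psi>1 n 0 - of_int n * \<psi> n 0) = ?C n" for n
      proof (cases "n = 0")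
        case True
        then show ?thesis using bv0 u0 by (simp add: m_def)
      next
        case False
        then show ?thesis using bv nb[of n] by (simp add: algebra_simps)
      qed
      have "synth (velocity_fam \<psi> \<psi>1) x = of_real (1 / 1) * (\<i> * cexp_mode 1 \<theta>) * (\<Sum>\<^sub>\<infinity>m. (\<psi>1 m (ln 1) - of_int m * \<psi> m (ln 1)) * cexp_mode m \<theta>)"
        unfolding xt by (rule synth_velocity_fam_polar) simp
      also have "\<dots> = cexp_mode 1 \<theta> * (\<i> * (\<Sum>\<^sub>\<infinity>m. (\<psi>1 m 0 - of_int m * \<psi> m 0) * cexp_mode m \<theta>))" by simp
      also have "\<i> * (\<Sum>\<^sub>\<infinity>m. (\<psi>1 m 0 - of_int m * \<psi> m 0) * cexp_mode m \<theta>) = (\<Sum>\<^sub>\<infinity>m. ?C m * cexp_mode m \<theta>)"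
        unfolding infsum_cmult_right'[symmetric] mult.assoc[symmetric] coef ..
      finally have "u x = vec2 (cexp_mode 1 \<theta> * (\<Sum>\<^sub>\<infinity>m. ?C m * cexp_mode m \<theta>))" by (simp add: u_def)
      also have "\<dots> = ustar (e_r \<theta>)"
        using boundary_velocity[OF cc _ t(1), of "\<epsilon> + norm (?C 0)"] bC unfolding uu_def vv_def by blast
      finally show ?thesis using xt by simp
    qed
    have "continuous_on (closure exterior) u"
      unfolding exterior_closure u_def
      by (rule continuous_on_compose2[OF linear_continuous_on[OF bounded_linear_vec2, of UNIV] velocity_continuous[OF vel]]) auto
    moreover have "(u \<longlongrightarrow> 0) at_infinity" unfolding u_def[abs_def] by (rule velocity_tendsto_0[OF vel])
    ultimately have "steady_NS_solution ustar u p"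
      unfolding steady_NS_solution_def using NS bdry by blast
    moreover have "((\<lambda>r. ereal r * Linf_norm (\<lambda>\<theta>. u (r *\<^sub>R e_r \<theta>) - (\<mu> / r) *\<^sub>R e_theta \<theta>)) \<longlongrightarrow> 0) at_top"
      unfolding u_def by (rule velocity_Linf_limit[OF vel])
    ultimately show "\<exists>u p. steady_NS_solution ustar u p \<and>
       (\<exists>\<mu>. \<bar>\<mu> - \<mu>\<^sub>0\<bar> < \<delta> \<and>
         ((\<lambda>r. ereal r * Linf_norm (\<lambda>\<theta>. u (r *\<^sub>R e_r \<theta>) - (\<mu> / r) *\<^sub>R e_theta \<theta>)) \<longlongrightarrow> 0) at_top)"
      using \<mu> by blast
  qed
qed

end
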